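(* Let $1\leq p<\infty$, let $S_p$ be the unit sphere of the real Banach space $L^p[0,1]$ (with the norm topology), and let $G$ be the group of surjective linear isometries of $L^p[0,1]$, endowed with the strong operator topology. Then the greatest equivariant compactification $\beta_G(S_p)$ of the $G$-space $S_p$ is metrizable.
   Context: A $G$-space is a Tychonoff space $X$ with a continuous left action of the topological group $G$. An equivariant compactification of $X$ is a compact Hausdorff $G$-space $K$ with a continuous $G$-equivariant map $\nu\colon X\to K$ with dense image. The greatest equivariant compactification $\beta_G\colon X\to\beta_GX$ is the one such that every equivariant compactification $\nu\colon X\to K$ has the form $\nu=\pi\circ\beta_G$ for some continuous $\pi\colon\beta_GX\to K$. *)

theory Defs
  imports "HOL-Analysis.Analysis" "HOL-Algebra.Bij"
begin

no_notation eq_closure_of (\<open>closure'_of\<index>\<close>)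

section \<open>G-spaces and their equivariant compactifications\<close>

locale topological_group = group G
  for G :: "('g, 'b) monoid_scheme" (structure) and T :: "'g topology" +
  assumes topspace_group [simp]: "topspace T = carrier G"
    and continuous_mult: "continuous_map (prod_topology T T) T (\<lambda>(g, h). g \<otimes> h)"
    and continuous_inv: "continuous_map T T (\<lambda>g. inv g)"

definition continuous_left_action ::
  "('g, 'b) monoid_scheme \<Rightarrow> 'g topology \<Rightarrow> 'x topology \<Rightarrow> ('g \<Rightarrow> 'x \<Rightarrow> 'x) \<Rightarrow> bool"
  where "continuous_left_action G T X act \<longleftrightarrow>
    continuous_map (prod_topology T X) X (\<lambda>(g, x). act g x) \<and>
    (\<forall>x \<in> topspace X. act \<one>\<^bsub>G\<^esub> x = x) \<and>
    (\<forall>g \<in> carrier G. \<forall>h \<in> carrier G. \<forall>x \<in> topspace X.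
      act (g \<otimes>\<^bsub>G\<^esub> h) x = act g (act h x))"

text \<open>In the library, \<^const>\<open>completely_regular_space\<close> does not include any separation axiom.\<close>

locale G_space = topological_group G T
  for G :: "('g, 'b) monoid_scheme" (structure) and T :: "'g topology"
    and X :: "'x topology" and act :: "'g \<Rightarrow> 'x \<Rightarrow> 'x" +
  assumes completely_regular: "completely_regular_space X"
    and Hausdorff: "Hausdorff_space X"
    and action: "continuous_left_action G T X act"

definition equivariant_compactification ::
  "('g, 'b) monoid_scheme \<Rightarrow> 'g topology \<Rightarrow> 'x topology \<Rightarrow> ('g \<Rightarrow> 'x \<Rightarrow> 'x) \<Rightarrow>
    'k topology \<Rightarrow> ('g \<Rightarrow> 'k \<Rightarrow> 'k) \<Rightarrow> ('x \<Rightarrow> 'k) \<Rightarrow> bool"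
  where "equivariant_compactification G T X act K actK \<nu> \<longleftrightarrow>
    compact_space K \<and> Hausdorff_space K \<and> continuous_left_action G T K actK \<and>
    continuous_map X K \<nu> \<and>
    (\<forall>g \<in> carrier G. \<forall>x \<in> topspace X. \<nu> (act g x) = actK g (\<nu> x)) \<and>
    K closure_of (\<nu> ` topspace X) = topspace K"

text \<open>
  The universal property quantifies over compactifications carried by the type \<open>'x set set\<close>, as
  HOL cannot quantify over types. This loses nothing: sending a point of a compactification to the
  traces on \<open>X\<close> of its open neighbourhoods is injective, so every compactification has a copy on
  that type. See \<open>greatest_equivariant_compactification_universal\<close> and
  \<open>greatest_equivariant_compactification_exists\<close> below.
\<close>

definition greatest_equivariant_compactification ::
  "('g, 'b) monoid_scheme \<Rightarrow> 'g topology \<Rightarrow> 'x topology \<Rightarrow> ('g \<Rightarrow> 'x \<Rightarrow> 'x) \<Rightarrow>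
    'k topology \<Rightarrow> ('g \<Rightarrow> 'k \<Rightarrow> 'k) \<Rightarrow> ('x \<Rightarrow> 'k) \<Rightarrow> bool"
  where "greatest_equivariant_compactification G T X act B actB \<beta> \<longleftrightarrow>
    equivariant_compactification G T X act B actB \<beta> \<and>
    (\<forall>(K :: 'x set set topology) actK \<nu>. equivariant_compactification G T X act K actK \<nu> \<longrightarrow>
      (\<exists>\<pi>. continuous_map B K \<pi> \<and> (\<forall>x \<in> topspace X. \<nu> x = \<pi> (\<beta> x))))"

lemma continuous_left_action_continuous:
  "continuous_left_action G T X act \<Longrightarrow> continuous_map (prod_topology T X) X (\<lambda>(g, x). act g x)"
  by (simp add: continuous_left_action_def)

lemma continuous_left_action_closed:
  assumes "continuous_left_action G T X act" "topspace T = carrier G" "g \<in> carrier G" "x \<in> topspace X"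
  shows "act g x \<in> topspace X"
proof -
  have "(\<lambda>(g, x). act g x) \<in> topspace (prod_topology T X) \<rightarrow> topspace X"
    using assms(1) unfolding continuous_left_action_def by (blast dest: continuous_map_funspace)
  moreover have "(g, x) \<in> topspace (prod_topology T X)" using assms by simp
  ultimately have "(\<lambda>(g, x). act g x) (g, x) \<in> topspace X" by (rule funcset_mem)
  then show ?thesis by simp
qed

lemma equivariant_compactification_transfer:
  fixes G :: "('g, 'b) monoid_scheme" and X :: "'x topology" and K :: "'k topology"
  assumes ec: "equivariant_compactification G T X act K actK \<nu>" and T: "topspace T = carrier G"
  obtains K' :: "'x set set topology" and actK' h h'
  where "homeomorphic_maps K K' h h'" "equivariant_compactification G T X act K' actK' (h \<circ> \<nu>)"
proof -
  have K: "compact_space K" "Hausdorff_space K" "continuous_left_action G T K actK"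
    "continuous_map X K \<nu>" "\<And>g x. g \<in> carrier G \<Longrightarrow> x \<in> topspace X \<Longrightarrow> \<nu> (act g x) = actK g (\<nu> x)"
    and dense: "K closure_of (\<nu> ` topspace X) = topspace K"
    using ec unfolding equivariant_compactification_def by auto
  define h where "h k = {V. \<exists>U. openin K U \<and> k \<in> U \<and> V = {x \<in> topspace X. \<nu> x \<in> U}}" for k
  have inj: "inj_on h (topspace K)"
  proof (rule inj_onI, rule ccontr)
    fix k l assume kl: "k \<in> topspace K" "l \<in> topspace K" "h k = h l" "k \<noteq> l"
    obtain U W where UW: "openin K U" "openin K W" "k \<in> U" "l \<in> W" "disjnt U W"
      using K(2)[unfolded Hausdorff_space_def, rule_format, of k l] kl(1,2,4) by blast
    have "{x \<in> topspace X. \<nu> x \<in> U} \<in> h k"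
      unfolding h_def mem_Collect_eq using UW by (intro exI[of _ U]) simp
    then have "{x \<in> topspace X. \<nu> x \<in> U} \<in> h l" by (simp only: kl(3))
    then obtain U' where U': "openin K U'" "l \<in> U'" "{x \<in> topspace X. \<nu> x \<in> U} = {x \<in> topspace X. \<nu> x \<in> U'}"
      by (auto simp: h_def)
    have "openin K (U' \<inter> W)" "l \<in> U' \<inter> W" using U' UW by auto
    moreover have "l \<in> K closure_of (\<nu> ` topspace X)" using dense kl by simp
    ultimately obtain y where "y \<in> \<nu> ` topspace X" "y \<in> U' \<inter> W"
      using in_closure_of[of l K "\<nu> ` topspace X"] by metis
    then obtain x where "x \<in> topspace X" "\<nu> x \<in> U'" "\<nu> x \<in> W" by auto
    moreover from this have "\<nu> x \<in> U" using U'(3) by blast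
    ultimately show False using UW(5) by (auto simp: disjnt_def)
  qed
  define h' where "h' = inv_into (topspace K) h"
  have h'h [simp]: "h' (h k) = k" if "k \<in> topspace K" for k
    using inj that by (simp add: h'_def)
  define K' where "K' = pullback_topology (h ` topspace K) h' K"
  have topK': "topspace K' = h ` topspace K"
    unfolding K'_def topspace_pullback_topology by auto
  have hh: "homeomorphic_maps K K' h h'"
    unfolding homeomorphic_maps_def
  proof (intro conjI ballI)
    have "continuous_map K K (h' \<circ> h)"
      using continuous_map_id by (rule continuous_map_eq) auto
    then show "continuous_map K K' h"
      unfolding K'_def by (rule continuous_map_pullback') auto
    have "continuous_map K' K (id \<circ> h')"
      unfolding K'_def by (rule continuous_map_pullback) (rule continuous_map_id)
    then show "continuous_map K' K h'" by simp
  qed (auto simp: topK')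
  then have ch: "continuous_map K K' h" and ch': "continuous_map K' K h'"
    by (auto simp: homeomorphic_maps_def)
  have homeo: "K homeomorphic_space K'"
    using hh homeomorphic_space_def by blast
  define actK' where "actK' g y = h (actK g (h' y))" for g y
  note closed = continuous_left_action_closed[OF K(3) T]
  have "continuous_left_action G T K' actK'"
    unfolding continuous_left_action_def
  proof (intro conjI ballI)
    have "continuous_map (prod_topology T K') (prod_topology T K) (\<lambda>z. (fst z, h' (snd z)))"
      by (intro continuous_map_pairedI continuous_map_fst continuous_map_compose[OF continuous_map_snd ch', unfolded o_def])
    moreover have "continuous_map (prod_topology T K) K' (h \<circ> (\<lambda>(g, x). actK g x))"
      using continuous_left_action_continuous[OF K(3)] ch by (rule continuous_map_compose)
    ultimately have "continuous_map (prod_topology T K') K' ((h \<circ> (\<lambda>(g, x). actK g x)) \<circ> (\<lambda>z. (fst z, h' (snd z))))"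
      by (rule continuous_map_compose)
    then show "continuous_map (prod_topology T K') K' (\<lambda>(g, x). actK' g x)"
      by (simp add: o_def case_prod_unfold actK'_def)
  qed (use K(3) closed in \<open>auto simp: topK' actK'_def continuous_left_action_def\<close>)
  moreover have "K' closure_of ((h \<circ> \<nu>) ` topspace X) = topspace K'"
  proof -
    have "h ` (K closure_of (\<nu> ` topspace X)) \<subseteq> K' closure_of (h ` (\<nu> ` topspace X))"
      using ch by (rule continuous_map_image_closure_subset)
    then show ?thesis
      using closure_of_subset_topspace[of K' "h ` (\<nu> ` topspace X)"]
      by (simp add: image_comp dense topK' subset_antisym)
  qed
  moreover have "compact_space K'" "Hausdorff_space K'"
    using K homeo homeomorphic_compact_space homeomorphic_Hausdorff_space by blast+
  moreover have "continuous_map X K' (h \<circ> \<nu>)"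
    using K(4) ch by (rule continuous_map_compose)
  moreover have "(h \<circ> \<nu>) (act g x) = actK' g ((h \<circ> \<nu>) x)" if "g \<in> carrier G" "x \<in> topspace X" for g x
  proof -
    have "\<nu> x \<in> topspace K" using K(4) that by (auto simp: continuous_map_def)
    with that K(5) show ?thesis by (simp add: actK'_def)
  qed
  ultimately have "equivariant_compactification G T X act K' actK' (h \<circ> \<nu>)"
    unfolding equivariant_compactification_def by blast
  with hh that show ?thesis by blast
qed

lemma greatest_equivariant_compactification_universal:
  fixes G :: "('g, 'b) monoid_scheme" and X :: "'x topology" and K :: "'k topology"
  assumes gec: "greatest_equivariant_compactification G T X act B actB \<beta>"
    and T: "topspace T = carrier G"
    and ec: "equivariant_compactification G T X act K actK \<nu>"
  shows "\<exists>\<pi>. continuous_map B K \<pi> \<and> (\<forall>x \<in> topspace X. \<nu> x = \<pi> (\<beta> x))"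
proof -
  obtain K' :: "'x set set topology" and actK' h h'
    where h: "homeomorphic_maps K K' h h'" and ec': "equivariant_compactification G T X act K' actK' (h \<circ> \<nu>)"
    by (rule equivariant_compactification_transfer[OF ec T])
  have "\<exists>\<pi>. continuous_map B K' \<pi> \<and> (\<forall>x \<in> topspace X. (h \<circ> \<nu>) x = \<pi> (\<beta> x))"
    by (rule gec[unfolded greatest_equivariant_compactification_def, THEN conjunct2, rule_format, OF ec'])
  then obtain \<pi> where \<pi>: "continuous_map B K' \<pi>" "\<And>x. x \<in> topspace X \<Longrightarrow> (h \<circ> \<nu>) x = \<pi> (\<beta> x)"
    by blast
  have "continuous_map B K (h' \<circ> \<pi>)"
    using \<pi>(1) h[unfolded homeomorphic_maps_def, THEN conjunct2, THEN conjunct1] by (rule continuous_map_compose)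
  moreover have "\<nu> x = (h' \<circ> \<pi>) (\<beta> x)" if "x \<in> topspace X" for x
  proof -
    have "\<nu> x \<in> topspace K"
      using ec that by (auto simp: equivariant_compactification_def continuous_map_def)
    then have "h' (h (\<nu> x)) = \<nu> x" using h by (simp add: homeomorphic_maps_def)
    with \<pi>(2)[OF that] show ?thesis by simp
  qed
  ultimately show ?thesis by (intro exI conjI ballI)
qed

lemma (in G_space) greatest_equivariant_compactification_exists:
  "\<exists>(B :: 'x set set topology) actB \<beta>. greatest_equivariant_compactification G T X act B actB \<beta>"
proof -
  define I where "I = {(K :: 'x set set topology, actK, \<nu>). equivariant_compactification G T X act K actK \<nu>}"
  define P where "P = product_topology fst I"
  define e where "e x = (\<lambda>i\<in>I. snd (snd i) x)" for x
  define a where "a g y = (\<lambda>i\<in>I. fst (snd i) g (y i))" for g :: 'g and y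
  define B where "B = subtopology P (P closure_of (e ` topspace X))"
  have I: "equivariant_compactification G T X act (fst i) (fst (snd i)) (snd (snd i))" if "i \<in> I" for i
    using that by (auto simp: I_def)
  then have acti: "continuous_left_action G T (fst i) (fst (snd i))" if "i \<in> I" for i
    using that by (auto simp: equivariant_compactification_def)
  have ce: "continuous_map X P e"
  proof -
    have "continuous_map X (fst i) (\<lambda>x. e x i)" if "i \<in> I" for i
      using I[OF that] that by (simp add: equivariant_compactification_def e_def)
    then show ?thesis
      unfolding P_def continuous_map_componentwise by (auto simp: e_def)
  qed
  have e_sub: "e ` topspace X \<subseteq> topspace P"
    using ce by (auto simp: continuous_map_def)
  have actP: "continuous_left_action G T P a"
    unfolding continuous_left_action_def
  proof (intro conjI ballI)
    have "continuous_map (prod_topology T P) (fst i) (\<lambda>z. fst (snd i) (fst z) (snd z i))" if i: "i \<in> I" for i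
    proof -
      have "continuous_map P (fst i) (\<lambda>y. y i)"
        unfolding P_def using i by (rule continuous_map_product_projection)
      then have "continuous_map (prod_topology T P) (prod_topology T (fst i)) (\<lambda>z. (fst z, snd z i))"
        by (intro continuous_map_pairedI continuous_map_fst continuous_map_compose[OF continuous_map_snd, unfolded o_def])
      then have "continuous_map (prod_topology T P) (fst i) ((\<lambda>(g, x). fst (snd i) g x) \<circ> (\<lambda>z. (fst z, snd z i)))"
        using continuous_left_action_continuous[OF acti[OF i]] by (rule continuous_map_compose)
      then show ?thesis by (simp add: o_def)
    qed
    then have "continuous_map (prod_topology T P) P (\<lambda>z. \<lambda>i\<in>I. fst (snd i) (fst z) (snd z i))"
      unfolding P_def continuous_map_componentwise by auto
    then show "continuous_map (prod_topology T P) P (\<lambda>(g, x). a g x)"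
      by (simp add: case_prod_unfold a_def)
  next
    fix y assume "y \<in> topspace P"
    then have y: "y \<in> (\<Pi>\<^sub>E i\<in>I. topspace (fst i))" by (simp add: P_def)
    have yi: "y i \<in> topspace (fst i)" if "i \<in> I" for i
      using y that by (rule PiE_mem)
    show "a \<one> y = y"
    proof (rule extensionalityI)
      show "y \<in> extensional I" using y by (simp add: PiE_def)
      show "a \<one> y i = y i" if "i \<in> I" for i
        using acti[OF that] yi[OF that] that by (simp add: a_def continuous_left_action_def)
    qed (simp add: a_def)
    fix g h assume gh: "g \<in> carrier G" "h \<in> carrier G"
    show "a (g \<otimes> h) y = a g (a h y)"
    proof (rule extensionalityI)
      show "a (g \<otimes> h) y i = a g (a h y) i" if "i \<in> I" for i
        using acti[OF that] yi[OF that] gh that by (simp add: a_def continuous_left_action_def)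
    qed (simp_all add: a_def)
  qed
  have equiv: "e (act g x) = a g (e x)" if "g \<in> carrier G" "x \<in> topspace X" for g x
  proof (rule extensionalityI)
    show "e (act g x) i = a g (e x) i" if "i \<in> I" for i
      using I[OF that] that \<open>g \<in> carrier G\<close> \<open>x \<in> topspace X\<close>
      by (simp add: e_def a_def equivariant_compactification_def)
  qed (simp_all add: e_def a_def)
  have a_cont: "continuous_map P P (a g)" if "g \<in> carrier G" for g
  proof -
    have "continuous_map P (prod_topology T P) (\<lambda>y. (g, y))"
      using that by (intro continuous_map_pairedI) auto
    then have "continuous_map P P ((\<lambda>(g, x). a g x) \<circ> (\<lambda>y. (g, y)))"
      using continuous_left_action_continuous[OF actP] by (rule continuous_map_compose)
    then show ?thesis by (simp add: o_def)
  qed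
  have topB: "topspace B = P closure_of (e ` topspace X)"
    using closure_of_subset_topspace[of P] by (auto simp: B_def)
  have a_closed: "a g y \<in> topspace B" if "g \<in> carrier G" "y \<in> topspace B" for g y
  proof -
    have "a g ` (P closure_of (e ` topspace X)) \<subseteq> P closure_of (a g ` (e ` topspace X))"
      using a_cont[OF that(1)] by (rule continuous_map_image_closure_subset)
    also have "\<dots> \<subseteq> P closure_of (e ` topspace X)"
    proof (rule closure_of_mono)
      show "a g ` (e ` topspace X) \<subseteq> e ` topspace X"
      proof clarify
        fix x assume x: "x \<in> topspace X"
        have "a g (e x) = e (act g x)" using equiv that(1) x by simp
        moreover have "act g x \<in> topspace X"
          using continuous_left_action_closed[OF action topspace_group that(1) x] .
        ultimately show "a g (e x) \<in> e ` topspace X" by simp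
      qed
    qed
    finally show ?thesis using that(2) topB by blast
  qed
  have B_sub: "topspace B \<subseteq> topspace P" by (simp add: B_def)
  have actB: "continuous_left_action G T B a"
    unfolding continuous_left_action_def
  proof (intro conjI ballI)
    have "prod_topology T B = subtopology (prod_topology T P) (topspace T \<times> P closure_of (e ` topspace X))"
      unfolding B_def by (rule prod_topology_subtopology(2))
    then have "continuous_map (prod_topology T B) P (\<lambda>(g, x). a g x)"
      using continuous_left_action_continuous[OF actP] by (simp add: continuous_map_from_subtopology)
    moreover have "(\<lambda>(g, x). a g x) \<in> topspace (prod_topology T B) \<rightarrow> P closure_of (e ` topspace X)"
      using a_closed topB by auto
    ultimately show "continuous_map (prod_topology T B) B (\<lambda>(g, x). a g x)"
      unfolding B_def continuous_map_in_subtopology by blast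
  next
    fix y assume "y \<in> topspace B"
    then have y: "y \<in> topspace P" using B_sub by blast
    show "a \<one> y = y" using actP y by (simp add: continuous_left_action_def)
    show "a (g \<otimes> h) y = a g (a h y)" if "g \<in> carrier G" "h \<in> carrier G" for g h
      using actP y that by (simp add: continuous_left_action_def)
  qed
  have "compact_space P" "Hausdorff_space P"
    unfolding P_def compact_space_product_topology Hausdorff_space_product_topology
    using I by (simp_all add: equivariant_compactification_def)
  then have "compact_space B" "Hausdorff_space B"
    unfolding B_def
    by (simp_all add: Hausdorff_space_subtopology compact_space_subtopology closedin_compact_space)
  moreover have "e ` topspace X \<subseteq> topspace B"
    using closure_of_subset[OF e_sub] topB by simp
  moreover from this have "continuous_map X B e"
    using ce topB by (simp add: B_def continuous_map_in_subtopology image_subset_iff_funcset)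
  moreover have "B closure_of (e ` topspace X) = topspace B"
    using closure_of_subset[OF e_sub] topB
    by (simp add: B_def closure_of_subtopology Int_absorb1)
  ultimately have ecB: "equivariant_compactification G T X act B a e"
    using actB equiv by (simp add: equivariant_compactification_def)
  obtain B' :: "'x set set topology" and aB' h h'
    where h: "homeomorphic_maps B B' h h'" and ecB': "equivariant_compactification G T X act B' aB' (h \<circ> e)"
    by (rule equivariant_compactification_transfer[OF ecB topspace_group])
  have univ: "\<exists>\<pi>. continuous_map B' K \<pi> \<and> (\<forall>x \<in> topspace X. \<nu> x = \<pi> ((h \<circ> e) x))"
    if "equivariant_compactification G T X act K actK \<nu>" for K :: "'x set set topology" and actK \<nu>
  proof -
    have i: "(K, actK, \<nu>) \<in> I" using that by (simp add: I_def)
    then have "continuous_map P K (\<lambda>y. y (K, actK, \<nu>))"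
      unfolding P_def by (metis continuous_map_product_projection fst_conv)
    then have "continuous_map B K (\<lambda>y. y (K, actK, \<nu>))"
      unfolding B_def by (rule continuous_map_from_subtopology)
    then have "continuous_map B' K ((\<lambda>y. y (K, actK, \<nu>)) \<circ> h')"
      by (rule continuous_map_compose[OF h[unfolded homeomorphic_maps_def, THEN conjunct2, THEN conjunct1]])
    moreover have "\<nu> x = ((\<lambda>y. y (K, actK, \<nu>)) \<circ> h') ((h \<circ> e) x)" if "x \<in> topspace X" for x
    proof -
      have "h' (h (e x)) = e x"
        using h that \<open>e ` topspace X \<subseteq> topspace B\<close> by (auto simp: homeomorphic_maps_def)
      with i show ?thesis by (simp add: e_def)
    qed
    ultimately show ?thesis by blast
  qed
  have "greatest_equivariant_compactification G T X act B' aB' (h \<circ> e)"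
    unfolding greatest_equivariant_compactification_def
    by (intro conjI allI impI ecB') (rule univ)
  then show ?thesis by (intro exI)
qed


section \<open>The Banach space L^p[0,1]\<close>

abbreviation unit_interval_measure :: "real measure"
  where "unit_interval_measure \<equiv> lebesgue_on {0..1}"

text \<open>All measurable functions modulo equality almost everywhere; every \<open>L^p\<close> is a subspace.\<close>

quotient_type L0 = "real \<Rightarrow> real" /
  partial: "\<lambda>f g. f \<in> borel_measurable unit_interval_measure \<and> g \<in> borel_measurable unit_interval_measure \<and>
    (AE x in unit_interval_measure. f x = g x)"
proof (rule part_equivpI)
  show "\<exists>f :: real \<Rightarrow> real. f \<in> borel_measurable unit_interval_measure \<and> f \<in> borel_measurable unit_interval_measure \<and>
    (AE x in unit_interval_measure. f x = f x)"
    by (rule exI[of _ "\<lambda>_. 0"]) simp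
qed (auto intro!: sympI transpI elim: AE_mp)

instantiation L0 :: real_vector
begin

lift_definition zero_L0 :: L0 is "\<lambda>_. 0" by simp

lift_definition plus_L0 :: "L0 \<Rightarrow> L0 \<Rightarrow> L0" is "\<lambda>f g x. f x + g x"
  by (auto elim: AE_mp)

lift_definition uminus_L0 :: "L0 \<Rightarrow> L0" is "\<lambda>f x. - f x"
  by auto

lift_definition minus_L0 :: "L0 \<Rightarrow> L0 \<Rightarrow> L0" is "\<lambda>f g x. f x - g x"
  by (auto elim: AE_mp)

lift_definition scaleR_L0 :: "real \<Rightarrow> L0 \<Rightarrow> L0" is "\<lambda>c f x. c * f x"
  by (auto elim: AE_mp)

instance
  by standard (transfer; auto simp: algebra_simps)+

end

lift_definition p_integrable :: "real \<Rightarrow> L0 \<Rightarrow> bool"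
  is "\<lambda>p f. integrable unit_interval_measure (\<lambda>x. \<bar>f x\<bar> powr p)"
  by (rule integrable_cong_AE) (auto elim: AE_mp)

lift_definition Lp_norm :: "real \<Rightarrow> L0 \<Rightarrow> real"
  is "\<lambda>p f. (\<integral>x. \<bar>f x\<bar> powr p \<partial>unit_interval_measure) powr (1 / p)"
  by (rule arg_cong[where f = "\<lambda>I. I powr _"], rule integral_cong_AE) (auto elim: AE_mp)

definition Lp :: "real \<Rightarrow> L0 set"
  where "Lp p = {f. p_integrable p f}"

definition Lp_topology :: "real \<Rightarrow> L0 topology"
  where "Lp_topology p = Metric_space.mtopology (Lp p) (\<lambda>f g. Lp_norm p (f - g))"

definition Lp_sphere :: "real \<Rightarrow> L0 topology"
  where "Lp_sphere p = subtopology (Lp_topology p) {f \<in> Lp p. Lp_norm p f = 1}"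

text \<open>
  Elements of \<^term>\<open>Bij S\<close> are \<^const>\<open>undefined\<close> outside \<open>S\<close>, so each surjective linear isometry
  of the subspace \<open>Lp p\<close> is represented by exactly one function on \<^typ>\<open>L0\<close>.
\<close>

definition Lp_isometries :: "real \<Rightarrow> (L0 \<Rightarrow> L0) set"
  where "Lp_isometries p = {T \<in> Bij (Lp p).
    (\<forall>f \<in> Lp p. \<forall>g \<in> Lp p. T (f + g) = T f + T g) \<and>
    (\<forall>c. \<forall>f \<in> Lp p. T (c *\<^sub>R f) = c *\<^sub>R T f) \<and>
    (\<forall>f \<in> Lp p. Lp_norm p (T f) = Lp_norm p f)}"

definition Lp_isometry_group :: "real \<Rightarrow> (L0 \<Rightarrow> L0) monoid"
  where "Lp_isometry_group p = (BijGroup (Lp p))\<lparr>carrier := Lp_isometries p\<rparr>"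

text \<open>The strong operator topology is the topology of pointwise norm convergence.\<close>

definition Lp_strong_operator_topology :: "real \<Rightarrow> (L0 \<Rightarrow> L0) topology"
  where "Lp_strong_operator_topology p =
    subtopology (product_topology (\<lambda>_. Lp_topology p) (Lp p)) (Lp_isometries p)"


section \<open>The unit sphere of L^p[0,1] is a G-space\<close>

lemma powr_weighted_sum_le:
  fixes u v a b p :: real
  assumes "0 \<le> u" "0 \<le> v" "0 < a" "0 < b" "1 \<le> p"
  shows "(u + v) powr p \<le> (a + b) powr p * (a / (a + b) * (u powr p / a powr p) + b / (a + b) * (v powr p / b powr p))"
proof -
  have aux: "w powr p \<le> (a + b) powr p * (c / (a + b) * (w powr p / c powr p))"
    if "0 < c" "c \<le> a + b" "0 \<le> w" for w c
  proof -
    have "1 \<le> ((a + b) / c) powr (p - 1)"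
      using that assms by (intro ge_one_powr_ge_zero) auto
    also have "\<dots> = (a + b) powr p * (c / (a + b) * (1 / c powr p))"
      using that assms by (simp add: powr_divide powr_diff)
    finally have "w powr p * 1 \<le> w powr p * ((a + b) powr p * (c / (a + b) * (1 / c powr p)))"
      by (rule mult_left_mono) simp
    then show ?thesis by (simp add: ac_simps)
  qed
  consider "u = 0" | "v = 0" | "0 < u" "0 < v" using assms by fastforce
  then show ?thesis
  proof cases
    case 1
    then show ?thesis using aux[of b v] assms by simp
  next
    case 2
    then show ?thesis using aux[of a u] assms by simp
  next
    case 3
    have "((1 - b / (a + b)) *\<^sub>R (u / a) + (b / (a + b)) *\<^sub>R (v / b)) powr p
      \<le> (1 - b / (a + b)) * (u / a) powr p + b / (a + b) * (v / b) powr p"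
      using 3 assms by (intro convex_onD[OF powr_convex]) auto
    moreover have "1 - b / (a + b) = a / (a + b)" using assms by (simp add: field_simps)
    ultimately have "(u / (a + b) + v / (a + b)) powr p
      \<le> a / (a + b) * (u powr p / a powr p) + b / (a + b) * (v powr p / b powr p)"
      using 3 assms by (simp add: powr_divide)
    then have "((u + v) / (a + b)) powr p
      \<le> a / (a + b) * (u powr p / a powr p) + b / (a + b) * (v powr p / b powr p)"
      by (simp add: add_divide_distrib)
    then have "(a + b) powr p * ((u + v) / (a + b)) powr p
      \<le> (a + b) powr p * (a / (a + b) * (u powr p / a powr p) + b / (a + b) * (v powr p / b powr p))"
      by (rule mult_left_mono) simp
    moreover have "(a + b) powr p * ((u + v) / (a + b)) powr p = (u + v) powr p"
      using 3 assms by (simp add: powr_divide)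
    ultimately show ?thesis by simp
  qed
qed

lemma abs_sum_powr_le:
  fixes x y a b p :: real
  assumes "0 < a" "0 < b" "1 \<le> p"
  shows "\<bar>x + y\<bar> powr p
    \<le> (a + b) powr p * (a / (a + b) * (\<bar>x\<bar> powr p / a powr p) + b / (a + b) * (\<bar>y\<bar> powr p / b powr p))"
proof -
  have "\<bar>x + y\<bar> powr p \<le> (\<bar>x\<bar> + \<bar>y\<bar>) powr p"
    using assms by (intro powr_mono2) auto
  also have "\<dots> \<le> (a + b) powr p * (a / (a + b) * (\<bar>x\<bar> powr p / a powr p) + b / (a + b) * (\<bar>y\<bar> powr p / b powr p))"
    using assms by (intro powr_weighted_sum_le) auto
  finally show ?thesis .
qed

lemma p_integrable_add:
  assumes "1 \<le> p"
  shows "p_integrable p f \<Longrightarrow> p_integrable p g \<Longrightarrow> p_integrable p (f + g)"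
proof (transfer fixing: p)
  fix f g :: "real \<Rightarrow> real"
  assume f: "f \<in> borel_measurable unit_interval_measure \<and> f \<in> borel_measurable unit_interval_measure \<and>
      (AE x in unit_interval_measure. f x = f x)"
    and g: "g \<in> borel_measurable unit_interval_measure \<and> g \<in> borel_measurable unit_interval_measure \<and>
      (AE x in unit_interval_measure. g x = g x)"
    and i: "integrable unit_interval_measure (\<lambda>x. \<bar>f x\<bar> powr p)"
      "integrable unit_interval_measure (\<lambda>x. \<bar>g x\<bar> powr p)"
  show "integrable unit_interval_measure (\<lambda>x. \<bar>f x + g x\<bar> powr p)"
  proof (rule Bochner_Integration.integrable_bound)
    show "integrable unit_interval_measure
      (\<lambda>x. 2 powr p * (1 / 2 * \<bar>f x\<bar> powr p + 1 / 2 * \<bar>g x\<bar> powr p))"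
      using i by simp
    show "(\<lambda>x. \<bar>f x + g x\<bar> powr p) \<in> borel_measurable unit_interval_measure"
      using f g by simp
    show "AE x in unit_interval_measure. norm (\<bar>f x + g x\<bar> powr p)
      \<le> norm (2 powr p * (1 / 2 * \<bar>f x\<bar> powr p + 1 / 2 * \<bar>g x\<bar> powr p))"
    proof (rule AE_I2)
      show "norm (\<bar>f x + g x\<bar> powr p)
      \<le> norm (2 powr p * (1 / 2 * \<bar>f x\<bar> powr p + 1 / 2 * \<bar>g x\<bar> powr p))" for x
        using abs_sum_powr_le[of 1 1 p "f x" "g x"] assms by simp
    qed
  qed
qed

lemma p_integrable_scaleR: "p_integrable p f \<Longrightarrow> p_integrable p (c *\<^sub>R f)"
  by transfer (simp add: abs_mult powr_mult)

lemma p_integrable_zero: "p_integrable p 0"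
  by transfer simp

lemma Lp_norm_scaleR: "1 \<le> p \<Longrightarrow> Lp_norm p (c *\<^sub>R f) = \<bar>c\<bar> * Lp_norm p f"
  by transfer (simp add: abs_mult powr_mult powr_powr)

lemma Lp_norm_nonneg: "0 \<le> Lp_norm p f"
  by transfer simp

lemma Lp_norm_zero [simp]: "Lp_norm p 0 = 0"
  by transfer simp

lemma Lp_norm_eq_0D: "p_integrable p f \<Longrightarrow> Lp_norm p f = 0 \<Longrightarrow> f = 0"
proof transfer
  fix p :: real and f :: "real \<Rightarrow> real"
  assume f: "f \<in> borel_measurable unit_interval_measure \<and> f \<in> borel_measurable unit_interval_measure \<and>
      (AE x in unit_interval_measure. f x = f x)"
    and i: "integrable unit_interval_measure (\<lambda>x. \<bar>f x\<bar> powr p)"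
    and z: "(\<integral>x. \<bar>f x\<bar> powr p \<partial>unit_interval_measure) powr (1 / p) = 0"
  then have "AE x in unit_interval_measure. \<bar>f x\<bar> powr p = 0"
    using integral_nonneg_eq_0_iff_AE[OF i] by simp
  then have "AE x in unit_interval_measure. f x = 0" by simp
  then show "f \<in> borel_measurable unit_interval_measure \<and> (\<lambda>_. 0) \<in> borel_measurable unit_interval_measure \<and>
      (AE x in unit_interval_measure. f x = 0)"
    using f by simp
qed

lemma Lp_norm_add:
  assumes p: "1 \<le> p"
  shows "p_integrable p f \<Longrightarrow> p_integrable p g \<Longrightarrow> Lp_norm p (f + g) \<le> Lp_norm p f + Lp_norm p g"
proof -
  assume fg: "p_integrable p f" "p_integrable p g"
  show ?thesis
  proof (cases "Lp_norm p f = 0 \<or> Lp_norm p g = 0")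
    case True
    then have "f = 0 \<or> g = 0" using fg Lp_norm_eq_0D by blast
    then show ?thesis by auto
  next
    case False
    define a where "a = Lp_norm p f"
    define b where "b = Lp_norm p g"
    have ab: "0 < a" "0 < b"
      using False Lp_norm_nonneg[of p f] Lp_norm_nonneg[of p g] by (auto simp: a_def b_def)
    have "Lp_norm p (f + g) \<le> a + b"
      using fg a_def b_def p_integrable_add[OF p fg]
    proof (transfer fixing: p a b)
      fix f g :: "real \<Rightarrow> real"
      assume i: "integrable unit_interval_measure (\<lambda>x. \<bar>f x\<bar> powr p)"
          "integrable unit_interval_measure (\<lambda>x. \<bar>g x\<bar> powr p)"
          "integrable unit_interval_measure (\<lambda>x. \<bar>f x + g x\<bar> powr p)"
        and a: "a = (\<integral>x. \<bar>f x\<bar> powr p \<partial>unit_interval_measure) powr (1 / p)"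
        and b: "b = (\<integral>x. \<bar>g x\<bar> powr p \<partial>unit_interval_measure) powr (1 / p)"
      have "(\<integral>x. \<bar>f x + g x\<bar> powr p \<partial>unit_interval_measure) \<le> (\<integral>x. (a + b) powr p *
        (a / (a + b) * (\<bar>f x\<bar> powr p / a powr p) + b / (a + b) * (\<bar>g x\<bar> powr p / b powr p)) \<partial>unit_interval_measure)"
        using i ab p by (intro integral_mono abs_sum_powr_le) simp_all
      also have "\<dots> = (a + b) powr p *
        (a / (a + b) * ((\<integral>x. \<bar>f x\<bar> powr p \<partial>unit_interval_measure) / a powr p) +
         b / (a + b) * ((\<integral>x. \<bar>g x\<bar> powr p \<partial>unit_interval_measure) / b powr p))"
        using i by simp
      also have "(\<integral>x. \<bar>f x\<bar> powr p \<partial>unit_interval_measure) = a powr p"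
        using p a by (simp add: powr_powr)
      also have "(\<integral>x. \<bar>g x\<bar> powr p \<partial>unit_interval_measure) = b powr p"
        using p b by (simp add: powr_powr)
      also have "(a + b) powr p * (a / (a + b) * (a powr p / a powr p) + b / (a + b) * (b powr p / b powr p)) = (a + b) powr p"
        using ab by (simp add: add_divide_distrib[symmetric])
      finally have "(\<integral>x. \<bar>f x + g x\<bar> powr p \<partial>unit_interval_measure) powr (1 / p) \<le> ((a + b) powr p) powr (1 / p)"
        using p by (intro powr_mono2) auto
      then show "(\<integral>x. \<bar>f x + g x\<bar> powr p \<partial>unit_interval_measure) powr (1 / p) \<le> a + b"
        using p ab by (simp add: powr_powr)
    qed
    then show ?thesis by (simp add: a_def b_def)
  qed
qed

lemma Lp_add: "1 \<le> p \<Longrightarrow> f \<in> Lp p \<Longrightarrow> g \<in> Lp p \<Longrightarrow> f + g \<in> Lp p"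
  by (simp add: Lp_def p_integrable_add)

lemma Lp_scaleR: "f \<in> Lp p \<Longrightarrow> c *\<^sub>R f \<in> Lp p"
  by (simp add: Lp_def p_integrable_scaleR)

lemma Lp_diff: "1 \<le> p \<Longrightarrow> f \<in> Lp p \<Longrightarrow> g \<in> Lp p \<Longrightarrow> f - g \<in> Lp p"
  using Lp_add[of p f "(-1) *\<^sub>R g"] Lp_scaleR[of g p "-1"] by simp

lemma Lp_norm_minus_commute: "1 \<le> p \<Longrightarrow> Lp_norm p (f - g) = Lp_norm p (g - f)"
  using Lp_norm_scaleR[of p "-1" "f - g"] by simp

lemma Metric_space_Lp:
  assumes "1 \<le> p"
  shows "Metric_space (Lp p) (\<lambda>f g. Lp_norm p (f - g))"
proof
  show "0 \<le> Lp_norm p (f - g)" for f g by (rule Lp_norm_nonneg)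
  show "Lp_norm p (f - g) = Lp_norm p (g - f)" for f g using assms by (rule Lp_norm_minus_commute)
  show "Lp_norm p (f - g) = 0 \<longleftrightarrow> f = g" if "f \<in> Lp p" "g \<in> Lp p" for f g
    using Lp_norm_eq_0D[of p "f - g"] Lp_diff[OF assms that] by (auto simp: Lp_def)
  show "Lp_norm p (f - h) \<le> Lp_norm p (f - g) + Lp_norm p (g - h)"
    if "f \<in> Lp p" "g \<in> Lp p" "h \<in> Lp p" for f g h
    using Lp_norm_add[OF assms, of "f - g" "g - h"] Lp_diff[OF assms] that by (simp add: Lp_def)
qed

lemma topspace_Lp_topology [simp]: "1 \<le> p \<Longrightarrow> topspace (Lp_topology p) = Lp p"
  by (simp add: Lp_topology_def Metric_space.topspace_mtopology Metric_space_Lp)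

lemma Lp_isometries_Bij: "T \<in> Lp_isometries p \<Longrightarrow> T \<in> Bij (Lp p)"
  by (simp add: Lp_isometries_def)

lemma Lp_isometries_closed: "T \<in> Lp_isometries p \<Longrightarrow> f \<in> Lp p \<Longrightarrow> T f \<in> Lp p"
  by (rule funcset_mem[OF Bij_imp_funcset[OF Lp_isometries_Bij]])

lemma Lp_isometries_norm_diff:
  assumes "1 \<le> p" "T \<in> Lp_isometries p" "f \<in> Lp p" "g \<in> Lp p"
  shows "Lp_norm p (T f - T g) = Lp_norm p (f - g)"
proof -
  have "\<forall>f \<in> Lp p. \<forall>g \<in> Lp p. T (f + g) = T f + T g"
    using assms(2) by (simp add: Lp_isometries_def)
  then have "T (f - g + g) = T (f - g) + T g"
    using Lp_diff[OF assms(1,3,4)] assms(4) by blast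
  then have "T f - T g = T (f - g)" by (simp add: algebra_simps)
  then show ?thesis using assms Lp_diff[OF assms(1,3,4)] by (simp add: Lp_isometries_def)
qed

lemma Lp_isometries_inv_into:
  assumes "T \<in> Lp_isometries p" "f \<in> Lp p"
  shows "inv_into (Lp p) T f \<in> Lp p" "T (inv_into (Lp p) T f) = f" "inv_into (Lp p) T (T f) = f"
  using assms Lp_isometries_Bij[OF assms(1)]
  by (auto simp: Bij_def bij_betw_def inv_into_into f_inv_into_f)

lemma subgroup_Lp_isometries:
  assumes p: "1 \<le> p"
  shows "subgroup (Lp_isometries p) (BijGroup (Lp p))"
proof (rule group.subgroupI[OF group_BijGroup])
  show "Lp_isometries p \<subseteq> carrier (BijGroup (Lp p))"
    by (auto simp: BijGroup_def Lp_isometries_def)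
  have "(\<lambda>f\<in>Lp p. f) \<in> Lp_isometries p"
    using Lp_add[OF p] Lp_scaleR by (simp add: Lp_isometries_def id_Bij)
  then show "Lp_isometries p \<noteq> {}" by blast
next
  fix T assume T: "T \<in> Lp_isometries p"
  note inv = Lp_isometries_inv_into[OF T]
  have add: "T (f + g) = T f + T g" if "f \<in> Lp p" "g \<in> Lp p" for f g
    using T that by (simp add: Lp_isometries_def)
  have scale: "T (c *\<^sub>R f) = c *\<^sub>R T f" and norm: "Lp_norm p (T f) = Lp_norm p f" if "f \<in> Lp p" for c f
    using T that by (simp_all add: Lp_isometries_def)
  have "inv_into (Lp p) T (f + g) = inv_into (Lp p) T f + inv_into (Lp p) T g" if "f \<in> Lp p" "g \<in> Lp p" for f g
    using inv(3)[of "inv_into (Lp p) T f + inv_into (Lp p) T g"] inv(1,2)[OF that(1)] inv(1,2)[OF that(2)]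
    by (simp add: add Lp_add p)
  moreover have "inv_into (Lp p) T (c *\<^sub>R f) = c *\<^sub>R inv_into (Lp p) T f" if "f \<in> Lp p" for c f
    using inv(3)[of "c *\<^sub>R inv_into (Lp p) T f"] inv(1,2)[OF that]
    by (simp add: scale Lp_scaleR)
  moreover have "Lp_norm p (inv_into (Lp p) T f) = Lp_norm p f" if "f \<in> Lp p" for f
    using norm[of "inv_into (Lp p) T f"] inv(1,2)[OF that] by simp
  ultimately have "restrict (inv_into (Lp p) T) (Lp p) \<in> Lp_isometries p"
    using restrict_inv_into_Bij[OF Lp_isometries_Bij[OF T]]
    by (simp add: Lp_isometries_def Lp_add Lp_scaleR p)
  then show "inv\<^bsub>BijGroup (Lp p)\<^esub> T \<in> Lp_isometries p"
    by (simp add: inv_BijGroup Lp_isometries_Bij[OF T])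
next
  fix S T assume ST: "S \<in> Lp_isometries p" "T \<in> Lp_isometries p"
  then have "compose (Lp p) S T \<in> Lp_isometries p"
    using compose_Bij[of S "Lp p" T] Lp_isometries_closed[OF ST(2)]
    by (simp add: Lp_isometries_def compose_def Lp_add Lp_scaleR p)
  then show "S \<otimes>\<^bsub>BijGroup (Lp p)\<^esub> T \<in> Lp_isometries p"
    using ST by (simp add: BijGroup_def Lp_isometries_Bij)
qed

lemma carrier_Lp_isometry_group [simp]: "carrier (Lp_isometry_group p) = Lp_isometries p"
  by (simp add: Lp_isometry_group_def)

lemma group_Lp_isometry_group: "1 \<le> p \<Longrightarrow> group (Lp_isometry_group p)"
  unfolding Lp_isometry_group_def
  by (rule group.subgroup_imp_group[OF group_BijGroup subgroup_Lp_isometries])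

lemma one_Lp_isometry_group: "\<one>\<^bsub>Lp_isometry_group p\<^esub> = (\<lambda>f\<in>Lp p. f)"
  by (simp add: Lp_isometry_group_def BijGroup_def)

lemma mult_Lp_isometry_group:
  "S \<in> Lp_isometries p \<Longrightarrow> T \<in> Lp_isometries p \<Longrightarrow> S \<otimes>\<^bsub>Lp_isometry_group p\<^esub> T = compose (Lp p) S T"
  by (simp add: Lp_isometry_group_def BijGroup_def Lp_isometries_Bij)

lemma inv_Lp_isometry_group:
  assumes "1 \<le> p" "T \<in> Lp_isometries p"
  shows "inv\<^bsub>Lp_isometry_group p\<^esub> T = (\<lambda>f\<in>Lp p. inv_into (Lp p) T f)"
  using group.m_inv_consistent[OF group_BijGroup subgroup_Lp_isometries[OF assms(1)] assms(2)]
    inv_BijGroup[OF Lp_isometries_Bij[OF assms(2)]]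
  by (simp add: Lp_isometry_group_def)

lemma topspace_Lp_strong_operator_topology [simp]:
  "1 \<le> p \<Longrightarrow> topspace (Lp_strong_operator_topology p) = Lp_isometries p"
  using Bij_imp_extensional[OF Lp_isometries_Bij] Lp_isometries_closed
  by (auto simp: Lp_strong_operator_topology_def PiE_def Pi_def)

lemma continuous_map_evaluation:
  assumes "1 \<le> p" "f \<in> Lp p"
  shows "continuous_map (Lp_strong_operator_topology p) (Lp_topology p) (\<lambda>T. T f)"
  unfolding Lp_strong_operator_topology_def
  by (rule continuous_map_from_subtopology[OF continuous_map_product_projection[OF assms(2)]])

lemma continuous_map_into_Lp_strong_operator_topology:
  assumes p: "1 \<le> p" and c: "\<And>f. f \<in> Lp p \<Longrightarrow> continuous_map X (Lp_topology p) (\<lambda>x. F x f)"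
    and F: "\<And>x. x \<in> topspace X \<Longrightarrow> F x \<in> Lp_isometries p"
  shows "continuous_map X (Lp_strong_operator_topology p) F"
  unfolding Lp_strong_operator_topology_def continuous_map_in_subtopology continuous_map_componentwise
  using c F Bij_imp_extensional[OF Lp_isometries_Bij[OF F]] by auto

lemma openin_evaluation_ball:
  assumes p: "1 \<le> p" and f: "f \<in> Lp p"
  shows "openin (Lp_strong_operator_topology p)
    {T \<in> Lp_isometries p. T f \<in> Metric_space.mball (Lp p) (\<lambda>f g. Lp_norm p (f - g)) h r}"
  using openin_continuous_map_preimage[OF continuous_map_evaluation[OF p f, unfolded Lp_topology_def]
      Metric_space.openin_mball[OF Metric_space_Lp[OF p]]]
  by (simp add: p)

lemma continuous_map_Lp_action:
  assumes p: "1 \<le> p"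
  shows "continuous_map (prod_topology (Lp_strong_operator_topology p) (Lp_topology p)) (Lp_topology p) (\<lambda>(T, f). T f)"
proof -
  interpret Metric_space "Lp p" "\<lambda>f g. Lp_norm p (f - g)" by (rule Metric_space_Lp[OF p])
  have "\<exists>U. openin (prod_topology (Lp_strong_operator_topology p) (Lp_topology p)) U \<and> (T, f) \<in> U \<and>
      (\<forall>(S, g) \<in> U. S g \<in> mball (T f) e)"
    if T: "T \<in> Lp_isometries p" and f: "f \<in> Lp p" and e: "0 < e" for T f e
  proof (intro exI conjI)
    let ?U = "{S \<in> Lp_isometries p. S f \<in> mball (T f) (e / 2)} \<times> mball f (e / 2)"
    show "openin (prod_topology (Lp_strong_operator_topology p) (Lp_topology p)) ?U"
      unfolding openin_prod_Times_iff
      using openin_evaluation_ball[OF p f, of "T f" "e / 2"] openin_mball[of f "e / 2"]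
      unfolding Lp_topology_def by blast
    show "(T, f) \<in> ?U"
      using T f e Lp_isometries_closed[OF T f] by simp
    have "S g \<in> mball (T f) e" if S: "S \<in> Lp_isometries p" "S f \<in> mball (T f) (e / 2)" and g: "g \<in> mball f (e / 2)" for S g
    proof -
      have gL: "g \<in> Lp p" using g by simp
      note cl = Lp_isometries_closed[OF S(1)] Lp_isometries_closed[OF T]
      have "Lp_norm p (T f - S g) \<le> Lp_norm p (T f - S f) + Lp_norm p (S f - S g)"
        using cl f gL by (intro triangle) simp_all
      also have "Lp_norm p (S f - S g) = Lp_norm p (f - g)"
        using Lp_isometries_norm_diff[OF p S(1) f gL] .
      finally show ?thesis using S g cl f gL by simp
    qed
    then show "\<forall>(S, g) \<in> ?U. S g \<in> mball (T f) e" by blast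
  qed
  then have "continuous_map (prod_topology (Lp_strong_operator_topology p) (Lp_topology p)) mtopology (\<lambda>(T, f). T f)"
    unfolding continuous_map_to_metric using p by (simp add: split_beta)
  then show ?thesis by (simp add: Lp_topology_def)
qed

lemma topological_group_Lp_isometry_group:
  assumes p: "1 \<le> p"
  shows "topological_group (Lp_isometry_group p) (Lp_strong_operator_topology p)"
proof -
  interpret group "Lp_isometry_group p" by (rule group_Lp_isometry_group[OF p])
  interpret Metric_space "Lp p" "\<lambda>f g. Lp_norm p (f - g)" by (rule Metric_space_Lp[OF p])
  let ?O = "Lp_strong_operator_topology p"
  show ?thesis
  proof
    show "topspace ?O = carrier (Lp_isometry_group p)" using p by simp
    show "continuous_map (prod_topology ?O ?O) ?O (\<lambda>(S, T). S \<otimes>\<^bsub>Lp_isometry_group p\<^esub> T)"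
    proof (rule continuous_map_into_Lp_strong_operator_topology[OF p])
      fix f assume f: "f \<in> Lp p"
      have "continuous_map (prod_topology ?O ?O) (Lp_topology p) (\<lambda>z. snd z f)"
        using continuous_map_compose[OF continuous_map_snd continuous_map_evaluation[OF p f]]
        by (simp add: o_def)
      then have "continuous_map (prod_topology ?O ?O) (prod_topology ?O (Lp_topology p)) (\<lambda>z. (fst z, snd z f))"
        by (intro continuous_map_pairedI continuous_map_fst)
      from continuous_map_compose[OF this continuous_map_Lp_action[OF p]]
      have "continuous_map (prod_topology ?O ?O) (Lp_topology p) (\<lambda>z. fst z (snd z f))"
        by (simp add: o_def)
      then show "continuous_map (prod_topology ?O ?O) (Lp_topology p) (\<lambda>z. (case z of (S, T) \<Rightarrow> S \<otimes>\<^bsub>Lp_isometry_group p\<^esub> T) f)"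
        by (rule continuous_map_eq) (use p f in \<open>auto simp: mult_Lp_isometry_group compose_eq\<close>)
    next
      fix z assume "z \<in> topspace (prod_topology ?O ?O)"
      then show "(case z of (S, T) \<Rightarrow> S \<otimes>\<^bsub>Lp_isometry_group p\<^esub> T) \<in> Lp_isometries p"
        using m_closed p by auto
    qed
    show "continuous_map ?O ?O (\<lambda>T. inv\<^bsub>Lp_isometry_group p\<^esub> T)"
    proof (rule continuous_map_into_Lp_strong_operator_topology[OF p])
      fix f assume f: "f \<in> Lp p"
      have "\<exists>U. openin ?O U \<and> T \<in> U \<and> (\<forall>S \<in> U. (inv\<^bsub>Lp_isometry_group p\<^esub> S) f \<in> mball ((inv\<^bsub>Lp_isometry_group p\<^esub> T) f) e)"
        if T: "T \<in> Lp_isometries p" and e: "0 < e" for T e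
      proof (intro exI conjI ballI)
        let ?h = "inv_into (Lp p) T f"
        let ?U = "{S \<in> Lp_isometries p. S ?h \<in> mball f e}"
        note h = Lp_isometries_inv_into[OF T f]
        show "openin ?O ?U" by (rule openin_evaluation_ball[OF p h(1)])
        show "T \<in> ?U" using T h f e by simp
        fix S assume S': "S \<in> ?U"
        then have S: "S \<in> Lp_isometries p" by simp
        note k = Lp_isometries_inv_into[OF S f]
        have "Lp_norm p (?h - inv_into (Lp p) S f) = Lp_norm p (S ?h - f)"
          using Lp_isometries_norm_diff[OF p S h(1) k(1)] k(2) by simp
        also have "\<dots> < e"
          using S' Lp_norm_minus_commute[OF p] by simp
        finally show "(inv\<^bsub>Lp_isometry_group p\<^esub> S) f \<in> mball ((inv\<^bsub>Lp_isometry_group p\<^esub> T) f) e"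
          using S T f h(1) k(1) by (simp add: inv_Lp_isometry_group p)
      qed
      then show "continuous_map ?O (Lp_topology p) (\<lambda>T. (inv\<^bsub>Lp_isometry_group p\<^esub> T) f)"
        unfolding Lp_topology_def continuous_map_to_metric using p by simp
    next
      fix T assume "T \<in> topspace ?O"
      then show "inv\<^bsub>Lp_isometry_group p\<^esub> T \<in> Lp_isometries p" using inv_closed p by simp
    qed
  qed
qed

theorem G_space_Lp_sphere:
  assumes p: "1 \<le> p"
  shows "G_space (Lp_isometry_group p) (Lp_strong_operator_topology p) (Lp_sphere p) (\<lambda>T f. T f)"
proof -
  interpret topological_group "Lp_isometry_group p" "Lp_strong_operator_topology p"
    by (rule topological_group_Lp_isometry_group[OF p])
  let ?O = "Lp_strong_operator_topology p"
  have metrizable: "metrizable_space (Lp_sphere p)"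
    unfolding Lp_sphere_def Lp_topology_def
    by (rule metrizable_space_subtopology[OF Metric_space.metrizable_space_mtopology[OF Metric_space_Lp[OF p]]])
  have top: "topspace (Lp_sphere p) = {f \<in> Lp p. Lp_norm p f = 1}"
    using p by (auto simp: Lp_sphere_def)
  show ?thesis
  proof
    show "completely_regular_space (Lp_sphere p)" "Hausdorff_space (Lp_sphere p)"
      by (rule metrizable_imp_completely_regular_space[OF metrizable], rule metrizable_imp_Hausdorff_space[OF metrizable])
    have "continuous_map (prod_topology ?O (Lp_sphere p)) (Lp_topology p) (\<lambda>(T, f). T f)"
      unfolding Lp_sphere_def prod_topology_subtopology(2)
      by (rule continuous_map_from_subtopology[OF continuous_map_Lp_action[OF p]])
    moreover have "(case z of (T, f) \<Rightarrow> T f) \<in> {f \<in> Lp p. Lp_norm p f = 1}"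
      if "z \<in> topspace (prod_topology ?O (Lp_sphere p))" for z
      using that p Lp_isometries_closed by (auto simp: top Lp_isometries_def)
    ultimately have "continuous_map (prod_topology ?O (Lp_sphere p)) (Lp_sphere p) (\<lambda>(T, f). T f)"
      by (subst (2) Lp_sphere_def) (simp add: continuous_map_in_subtopology)
    then show "continuous_left_action (Lp_isometry_group p) ?O (Lp_sphere p) (\<lambda>T f. T f)"
      by (simp add: continuous_left_action_def top one_Lp_isometry_group mult_Lp_isometry_group compose_eq)
  qed
qed

corollary greatest_equivariant_compactification_Lp_sphere_exists:
  assumes "1 \<le> p"
  shows "\<exists>(B :: L0 set set topology) actB \<beta>.
    greatest_equivariant_compactification (Lp_isometry_group p) (Lp_strong_operator_topology p)
      (Lp_sphere p) (\<lambda>T f. T f) B actB \<beta>"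
  by (rule G_space.greatest_equivariant_compactification_exists[OF G_space_Lp_sphere[OF assms]])

end

theory Submission
  imports Defs "HOL-Probability.Helly_Selection"
begin

text \<open>
  Every equivariant compactification \<open>B\<close> of the sphere is metrizable, maximal or not. For this it
  suffices that for arbitrarily small sets \<open>V\<close> of isometries around the identity there is a
  compact \<open>K\<close> in the sphere with \<open>V K\<close> dense: a continuous function \<open>h\<close> on \<open>B\<close> is almost
  invariant under small \<open>V\<close>, hence almost determined by its values on the compact metrizable set
  \<open>K\<close>, so the closures of the images of the sets \<open>V Q\<close>, with \<open>Q\<close> from a countable base of \<open>K\<close>,
  separate the points of \<open>B\<close>.

  To find \<open>K\<close>, let \<open>V\<close> consist of the isometries that almost fix the functions constant on each of
  \<open>N\<close> blocks of \<open>[0,1]\<close>. A step function can be sorted within each block by an isometry permuting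
  small intervals. Rescaling the two ends of each block, which have small measure, then makes the
  function constant there, equal to a negative constant at the left end and a positive one at the
  right end, while it stays monotone on the block; as the ends have fixed length, the result is
  bounded by a constant depending only on \<open>V\<close>. Blockwise monotone functions with a
  common bound form a compact set by Helly's selection theorem.
\<close>

section \<open>Metrizability of equivariant compactifications\<close>

text \<open>Total boundedness gives a finite net for every radius 1/(n+1); the balls of that radius
  around the net points, over all n, form the base.\<close>

lemma compact_metrizable_imp_second_countable:
  assumes "compact_space X" "metrizable_space X"
  shows "second_countable X"
proof -
  obtain M d where "Metric_space M d" and X: "X = Metric_space.mtopology M d"
    using assms(2) unfolding metrizable_space_def by blast
  then interpret Metric_space M d by simp
  have "mtotally_bounded M"
    using assms(1) unfolding X compact_space_def by (simp add: compactin_imp_mtotally_bounded)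
  then have "\<forall>n::nat. \<exists>F. finite F \<and> F \<subseteq> M \<and> M \<subseteq> (\<Union>x\<in>F. mball x (inverse (Suc n)))"
    unfolding mtotally_bounded_def by simp
  then obtain F where F: "\<And>n::nat. finite (F n)" "\<And>n. F n \<subseteq> M"
      "\<And>n. M \<subseteq> (\<Union>x\<in>F n. mball x (inverse (Suc n)))"
    by metis
  let ?B = "\<Union>n. (\<lambda>x. mball x (inverse (Suc n))) ` F n"
  show ?thesis
    unfolding second_countable_def
  proof (intro exI conjI allI impI ballI)
    show "countable ?B" using F(1) by (simp add: countable_finite)
    show "openin X V" if "V \<in> ?B" for V using that X by auto
    fix U x assume Ux: "openin X U \<and> x \<in> U"
    then obtain r where r: "0 < r" "mball x r \<subseteq> U" and xM: "x \<in> M"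
      unfolding X openin_mtopology by blast
    obtain n where n: "inverse (Suc n) < r / 2"
      using reals_Archimedean[of "r / 2"] r by auto
    obtain y where y: "y \<in> F n" "x \<in> mball y (inverse (Suc n))" using F(3) xM by blast
    have "mball y (inverse (Suc n)) \<subseteq> mball x r"
    proof
      fix z assume z: "z \<in> mball y (inverse (Suc n))"
      have "d x z \<le> d x y + d y z" using z xM y by (intro triangle) auto
      also have "\<dots> < r" using z y n commute[of x y] by simp
      finally show "z \<in> mball x r" using z xM by simp
    qed
    then show "\<exists>V\<in>?B. x \<in> V \<and> V \<subseteq> U" using y r by blast
  qed
qed

lemma Urysohn_function_exists:
  assumes "normal_space X" "closedin X S" "closedin X T" "disjnt S T"
  shows "\<exists>f. continuous_map X euclideanreal f \<and> f ` S \<subseteq> {0} \<and> f ` T \<subseteq> {1}"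
proof -
  obtain f where "continuous_map X (top_of_set {0..1::real}) f" "f ` S \<subseteq> {0}" "f ` T \<subseteq> {1}"
    by (rule Urysohn_lemma[OF assms, of 0 1]) auto
  then show ?thesis by (meson continuous_map_into_fulltopology)
qed

text \<open>Each of the countably many disjoint pairs from \<open>N\<close> has a Urysohn function.
  Together these map \<open>B\<close> injectively and continuously into a countable product of
  lines, and compactness makes this map an embedding.\<close>

lemma metrizable_space_countable_closed_network:
  assumes "compact_space B" "Hausdorff_space B" "countable N"
    and closed: "\<And>C. C \<in> N \<Longrightarrow> closedin B C"
    and sep: "\<And>x y. x \<in> topspace B \<Longrightarrow> y \<in> topspace B \<Longrightarrow> x \<noteq> y \<Longrightarrow>
      \<exists>C\<in>N. \<exists>D\<in>N. disjnt C D \<and> x \<in> C \<and> y \<in> D"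
  shows "metrizable_space B"
proof -
  have "normal_space B"
    using assms(1,2) by (simp add: compact_Hausdorff_or_regular_imp_normal_space)
  define I where "I = {(C, D) \<in> N \<times> N. disjnt C D}"
  have "\<exists>f. continuous_map B euclideanreal f \<and> f ` fst i \<subseteq> {0} \<and> f ` snd i \<subseteq> {1}" if "i \<in> I" for i
    using that closed by (intro Urysohn_function_exists[OF \<open>normal_space B\<close>]) (auto simp: I_def)
  then obtain f where f: "\<And>i. i \<in> I \<Longrightarrow> continuous_map B euclideanreal (f i)"
      "\<And>i. i \<in> I \<Longrightarrow> f i ` fst i \<subseteq> {0}" "\<And>i. i \<in> I \<Longrightarrow> f i ` snd i \<subseteq> {1}"
    by metis
  define e where "e x = (\<lambda>i\<in>I. f i x)" for x
  let ?P = "product_topology (\<lambda>_. euclideanreal) I"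
  have "countable (N \<times> N)" using assms(3) by simp
  then have "countable I" by (rule countable_subset[rotated]) (auto simp: I_def)
  then have "metrizable_space ?P"
    unfolding metrizable_space_product_topology
    by (simp add: metrizable_space_euclidean countable_Collect)
  have "continuous_map B ?P e"
    unfolding continuous_map_componentwise using f(1) by (auto simp: e_def)
  moreover have "inj_on e (topspace B)"
  proof (rule inj_onI, rule ccontr)
    fix x y assume xy: "x \<in> topspace B" "y \<in> topspace B" "e x = e y" "x \<noteq> y"
    then obtain C D where CD: "(C, D) \<in> I" "x \<in> C" "y \<in> D"
      using sep unfolding I_def by blast
    have "f (C, D) x = 0" "f (C, D) y = 1" using f(2,3)[OF CD(1)] CD(2,3) by auto
    moreover have "e x (C, D) = e y (C, D)" using xy by simp
    ultimately show False using CD(1) by (simp add: e_def)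
  qed
  moreover have "Hausdorff_space ?P" by (simp add: Hausdorff_space_product_topology)
  ultimately have "embedding_map B ?P e"
    using assms(1) by (intro continuous_imp_embedding_map)
  then have "B homeomorphic_space subtopology ?P (e ` topspace B)"
    by (rule embedding_map_imp_homeomorphic_space)
  then show ?thesis
    using homeomorphic_metrizable_space metrizable_space_subtopology[OF \<open>metrizable_space ?P\<close>] by blast
qed

section \<open>Almost invariant functions and separation of points\<close>

text \<open>The displacement \<open>\<bar>h (act g b) - h b\<bar>\<close> is jointly continuous and
  vanishes for g the identity, so the tube lemma over the compact \<open>B\<close> gives a
  neighbourhood of the identity that works for all b at once.\<close>

lemma continuous_left_action_small_displacement:
  fixes h :: "'k \<Rightarrow> real"
  assumes "topological_group G T" "continuous_left_action G T B act" "compact_space B"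
    and h: "continuous_map B euclideanreal h" and "0 < e"
  obtains U where "openin T U" "\<one>\<^bsub>G\<^esub> \<in> U" "\<And>g b. g \<in> U \<Longrightarrow> b \<in> topspace B \<Longrightarrow> \<bar>h (act g b) - h b\<bar> < e"
proof -
  interpret topological_group G T by fact
  let ?P = "prod_topology T B"
  define H where "H z = \<bar>h (act (fst z) (snd z)) - h (snd z)\<bar>" for z
  define W where "W = {z \<in> topspace ?P. H z \<in> {..<e}}"
  have "continuous_map ?P B (\<lambda>z. act (fst z) (snd z))"
    using assms(2) by (simp add: continuous_left_action_def case_prod_unfold)
  from continuous_map_compose[OF this h] continuous_map_compose[OF continuous_map_snd h]
  have "continuous_map ?P euclideanreal H"
    unfolding H_def by (intro continuous_intros) (simp_all add: o_def)
  then have "openin ?P W"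
    unfolding W_def by (rule openin_continuous_map_preimage) (simp add: open_openin[symmetric])
  moreover have "{\<one>\<^bsub>G\<^esub>} \<times> topspace B \<subseteq> W"
    using assms(2,5) by (auto simp: W_def H_def continuous_left_action_def)
  ultimately obtain U V where "openin T U" "openin B V" "\<one>\<^bsub>G\<^esub> \<in> U" "topspace B \<subseteq> V" "U \<times> V \<subseteq> W"
    using tube_lemma_right[of T B W "topspace B" "\<one>\<^bsub>G\<^esub>"] assms(3) by (auto simp: compact_space_def)
  have "\<bar>h (act g b) - h b\<bar> < e" if "g \<in> U" "b \<in> topspace B" for g b
  proof -
    have "(g, b) \<in> W" using that \<open>topspace B \<subseteq> V\<close> \<open>U \<times> V \<subseteq> W\<close> by blast
    then show ?thesis by (simp add: W_def H_def)
  qed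
  then show thesis using that \<open>openin T U\<close> \<open>\<one>\<^bsub>G\<^esub> \<in> U\<close> by blast
qed

text \<open>The network consists of the closures \<open>C n Q\<close> with \<open>Q\<close> in a
  countable base of \<open>K n\<close>. For a function h separating two points, a suitable n makes h
  nearly constant on \<open>C n Q\<close> for small \<open>Q\<close>, and finitely many such sets
  cover \<open>B\<close>, because \<open>V n\<close> carries \<open>K n\<close> onto a dense
  set.\<close>

theorem metrizable_equivariant_compactification:
  fixes V :: "nat \<Rightarrow> 'g set"
  assumes GX: "G_space G T X act"
    and X: "metrizable_space X"
    and ec: "equivariant_compactification G T X act B actB \<beta>"
    and V: "\<And>n. V n \<subseteq> carrier G"
    and V_small: "\<And>U. openin T U \<Longrightarrow> \<one>\<^bsub>G\<^esub> \<in> U \<Longrightarrow> \<exists>n. V n \<subseteq> U"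
    and K: "\<And>n. compactin X (K n)"
    and dense: "\<And>n. topspace X \<subseteq> X closure_of (\<Union>g\<in>V n. act g ` K n)"
  shows "metrizable_space B"
proof -
  have B: "compact_space B" "Hausdorff_space B" "continuous_left_action G T B actB" "continuous_map X B \<beta>"
      "\<And>g x. g \<in> carrier G \<Longrightarrow> x \<in> topspace X \<Longrightarrow> \<beta> (act g x) = actB g (\<beta> x)"
      "B closure_of (\<beta> ` topspace X) = topspace B"
    using ec unfolding equivariant_compactification_def by auto
  have G: "topological_group G T" and action: "continuous_left_action G T X act"
    using GX by (auto simp: G_space_def G_space_axioms_def)
  then have T: "topspace T = carrier G" by (simp add: topological_group.topspace_group)
  note KX = compactin_subset_topspace[OF K]
  have "second_countable (subtopology X (K n))" for n
    by (intro compact_metrizable_imp_second_countable compact_space_subtopology K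
      metrizable_space_subtopology X)
  then have "\<exists>\<B>. countable \<B> \<and> (\<forall>Q\<in>\<B>. openin (subtopology X (K n)) Q) \<and>
      (\<forall>U x. openin (subtopology X (K n)) U \<and> x \<in> U \<longrightarrow> (\<exists>Q\<in>\<B>. x \<in> Q \<and> Q \<subseteq> U))" for n
    unfolding second_countable_def .
  then obtain \<B> where \<B>: "\<And>n. countable (\<B> n)" "\<And>n Q. Q \<in> \<B> n \<Longrightarrow> openin (subtopology X (K n)) Q"
      "\<And>n U x. openin (subtopology X (K n)) U \<Longrightarrow> x \<in> U \<Longrightarrow> \<exists>Q\<in>\<B> n. x \<in> Q \<and> Q \<subseteq> U"
    by metis
  \<comment> \<open>These sets refer only to n and the base, not to the function h chosen later, so
    there are countably many of them.\<close>
  define C where "C n Q = B closure_of (\<beta> ` (\<Union>g\<in>V n. act g ` Q))" for n Q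
  define N where "N = (\<Union>n. C n ` \<B> n)"
  have \<B>K: "Q \<subseteq> K n" if "Q \<in> \<B> n" for n Q
    using openin_subset[OF \<B>(2)[OF that]] by simp
  show ?thesis
  proof (rule metrizable_space_countable_closed_network[OF B(1,2)])
    show "countable N" using \<B>(1) by (simp add: N_def)
    show "closedin B D" if "D \<in> N" for D using that by (auto simp: N_def C_def)
    fix b c assume bc: "b \<in> topspace B" "c \<in> topspace B" "b \<noteq> c"
    have "closedin B {b}" "closedin B {c}"
      using B(2) bc closedin_Hausdorff_sing_eq by fastforce+
    with bc B(1,2) have "\<exists>h. continuous_map B euclideanreal h \<and> h ` {b} \<subseteq> {0} \<and> h ` {c} \<subseteq> {1}"
      by (intro Urysohn_function_exists) (auto simp: compact_Hausdorff_or_regular_imp_normal_space)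
    then obtain h where h: "continuous_map B euclideanreal h" and hb: "h b = 0" and hc: "h c = 1"
      by auto
    \<comment> \<open>The error 1/10 for the displacement and another 1/10 for the variation of h
      along \<open>Q\<close> put h within 1/5 of its centre value on each \<open>C n (Q x)\<close>.
      If a set containing b met one containing c, the values 0 and 1 of h would differ by at most
      4/5.\<close>
    obtain U where U: "openin T U" "\<one>\<^bsub>G\<^esub> \<in> U"
        and Uh: "\<And>g b. g \<in> U \<Longrightarrow> b \<in> topspace B \<Longrightarrow> \<bar>h (actB g b) - h b\<bar> < 1/10"
      using continuous_left_action_small_displacement[OF G B(3,1) h, of "1/10"] by auto
    obtain n where n: "V n \<subseteq> U" using V_small[OF U] by blast
    have h\<beta>: "continuous_map X euclideanreal (h \<circ> \<beta>)" using B(4) h by (rule continuous_map_compose)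
    have \<beta>: "\<beta> x \<in> topspace B" if "x \<in> topspace X" for x
      using B(4) that by (auto simp: continuous_map_def)
    have "\<exists>Q\<in>\<B> n. x \<in> Q \<and> (\<forall>y\<in>Q. \<bar>h (\<beta> y) - h (\<beta> x)\<bar> < 1/10)" if x: "x \<in> K n" for x
    proof -
      let ?U = "{y \<in> topspace (subtopology X (K n)). (h \<circ> \<beta>) y \<in> {h (\<beta> x) - 1/10<..<h (\<beta> x) + 1/10}}"
      have "openin (subtopology X (K n)) ?U"
        using continuous_map_from_subtopology[OF h\<beta>]
        by (rule openin_continuous_map_preimage) (simp add: open_openin[symmetric])
      moreover have "x \<in> ?U" using x KX by auto
      ultimately obtain Q where "Q \<in> \<B> n" "x \<in> Q" "Q \<subseteq> ?U" using \<B>(3) by blast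
      moreover from this have "\<bar>h (\<beta> y) - h (\<beta> x)\<bar> < 1/10" if "y \<in> Q" for y
      proof -
        have "h (\<beta> y) \<in> {h (\<beta> x) - 1/10<..<h (\<beta> x) + 1/10}" using that \<open>Q \<subseteq> ?U\<close> by auto
        then show ?thesis unfolding greaterThanLessThan_iff by linarith
      qed
      ultimately show ?thesis by blast
    qed
    then obtain Q where Q: "\<And>x. x \<in> K n \<Longrightarrow> Q x \<in> \<B> n" "\<And>x. x \<in> K n \<Longrightarrow> x \<in> Q x"
        "\<And>x y. x \<in> K n \<Longrightarrow> y \<in> Q x \<Longrightarrow> \<bar>h (\<beta> y) - h (\<beta> x)\<bar> < 1/10"
      by metis
    have "compact_space (subtopology X (K n))" using K by (rule compact_space_subtopology)
    moreover have "\<forall>U\<in>Q ` K n. openin (subtopology X (K n)) U" using Q(1) \<B>(2) by blast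
    moreover have "topspace (subtopology X (K n)) \<subseteq> \<Union> (Q ` K n)" using Q(2) by auto
    ultimately obtain F where F: "finite F" "F \<subseteq> Q ` K n" "topspace (subtopology X (K n)) \<subseteq> \<Union>F"
      unfolding compact_space_alt by metis
    then obtain S where S: "finite S" "S \<subseteq> K n" "F = Q ` S" by (meson finite_subset_image)
    \<comment> \<open>The finite union of closures is closed and contains the image of a dense
      subset of \<open>X\<close>, hence all of \<open>B\<close>.\<close>
    have cover: "\<exists>x\<in>S. a \<in> C n (Q x)" if a: "a \<in> topspace B" for a
    proof -
      let ?W = "\<Union>g\<in>V n. act g ` K n"
      let ?C = "\<Union>x\<in>S. C n (Q x)"
      have closed: "closedin B ?C"
        using S(1) by (intro closedin_Union) (auto simp: C_def)
      have act: "act g x \<in> topspace X" if "g \<in> V n" "x \<in> K n" for g x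
        using continuous_left_action_closed[OF action T] that V KX by blast
      have "\<beta> ` ?W \<subseteq> ?C"
      proof clarify
        fix g y assume gy: "g \<in> V n" "y \<in> K n"
        then obtain x where x: "x \<in> S" "y \<in> Q x" using F(3) S(3) KX[of n] by auto
        have "\<beta> ` (\<Union>g\<in>V n. act g ` Q x) \<subseteq> C n (Q x)"
          unfolding C_def using \<B>K[OF Q(1)] x(1) S(2) act \<beta> by (intro closure_of_subset) blast
        then show "\<beta> (act g y) \<in> ?C" using gy x by blast
      qed
      then have "B closure_of (\<beta> ` ?W) \<subseteq> ?C" using closed by (rule closure_of_minimal)
      moreover have "\<beta> ` topspace X \<subseteq> B closure_of (\<beta> ` ?W)"
        using continuous_map_image_closure_subset[OF B(4), of ?W] dense by blast
      ultimately have "B closure_of (\<beta> ` topspace X) \<subseteq> ?C"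
        using closed by (intro closure_of_minimal) auto
      then show ?thesis using a B(6) by auto
    qed
    \<comment> \<open>The bound is a closed condition, so it need only be checked on the points
      \<open>\<beta> (act g y)\<close>, where equivariance splits it into displacement by g and
      variation from y to x.\<close>
    have osc: "\<bar>h a - h (\<beta> x)\<bar> \<le> 1/5" if x: "x \<in> S" and a: "a \<in> C n (Q x)" for x a
    proof -
      have xK: "x \<in> K n" using x S by blast
      let ?Z = "{a \<in> topspace B. h a \<in> {h (\<beta> x) - 1/5..h (\<beta> x) + 1/5}}"
      have "closedin B ?Z"
        using h by (rule closedin_continuous_map_preimage) (simp add: closed_closedin[symmetric])
      moreover have "\<beta> ` (\<Union>g\<in>V n. act g ` Q x) \<subseteq> ?Z"
      proof clarify
        fix g y assume g: "g \<in> V n" and y: "y \<in> Q x"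
        have yX: "y \<in> topspace X" using \<B>K[OF Q(1)[OF xK]] y KX by blast
        have eq: "\<beta> (act g y) = actB g (\<beta> y)" using B(5) V g yX by blast
        have "\<bar>h (actB g (\<beta> y)) - h (\<beta> y)\<bar> < 1/10" using Uh n g \<beta>[OF yX] by blast
        moreover have "\<bar>h (\<beta> y) - h (\<beta> x)\<bar> < 1/10" using Q(3)[OF xK y] .
        moreover have "actB g (\<beta> y) \<in> topspace B"
          using continuous_left_action_closed[OF B(3) T] V g \<beta>[OF yX] by blast
        ultimately show "\<beta> (act g y) \<in> topspace B \<and> h (\<beta> (act g y)) \<in> {h (\<beta> x) - 1/5..h (\<beta> x) + 1/5}"
          unfolding eq atLeastAtMost_iff by linarith
      qed
      ultimately have "C n (Q x) \<subseteq> ?Z" unfolding C_def by (intro closure_of_minimal)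
      then have "h a \<in> {h (\<beta> x) - 1/5..h (\<beta> x) + 1/5}" using a by blast
      then show ?thesis unfolding atLeastAtMost_iff by linarith
    qed
    obtain x y where x: "x \<in> S" "b \<in> C n (Q x)" and y: "y \<in> S" "c \<in> C n (Q y)"
      using cover bc by blast
    have "disjnt (C n (Q x)) (C n (Q y))"
      unfolding disjnt_iff
    proof clarify
      fix a assume a: "a \<in> C n (Q x)" "a \<in> C n (Q y)"
      note osc[OF x] osc[OF y] osc[OF x(1) a(1)] osc[OF y(1) a(2)]
      then show False using hb hc by linarith
    qed
    moreover have "C n (Q x) \<in> N" "C n (Q y) \<in> N"
      using Q(1) S(2) x(1) y(1) by (auto simp: N_def)
    ultimately show "\<exists>D\<in>N. \<exists>D'\<in>N. disjnt D D' \<and> b \<in> D \<and> c \<in> D'"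
      using x(2) y(2) by blast
  qed
qed


section \<open>Step functions in L^p[0,1]\<close>

abbreviation unit_measurable :: "(real \<Rightarrow> real) set"
  where "unit_measurable \<equiv> borel_measurable unit_interval_measure"

lemma rep_L0_measurable [measurable, simp]: "rep_L0 f \<in> unit_measurable"
  and abs_rep_L0 [simp]: "abs_L0 (rep_L0 f) = f"
  using Quotient3_rep_reflp[OF Quotient3_L0, of f] Quotient3_abs_rep[OF Quotient3_L0, of f] by auto

lemma abs_L0_eq_iff:
  "f \<in> unit_measurable \<Longrightarrow> g \<in> unit_measurable \<Longrightarrow>
    abs_L0 f = abs_L0 g \<longleftrightarrow> (AE x in unit_interval_measure. f x = g x)"
  using Quotient3_rel[OF Quotient3_L0, of f g] by simp

lemma rep_abs_L0_AE:
  "f \<in> unit_measurable \<Longrightarrow> AE x in unit_interval_measure. rep_L0 (abs_L0 f) x = f x"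
  by (subst abs_L0_eq_iff[symmetric]) simp_all

lemma abs_L0_plus:
  "f \<in> unit_measurable \<Longrightarrow> g \<in> unit_measurable \<Longrightarrow> abs_L0 f + abs_L0 g = abs_L0 (\<lambda>x. f x + g x)"
  by (simp add: plus_L0.abs_eq)

lemma abs_L0_minus:
  "f \<in> unit_measurable \<Longrightarrow> g \<in> unit_measurable \<Longrightarrow> abs_L0 f - abs_L0 g = abs_L0 (\<lambda>x. f x - g x)"
  by (simp add: minus_L0.abs_eq)

lemma abs_L0_scaleR:
  "f \<in> unit_measurable \<Longrightarrow> c *\<^sub>R abs_L0 f = abs_L0 (\<lambda>x. c * f x)"
  by (simp add: scaleR_L0.abs_eq)

lemma p_integrable_abs_L0:
  "f \<in> unit_measurable \<Longrightarrow>
    p_integrable p (abs_L0 f) \<longleftrightarrow> integrable unit_interval_measure (\<lambda>x. \<bar>f x\<bar> powr p)"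
  by (simp add: p_integrable.abs_eq)

lemma Lp_norm_abs_L0:
  "f \<in> unit_measurable \<Longrightarrow>
    Lp_norm p (abs_L0 f) = (\<integral>x. \<bar>f x\<bar> powr p \<partial>unit_interval_measure) powr (1 / p)"
  by (simp add: Lp_norm.abs_eq)

lemma p_integrable_abs_L0_nn:
  assumes "f \<in> unit_measurable"
  shows "p_integrable p (abs_L0 f) \<longleftrightarrow> (\<integral>\<^sup>+x. \<bar>f x\<bar> powr p \<partial>unit_interval_measure) < \<infinity>"
  using assms by (simp add: p_integrable_abs_L0 integrable_iff_bounded)

lemma Lp_norm_abs_L0_nn:
  assumes "f \<in> unit_measurable"
  shows "Lp_norm p (abs_L0 f) = enn2real (\<integral>\<^sup>+x. \<bar>f x\<bar> powr p \<partial>unit_interval_measure) powr (1 / p)"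
  using assms by (simp add: Lp_norm_abs_L0 integral_eq_nn_integral)

lemma bounded_in_Lp:
  assumes f: "f \<in> unit_measurable" and b: "\<And>x. x \<in> {0..1} \<Longrightarrow> \<bar>f x\<bar> \<le> C" and p: "1 \<le> p"
  shows "abs_L0 f \<in> Lp p" "Lp_norm p (abs_L0 f) \<le> C"
proof -
  have "finite_measure unit_interval_measure" by (rule finite_measure_lebesgue_on) auto
  then have C: "integrable unit_interval_measure (\<lambda>x. C powr p)"
    by (simp add: finite_measure.integrable_const)
  have le: "\<bar>f x\<bar> powr p \<le> C powr p" if "x \<in> {0..1}" for x
    using b[OF that] p by (intro powr_mono2) auto
  have I: "integrable unit_interval_measure (\<lambda>x. \<bar>f x\<bar> powr p)"
    by (rule Bochner_Integration.integrable_bound[OF C]) (use f le in \<open>auto intro!: AE_I2\<close>)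
  then show "abs_L0 f \<in> Lp p" using f by (simp add: Lp_def p_integrable_abs_L0)
  have "(\<integral>x. \<bar>f x\<bar> powr p \<partial>unit_interval_measure) \<le> (\<integral>x. C powr p \<partial>unit_interval_measure)"
    by (rule integral_mono[OF I C]) (use le in auto)
  also have "\<dots> = C powr p" by (simp add: measure_restrict_space)
  finally have "(\<integral>x. \<bar>f x\<bar> powr p \<partial>unit_interval_measure) powr (1 / p) \<le> (C powr p) powr (1 / p)"
    using p by (intro powr_mono2) auto
  moreover have "0 \<le> C" using b[of 0] by auto
  ultimately show "Lp_norm p (abs_L0 f) \<le> C"
    using f p by (simp add: Lp_norm_abs_L0 powr_powr)
qed

text \<open>Dominated convergence applies to the p-th powers of the differences; taking the root of
  order p preserves convergence to 0.\<close>

lemma Lp_dominated_convergence: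
  assumes p: "1 \<le> p"
    and meas [measurable]: "\<And>k. F k \<in> unit_measurable" "f \<in> unit_measurable"
    and int: "integrable unit_interval_measure (\<lambda>x. h x powr p)"
    and bound: "\<And>k. AE x in unit_interval_measure. \<bar>F k x - f x\<bar> \<le> h x"
    and lim: "AE x in unit_interval_measure. (\<lambda>k. F k x) \<longlonglongrightarrow> f x"
  shows "(\<lambda>k::nat. Lp_norm p (abs_L0 (F k) - abs_L0 f)) \<longlonglongrightarrow> 0"
proof -
  have "(\<lambda>k. \<integral>x. \<bar>F k x - f x\<bar> powr p \<partial>unit_interval_measure) \<longlonglongrightarrow> (\<integral>x. 0 \<partial>unit_interval_measure)"
  proof (rule integral_dominated_convergence)
    show "integrable unit_interval_measure (\<lambda>x. h x powr p)" by (rule int)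
    show "AE x in unit_interval_measure. (\<lambda>k. \<bar>F k x - f x\<bar> powr p) \<longlonglongrightarrow> 0"
      using lim
    proof eventually_elim
      case (elim x)
      then have "(\<lambda>k. \<bar>F k x - f x\<bar>) \<longlonglongrightarrow> 0"
        using tendsto_rabs[OF LIM_zero[OF elim]] by simp
      then show ?case
        by (rule tendsto_zero_powrI[where b = p]) (use p in auto)
    qed
    show "AE x in unit_interval_measure. norm (\<bar>F k x - f x\<bar> powr p) \<le> h x powr p" for k
      using bound[of k] by eventually_elim (use p in \<open>auto intro!: powr_mono2\<close>)
  qed simp_all
  then have "(\<lambda>k. \<integral>x. \<bar>F k x - f x\<bar> powr p \<partial>unit_interval_measure) \<longlonglongrightarrow> 0" by simp
  then have "(\<lambda>k. (\<integral>x. \<bar>F k x - f x\<bar> powr p \<partial>unit_interval_measure) powr (1 / p)) \<longlonglongrightarrow> 0"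
    by (rule tendsto_zero_powrI[where b = "1 / p"]) (use p in auto)
  then show ?thesis by (simp add: abs_L0_minus Lp_norm_abs_L0)
qed

section \<open>Step functions on equal cells and their density\<close>

text \<open>For positive n, the value on the m-th of n equal cells of [0,1) is \<open>c m\<close>.
  The point 1 gets the extra value \<open>c n\<close>, and negative arguments get
  \<open>c 0\<close>.\<close>

definition stepf :: "nat \<Rightarrow> (nat \<Rightarrow> real) \<Rightarrow> real \<Rightarrow> real"
  where "stepf n c x = c (nat \<lfloor>real n * x\<rfloor>)"

lemma stepf_measurable [measurable, simp]: "stepf n c \<in> unit_measurable"
proof -
  have "(\<lambda>x. c (nat \<lfloor>real n * x\<rfloor>)) \<in> borel_measurable borel" by measurable
  then show ?thesis unfolding stepf_def
    by (intro measurable_restrict_space1) (auto intro: borel_measurable_if_I measurable_completion)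
qed

lemma step_in_Lp:
  assumes "1 \<le> p"
  shows "abs_L0 (stepf n c) \<in> Lp p"
proof (rule bounded_in_Lp(1)[OF _ _ assms])
  fix x :: real assume "x \<in> {0..1}"
  then have "real n * x \<le> real n" by (simp add: mult_left_le)
  then have "nat \<lfloor>real n * x\<rfloor> \<le> n" by linarith
  then show "\<bar>stepf n c x\<bar> \<le> (\<Sum>i\<le>n. \<bar>c i\<bar>)"
    unfolding stepf_def by (intro member_le_sum) auto
qed simp

text \<open>The cell index on the coarse grid is the fine index divided by k, rounded down. This
  allows step functions on different grids to be compared.\<close>

lemma stepf_refine:
  assumes "0 < k"
  shows "stepf n c = stepf (n * k) (\<lambda>i. c (i div k))"
proof
  fix x
  have "\<lfloor>real n * x\<rfloor> = \<lfloor>(real (n * k) * x) / real_of_int (int k)\<rfloor>" using assms by simp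
  also have "\<dots> = \<lfloor>real (n * k) * x\<rfloor> div int k" by (rule floor_divide_real_eq_div) simp
  finally show "stepf n c x = stepf (n * k) (\<lambda>i. c (i div k)) x"
    by (simp add: stepf_def nat_div_distrib')
qed

text \<open>Sampling g at the left ends of the dyadic cells converges pointwise by continuity, and
  boundedly. Dyadic grids are nested, which is what later makes one step function available at all
  finer levels.\<close>

lemma continuous_step_approximation:
  assumes p: "1 \<le> p" and g: "continuous_on UNIV g" and gM: "\<And>x. \<bar>g x\<bar> \<le> M" and e: "0 < e"
  shows "\<exists>m c. (\<forall>i. \<bar>c i\<bar> \<le> M) \<and> Lp_norm p (abs_L0 (stepf (2 ^ m) c) - abs_L0 g) < e"
proof -
  let ?c = "\<lambda>m i. g (real i / 2 ^ m)"
  have [measurable]: "g \<in> unit_measurable"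
    using borel_measurable_continuous_onI[OF g]
    by (intro measurable_restrict_space1) (auto intro: measurable_completion)
  have "(\<lambda>m. Lp_norm p (abs_L0 (stepf (2 ^ m) (?c m)) - abs_L0 g)) \<longlonglongrightarrow> 0"
  proof (rule Lp_dominated_convergence[OF p])
    show "integrable unit_interval_measure (\<lambda>x. (2 * M) powr p)"
      by (rule finite_measure.integrable_const[OF finite_measure_lebesgue_on]) auto
    have "\<bar>stepf (2 ^ m) (?c m) x - g x\<bar> \<le> 2 * M" for m x
      using gM[of x] gM[of "real (nat \<lfloor>2 ^ m * x\<rfloor>) / 2 ^ m"] by (simp add: stepf_def)
    then show "AE x in unit_interval_measure. \<bar>stepf (2 ^ m) (?c m) x - g x\<bar> \<le> 2 * M" for m
      by (intro AE_I2) blast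
    show "AE x in unit_interval_measure. (\<lambda>m. stepf (2 ^ m) (?c m) x) \<longlonglongrightarrow> g x"
    proof (rule AE_I2)
      fix x assume "x \<in> space unit_interval_measure"
      then have x: "0 \<le> x" by simp
      have "(\<lambda>m. real (nat \<lfloor>2 ^ m * x\<rfloor>) / 2 ^ m) \<longlonglongrightarrow> x"
      proof (rule tendsto_sandwich)
        show "\<forall>\<^sub>F m in sequentially. x - 1 / 2 ^ m \<le> real (nat \<lfloor>2 ^ m * x\<rfloor>) / 2 ^ m"
        proof (rule always_eventually, rule allI)
          fix m :: nat
          have "2 ^ m * x - 1 \<le> real (nat \<lfloor>2 ^ m * x\<rfloor>)" using x by linarith
          then have "(2 ^ m * x - 1) / 2 ^ m \<le> real (nat \<lfloor>2 ^ m * x\<rfloor>) / 2 ^ m"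
            by (rule divide_right_mono) simp
          then show "x - 1 / 2 ^ m \<le> real (nat \<lfloor>2 ^ m * x\<rfloor>) / 2 ^ m" by (simp add: diff_divide_distrib)
        qed
        show "\<forall>\<^sub>F m in sequentially. real (nat \<lfloor>2 ^ m * x\<rfloor>) / 2 ^ m \<le> x"
        proof (rule always_eventually, rule allI)
          fix m :: nat
          have "real (nat \<lfloor>2 ^ m * x\<rfloor>) \<le> 2 ^ m * x" using x by simp
          then have "real (nat \<lfloor>2 ^ m * x\<rfloor>) / 2 ^ m \<le> (2 ^ m * x) / 2 ^ m"
            by (rule divide_right_mono) simp
          then show "real (nat \<lfloor>2 ^ m * x\<rfloor>) / 2 ^ m \<le> x" by simp
        qed
        have "(\<lambda>m. (1/2::real) ^ m) \<longlonglongrightarrow> 0" by (rule LIMSEQ_realpow_zero) auto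
        from tendsto_diff[OF tendsto_const[of x] this]
        show "(\<lambda>m. x - 1 / 2 ^ m) \<longlonglongrightarrow> x" by (simp add: power_divide)
      qed simp
      moreover have "isCont g x" using g by (simp add: continuous_on_eq_continuous_at)
      ultimately have "(\<lambda>m. g (real (nat \<lfloor>2 ^ m * x\<rfloor>) / 2 ^ m)) \<longlonglongrightarrow> g x"
        by (rule isCont_tendsto_compose[rotated])
      then show "(\<lambda>m. stepf (2 ^ m) (?c m) x) \<longlonglongrightarrow> g x" by (simp add: stepf_def)
    qed
  qed simp_all
  then have "\<forall>\<^sub>F m in sequentially. Lp_norm p (abs_L0 (stepf (2 ^ m) (?c m)) - abs_L0 g) < e"
    by (rule order_tendstoD(2)) (use e in simp)
  then obtain m where "Lp_norm p (abs_L0 (stepf (2 ^ m) (?c m)) - abs_L0 g) < e"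
    by (auto simp: eventually_sequentially)
  then show ?thesis using gM by (intro exI[of _ m] exI[of _ "?c m"] conjI allI)
qed

text \<open>Three errors of e/3: clip f at a height \<open>K\<close>, approximate the clipped
  function by clipped continuous functions, and sample one of these. The bound \<open>C\<close> on
  the coefficients is kept because \<open>almost_fixing\<close> controls only bounded step
  functions.\<close>

lemma step_approximation:
  assumes p: "1 \<le> p" and f: "f \<in> Lp p" and e: "0 < e"
  shows "\<exists>m c C. (\<forall>i. \<bar>c i\<bar> \<le> C) \<and> Lp_norm p (abs_L0 (stepf (2 ^ m) c) - f) < e"
proof -
  define f0 where "f0 = rep_L0 f"
  have f0 [measurable]: "f0 \<in> unit_measurable" and ff0: "f = abs_L0 f0" by (simp_all add: f0_def)
  define cl where "cl K x = max (- real K) (min (real K) x)" for K :: nat and x :: real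
  have cl_meas [measurable]: "(\<lambda>x. cl K (g x)) \<in> unit_measurable" if "g \<in> unit_measurable" for K g
    unfolding cl_def using that by measurable
  have cl_bound: "\<bar>cl K x\<bar> \<le> real K" for K x by (auto simp: cl_def)
  have cl_in: "abs_L0 (\<lambda>x. cl K (g x)) \<in> Lp p" if "g \<in> unit_measurable" for K g
    using that cl_bound by (intro bounded_in_Lp[of _ "real K"] p) auto
  have "(\<lambda>K. Lp_norm p (abs_L0 (\<lambda>x. cl K (f0 x)) - abs_L0 f0)) \<longlonglongrightarrow> 0"
  proof (rule Lp_dominated_convergence[OF p])
    show "integrable unit_interval_measure (\<lambda>x. \<bar>f0 x\<bar> powr p)"
      using f unfolding ff0 by (simp add: Lp_def p_integrable_abs_L0)
    show "AE x in unit_interval_measure. \<bar>cl K (f0 x) - f0 x\<bar> \<le> \<bar>f0 x\<bar>" for K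
      by (intro AE_I2) (auto simp: cl_def)
    show "AE x in unit_interval_measure. (\<lambda>K. cl K (f0 x)) \<longlonglongrightarrow> f0 x"
    proof (intro AE_I2 tendsto_eventually)
      fix x
      have "\<forall>\<^sub>F K in sequentially. \<bar>f0 x\<bar> \<le> real K"
        by (rule eventually_sequentiallyI[of "nat \<lceil>\<bar>f0 x\<bar>\<rceil>"]) linarith
      then show "\<forall>\<^sub>F K in sequentially. cl K (f0 x) = f0 x"
        by eventually_elim (auto simp: cl_def)
    qed
  qed simp_all
  then have "\<forall>\<^sub>F K in sequentially. Lp_norm p (abs_L0 (\<lambda>x. cl K (f0 x)) - abs_L0 f0) < e / 3"
    by (rule order_tendstoD(2)) (use e in simp)
  then obtain K where K: "Lp_norm p (abs_L0 (\<lambda>x. cl K (f0 x)) - abs_L0 f0) < e / 3"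
    by (auto simp: eventually_sequentially)
  \<comment> \<open>Measurability in this sense supplies continuous functions converging to f0 off a
    null set; clipping them at the same height \<open>K\<close> provides the dominating
    constant.\<close>
  have "f0 measurable_on {0..1}" by (simp add: measurable_on_iff_borel_measurable)
  then obtain N g where N: "negligible N" and g: "\<And>n. continuous_on UNIV (g n)"
      and gf: "\<And>x. x \<notin> N \<Longrightarrow> (\<lambda>n. g n x) \<longlonglongrightarrow> (if x \<in> {0..1} then f0 x else 0)"
    unfolding measurable_on_def by blast
  have cg: "continuous_on UNIV (\<lambda>x. cl K (g n x))" for n
    unfolding cl_def by (intro continuous_intros g)
  have cgm [measurable]: "(\<lambda>x. cl K (g n x)) \<in> unit_measurable" for n
    using borel_measurable_continuous_onI[OF cg]
    by (intro measurable_restrict_space1) (auto intro: measurable_completion)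
  have "(\<lambda>n. Lp_norm p (abs_L0 (\<lambda>x. cl K (g n x)) - abs_L0 (\<lambda>x. cl K (f0 x)))) \<longlonglongrightarrow> 0"
  proof (rule Lp_dominated_convergence[OF p])
    show "integrable unit_interval_measure (\<lambda>x. (2 * real K) powr p)"
      by (rule finite_measure.integrable_const[OF finite_measure_lebesgue_on]) auto
    have "\<bar>cl K (g n x) - cl K (f0 x)\<bar> \<le> 2 * real K" for n x
      using cl_bound[of K "g n x"] cl_bound[of K "f0 x"] by linarith
    then show "AE x in unit_interval_measure. \<bar>cl K (g n x) - cl K (f0 x)\<bar> \<le> 2 * real K" for n
      by (intro AE_I2) blast
    have "AE x in unit_interval_measure. x \<notin> N"
      using N by (subst AE_restrict_space_iff)
        (auto simp: negligible_iff_null_sets intro: AE_mp[OF AE_not_in])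
    then show "AE x in unit_interval_measure. (\<lambda>n. cl K (g n x)) \<longlonglongrightarrow> cl K (f0 x)"
    proof (rule AE_mp, intro AE_I2 impI)
      fix x assume "x \<in> space unit_interval_measure" "x \<notin> N"
      then have "(\<lambda>n. g n x) \<longlonglongrightarrow> f0 x" using gf[of x] by simp
      then show "(\<lambda>n. cl K (g n x)) \<longlonglongrightarrow> cl K (f0 x)"
        unfolding cl_def by (intro tendsto_intros)
    qed
  qed simp_all
  then have "\<forall>\<^sub>F n in sequentially. Lp_norm p (abs_L0 (\<lambda>x. cl K (g n x)) - abs_L0 (\<lambda>x. cl K (f0 x))) < e / 3"
    by (rule order_tendstoD(2)) (use e in simp)
  then obtain n where n: "Lp_norm p (abs_L0 (\<lambda>x. cl K (g n x)) - abs_L0 (\<lambda>x. cl K (f0 x))) < e / 3"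
    by (auto simp: eventually_sequentially)
  have "\<exists>m c. (\<forall>i. \<bar>c i\<bar> \<le> real K) \<and>
      Lp_norm p (abs_L0 (stepf (2 ^ m) c) - abs_L0 (\<lambda>x. cl K (g n x))) < e / 3"
    by (rule continuous_step_approximation[OF p cg cl_bound]) (use e in simp)
  then obtain m c where c: "\<forall>i. \<bar>c i\<bar> \<le> real K" and
      m: "Lp_norm p (abs_L0 (stepf (2 ^ m) c) - abs_L0 (\<lambda>x. cl K (g n x))) < e / 3"
    by blast
  interpret Metric_space "Lp p" "\<lambda>f g. Lp_norm p (f - g)" by (rule Metric_space_Lp[OF p])
  have s: "abs_L0 (stepf (2 ^ m) c) \<in> Lp p" using p by (rule step_in_Lp)
  have gL: "abs_L0 (\<lambda>x. cl K (g n x)) \<in> Lp p"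
    using cl_bound by (intro bounded_in_Lp[of _ "real K"] p) auto
  have "Lp_norm p (abs_L0 (stepf (2 ^ m) c) - f) \<le> Lp_norm p (abs_L0 (stepf (2 ^ m) c) - abs_L0 (\<lambda>x. cl K (g n x)))
      + (Lp_norm p (abs_L0 (\<lambda>x. cl K (g n x)) - abs_L0 (\<lambda>x. cl K (f0 x)))
      + Lp_norm p (abs_L0 (\<lambda>x. cl K (f0 x)) - f))"
    using triangle[OF s gL f] triangle[OF gL cl_in[OF f0, of K] f] by linarith
  also have "\<dots> < e" using m n K unfolding ff0 by linarith
  finally show ?thesis using c by blast
qed


section \<open>Small sets of isometries and compact sets of monotone functions\<close>

text \<open>These sets need not be neighbourhoods of the identity.\<close>

definition almost_fixing :: "real \<Rightarrow> nat \<Rightarrow> (L0 \<Rightarrow> L0) set"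
  where "almost_fixing p n = {T \<in> Lp_isometries p. \<forall>c. (\<forall>i. \<bar>c i\<bar> \<le> real n) \<longrightarrow>
    Lp_norm p (T (abs_L0 (stepf (2 ^ n) c)) - abs_L0 (stepf (2 ^ n) c)) < 1 / (real n + 1)}"

text \<open>Compare f with a step function d close to it: T moves d little, and T f is as close to T
  d as f is to d because T is an isometry.\<close>

lemma almost_fixing_eventually:
  assumes p: "1 \<le> p" and f: "f \<in> Lp p" and e: "0 < e"
  shows "\<forall>\<^sub>F n in sequentially. \<forall>T \<in> almost_fixing p n. Lp_norm p (f - T f) < e"
proof -
  interpret Metric_space "Lp p" "\<lambda>f g. Lp_norm p (f - g)" by (rule Metric_space_Lp[OF p])
  have "\<exists>m c C. (\<forall>i. \<bar>c i\<bar> \<le> C) \<and> Lp_norm p (abs_L0 (stepf (2 ^ m) c) - f) < e / 3"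
    by (rule step_approximation[OF p f]) (use e in simp)
  then obtain m c C where c: "\<And>i. \<bar>c i\<bar> \<le> C" and d: "Lp_norm p (abs_L0 (stepf (2 ^ m) c) - f) < e / 3"
    by blast
  let ?d = "abs_L0 (stepf (2 ^ m) c)"
  have dL: "?d \<in> Lp p" using p by (rule step_in_Lp)
  have "(\<lambda>n. 1 / (real n + 1)) \<longlonglongrightarrow> 0" by real_asymp
  then have "\<forall>\<^sub>F n in sequentially. 1 / (real n + 1) < e / 3"
    by (rule order_tendstoD(2)) (use e in simp)
  moreover have "\<forall>\<^sub>F n in sequentially. m \<le> n" by (rule eventually_ge_at_top)
  moreover have "\<forall>\<^sub>F n in sequentially. C \<le> real n"
    by (rule eventually_sequentiallyI[of "nat \<lceil>C\<rceil>"]) linarith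
  ultimately show ?thesis
  proof eventually_elim
    case (elim n)
    \<comment> \<open>Since m is at most n, d is also a step function on the grid used by
      \<open>almost_fixing p n\<close>.\<close>
    have ref: "stepf (2 ^ m) c = stepf (2 ^ n) (\<lambda>i. c (i div 2 ^ (n - m)))"
      using stepf_refine[of "2 ^ (n - m)" "2 ^ m" c] elim by (simp flip: power_add)
    show ?case
    proof
      fix T assume T: "T \<in> almost_fixing p n"
      then have TI: "T \<in> Lp_isometries p" by (simp add: almost_fixing_def)
      note cl = Lp_isometries_closed[OF TI]
      have "\<bar>c i\<bar> \<le> real n" for i using c[of i] elim by linarith
      then have "Lp_norm p (T ?d - ?d) < 1 / (real n + 1)"
        using T unfolding ref almost_fixing_def by simp
      then have "Lp_norm p (?d - T ?d) < e / 3"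
        using elim Lp_norm_minus_commute[OF p, of ?d "T ?d"] by simp
      moreover have "Lp_norm p (T ?d - T f) < e / 3"
        using d Lp_isometries_norm_diff[OF p TI dL f] by simp
      moreover have "Lp_norm p (f - ?d) < e / 3"
        using d Lp_norm_minus_commute[OF p, of f ?d] by simp
      ultimately show "Lp_norm p (f - T f) < e"
        using triangle[OF f dL cl[OF f]] triangle[OF dL cl[OF dL] cl[OF f]] by linarith
    qed
  qed
qed

text \<open>A basic neighbourhood in the product topology constrains the values at finitely many f
  only, so finitely many instances of \<open>almost_fixing_eventually\<close> hold for a common
  n.\<close>

lemma almost_fixing_small:
  assumes p: "1 \<le> p" and U: "openin (Lp_strong_operator_topology p) U" and one: "\<one>\<^bsub>Lp_isometry_group p\<^esub> \<in> U"
  shows "\<exists>n. almost_fixing p n \<subseteq> U"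
proof -
  interpret Metric_space "Lp p" "\<lambda>f g. Lp_norm p (f - g)" by (rule Metric_space_Lp[OF p])
  let ?one = "\<lambda>f\<in>Lp p. f"
  obtain W where W: "openin (product_topology (\<lambda>_. Lp_topology p) (Lp p)) W" and UW: "U = W \<inter> Lp_isometries p"
    using U unfolding Lp_strong_operator_topology_def openin_subtopology by blast
  have "?one \<in> W" using one UW by (simp add: one_Lp_isometry_group)
  from bspec[OF W[unfolded openin_product_topology_alt] this] obtain X where X: "finite {f \<in> Lp p. X f \<noteq> topspace (Lp_topology p)}"
      "\<forall>f \<in> Lp p. openin (Lp_topology p) (X f)" "?one \<in> Pi\<^sub>E (Lp p) X" "Pi\<^sub>E (Lp p) X \<subseteq> W"
    by (elim exE conjE) (rule that, assumption+)
  let ?F = "{f \<in> Lp p. X f \<noteq> topspace (Lp_topology p)}"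
  have "\<forall>\<^sub>F n in sequentially. \<forall>T \<in> almost_fixing p n. T f \<in> X f" if f: "f \<in> Lp p" for f
  proof -
    have "f \<in> X f" using PiE_mem[OF X(3) f] f by simp
    then obtain e where "0 < e" "mball f e \<subseteq> X f"
      using bspec[OF X(2) f] unfolding Lp_topology_def openin_mtopology by blast
    from almost_fixing_eventually[OF p f this(1)] show ?thesis
    proof eventually_elim
      case (elim n)
      have "T f \<in> mball f e" if "T \<in> almost_fixing p n" for T
        using elim that f Lp_isometries_closed[of T p f] by (auto simp: almost_fixing_def)
      then show ?case using \<open>mball f e \<subseteq> X f\<close> by blast
    qed
  qed
  then have "\<forall>\<^sub>F n in sequentially. \<forall>f\<in>?F. \<forall>T \<in> almost_fixing p n. T f \<in> X f"
    using X(1) by (intro eventually_ball_finite) auto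
  then obtain n where n: "\<And>f T. f \<in> ?F \<Longrightarrow> T \<in> almost_fixing p n \<Longrightarrow> T f \<in> X f"
    by (auto simp: eventually_sequentially)
  have "T \<in> U" if T: "T \<in> almost_fixing p n" for T
  proof -
    have TI: "T \<in> Lp_isometries p" using T by (simp add: almost_fixing_def)
    have "T f \<in> X f" if "f \<in> Lp p" for f
      using n[of f T] T that Lp_isometries_closed[OF TI that] p by (cases "f \<in> ?F") auto
    then have "T \<in> Pi\<^sub>E (Lp p) X"
      using Bij_imp_extensional[OF Lp_isometries_Bij[OF TI]] by (auto simp: PiE_def)
    then show ?thesis using X(4) TI UW by blast
  qed
  then show ?thesis by blast
qed

text \<open>
  With \<open>s\<close> a staircase of large steps, the functions \<open>g - s\<close> include all functions monotone between
  the jumps of \<open>s\<close> with a given bound. Right continuity is required by \<open>Helly_selection\<close>.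
\<close>

definition monotone_class :: "real \<Rightarrow> (real \<Rightarrow> real) \<Rightarrow> L0 set"
  where "monotone_class M s = {abs_L0 (\<lambda>x. g x - s x) | g.
    mono g \<and> (\<forall>x. continuous (at_right x) g) \<and> (\<forall>x. \<bar>g x\<bar> \<le> M)}"

section \<open>Compactness through Helly selection\<close>

lemma mono_unit_measurable: "mono (g :: real \<Rightarrow> real) \<Longrightarrow> g \<in> unit_measurable"
  using borel_measurable_mono[of g]
  by (intro measurable_restrict_space1) (auto intro: measurable_completion)

text \<open>Helly's theorem yields a subsequence converging at the continuity points of a limit in
  the same class. A monotone function has countably many discontinuities, so convergence holds
  almost everywhere, and the common bound turns it into norm convergence; the fixed s cancels in the
  differences.\<close>

lemma compactin_monotone_class:
  assumes p: "1 \<le> p" and s [measurable]: "s \<in> unit_measurable" and sC: "\<And>x. x \<in> {0..1} \<Longrightarrow> \<bar>s x\<bar> \<le> C"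
  shows "compactin (Lp_topology p) (monotone_class M s)"
proof -
  interpret Metric_space "Lp p" "\<lambda>f g. Lp_norm p (f - g)" by (rule Metric_space_Lp[OF p])
  have inLp: "abs_L0 (\<lambda>x. g x - s x) \<in> Lp p" if "mono g" "\<And>x. \<bar>g x\<bar> \<le> M" for g
  proof (rule bounded_in_Lp(1)[OF _ _ p])
    have [measurable]: "g \<in> unit_measurable" by (rule mono_unit_measurable) fact
    show "(\<lambda>x. g x - s x) \<in> unit_measurable" by measurable
    show "\<bar>g x - s x\<bar> \<le> M + C" if "x \<in> {0..1}" for x
      using \<open>\<bar>g x\<bar> \<le> M\<close> sC[OF that] by linarith
  qed
  show ?thesis
    unfolding Lp_topology_def compactin_sequentially
  proof (intro conjI allI impI)
    show "monotone_class M s \<subseteq> Lp p" using inLp by (auto simp: monotone_class_def)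
    fix y :: "nat \<Rightarrow> L0" assume "range y \<subseteq> monotone_class M s"
    then have "\<forall>k. \<exists>g. y k = abs_L0 (\<lambda>x. g x - s x) \<and>
        mono g \<and> (\<forall>x. continuous (at_right x) g) \<and> (\<forall>x. \<bar>g x\<bar> \<le> M)"
      unfolding monotone_class_def by blast
    then obtain g where y: "\<And>k. y k = abs_L0 (\<lambda>x. g k x - s x)" and mono: "\<And>k. mono (g k)"
        and right: "\<And>k x. continuous (at_right x) (g k)" and M: "\<And>k x. \<bar>g k x\<bar> \<le> M"
      by metis
    obtain r F where r: "strict_mono (r :: nat \<Rightarrow> nat)" and F: "\<And>x. continuous (at_right x) F" "mono F" "\<And>x. \<bar>F x\<bar> \<le> M"
        and lim: "\<And>x. continuous (at x) F \<Longrightarrow> (\<lambda>k. g (r k) x) \<longlonglongrightarrow> F x"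
      using Helly_selection[of g M] right mono M by blast
    have [measurable]: "F \<in> unit_measurable" "\<And>k. g k \<in> unit_measurable"
      using F(2) mono by (simp_all add: mono_unit_measurable)
    have "(\<lambda>k. Lp_norm p (abs_L0 (\<lambda>x. g (r k) x - s x) - abs_L0 (\<lambda>x. F x - s x))) \<longlonglongrightarrow> 0"
    proof (rule Lp_dominated_convergence[OF p])
      show "integrable unit_interval_measure (\<lambda>x. (2 * M) powr p)"
        by (rule finite_measure.integrable_const[OF finite_measure_lebesgue_on]) auto
      have "\<bar>(g (r k) x - s x) - (F x - s x)\<bar> \<le> 2 * M" for k x
        using M[of "r k" x] F(3)[of x] by linarith
      then show "AE x in unit_interval_measure. \<bar>(g (r k) x - s x) - (F x - s x)\<bar> \<le> 2 * M" for k
        by (intro AE_I2) blast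
      have "negligible {x. \<not> isCont F x}"
        using countable_imp_null_set_lborel[OF mono_ctble_discont[OF F(2)]]
        by (simp add: negligible_iff_null_sets null_sets_completionI)
      then have "AE x in unit_interval_measure. x \<notin> {x. \<not> isCont F x}"
        by (subst AE_restrict_space_iff)
          (auto simp: negligible_iff_null_sets intro: AE_mp[OF AE_not_in])
      then show "AE x in unit_interval_measure. (\<lambda>k. g (r k) x - s x) \<longlonglongrightarrow> F x - s x"
      proof (rule AE_mp, intro AE_I2 impI)
        fix x assume "x \<notin> {x. \<not> isCont F x}"
        then have "(\<lambda>k. g (r k) x) \<longlonglongrightarrow> F x" using lim by simp
        then show "(\<lambda>k. g (r k) x - s x) \<longlonglongrightarrow> F x - s x" by (rule tendsto_diff[OF _ tendsto_const])
      qed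
    qed simp_all
    then have "(\<lambda>k. Lp_norm p ((y \<circ> r) k - abs_L0 (\<lambda>x. F x - s x))) \<longlonglongrightarrow> 0" by (simp add: y)
    moreover have "(y \<circ> r) k \<in> Lp p" for k using inLp mono M by (simp add: y)
    ultimately have "limitin mtopology (y \<circ> r) (abs_L0 (\<lambda>x. F x - s x)) sequentially"
      using inLp[OF F(2,3)] by (auto simp: limitin_metric_dist_null)
    then show "\<exists>l r. l \<in> monotone_class M s \<and> strict_mono r \<and> limitin mtopology (y \<circ> r) l sequentially"
      using r F unfolding monotone_class_def by blast
  qed
qed

lemma topspace_Lp_sphere: "1 \<le> p \<Longrightarrow> topspace (Lp_sphere p) = {f \<in> Lp p. Lp_norm p f = 1}"
  by (auto simp: Lp_sphere_def)

lemma metrizable_Lp_sphere: "1 \<le> p \<Longrightarrow> metrizable_space (Lp_sphere p)"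
  unfolding Lp_sphere_def Lp_topology_def
  by (intro metrizable_space_subtopology Metric_space.metrizable_space_mtopology Metric_space_Lp)

lemma compactin_Lp_sphere_monotone_class:
  assumes p: "1 \<le> p" and "s \<in> unit_measurable" "\<And>x. x \<in> {0..1} \<Longrightarrow> \<bar>s x\<bar> \<le> C"
  shows "compactin (Lp_sphere p) (monotone_class M s \<inter> topspace (Lp_sphere p))"
proof -
  interpret Metric_space "Lp p" "\<lambda>f g. Lp_norm p (f - g)" by (rule Metric_space_Lp[OF p])
  have 0: "0 \<in> Lp p" by (simp add: Lp_def p_integrable_zero)
  \<comment> \<open>Writing the sphere as a closed ball minus an open ball shows that it is closed,
    so the intersection stays compact.\<close>
  have "topspace (Lp_sphere p) = mcball 0 1 - mball 0 1"
    using 0 Lp_norm_minus_commute[OF p, of 0] by (auto simp: topspace_Lp_sphere[OF p])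
  then have "closedin (Lp_topology p) (topspace (Lp_sphere p))"
    unfolding Lp_topology_def by (simp add: closedin_diff)
  moreover have "compactin (Lp_topology p) (monotone_class M s)"
    using assms by (rule compactin_monotone_class)
  ultimately have "compactin (Lp_topology p) (monotone_class M s \<inter> topspace (Lp_sphere p))"
    by (intro compact_Int_closedin)
  then show ?thesis
    by (auto simp: Lp_sphere_def compactin_subtopology topspace_Lp_sphere[OF p])
qed


section \<open>Piecewise affine isometries\<close>

text \<open>The tiles are half-open, given by left end and length, and may be numbered in any order;
  this freedom encodes permutations of cells.\<close>

definition interval_partition :: "nat \<Rightarrow> (nat \<Rightarrow> real) \<Rightarrow> (nat \<Rightarrow> real) \<Rightarrow> bool"
  where "interval_partition n s a \<longleftrightarrow> (\<forall>i<n. 0 < a i \<and> {s i..<s i + a i} \<subseteq> {0..<1}) \<and>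
    (\<forall>x\<in>{0..<1}. \<exists>!i. i < n \<and> x \<in> {s i..<s i + a i})"

text \<open>The value type is general because the identity serves both for real functions and for
  nonnegative extended integrands.\<close>

lemma interval_partition_sum_indicator:
  fixes z :: "nat \<Rightarrow> 'b::{comm_monoid_add, semiring_1}"
  assumes "interval_partition n s a" "i < n" "x \<in> {s i..<s i + a i}"
  shows "(\<Sum>j<n. indicator {s j..<s j + a j} x * z j) = z i"
proof -
  have x: "x \<in> {0..<1}" using assms unfolding interval_partition_def by blast
  then have "x \<notin> {s j..<s j + a j}" if "j < n" "j \<noteq> i" for j
    using assms that unfolding interval_partition_def by blast
  then have "(\<Sum>j<n. indicator {s j..<s j + a j} x * z j) = (\<Sum>j<n. if j = i then z j else 0)"
    using assms(3) by (intro sum.cong) auto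
  then show ?thesis using assms(2) by simp
qed

lemma interval_partition_sum_outside:
  fixes z :: "nat \<Rightarrow> 'b::{comm_monoid_add, semiring_1}"
  assumes "interval_partition n s a" "x \<notin> {0..<1}"
  shows "(\<Sum>j<n. indicator {s j..<s j + a j} x * z j) = 0"
proof (intro sum.neutral ballI)
  fix j assume "j \<in> {..<n}"
  then have "x \<notin> {s j..<s j + a j}" using assms unfolding interval_partition_def by blast
  then show "indicator {s j..<s j + a j} x * z j = 0" by simp
qed

lemma AE_unit_interval_less_1: "AE x in unit_interval_measure. x \<in> {0..<1}"
proof -
  have "AE x in lebesgue. x \<notin> {1::real}"
    by (rule AE_not_in) (simp flip: negligible_iff_null_sets)
  then show ?thesis by (subst AE_restrict_space_iff) (auto elim: AE_mp)
qed

text \<open>Moves integrals to the whole line, where affine substitution is available, and drops the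
  null point 1, which no tile covers.\<close>

lemma nn_integral_unit_interval:
  fixes f :: "real \<Rightarrow> real"
  assumes "0 < p"
  shows "(\<integral>\<^sup>+x. \<bar>f x\<bar> powr p \<partial>unit_interval_measure) = (\<integral>\<^sup>+x. \<bar>indicator {0..<1} x * f x\<bar> powr p \<partial>lebesgue)"
proof -
  have "(\<integral>\<^sup>+x. \<bar>f x\<bar> powr p \<partial>unit_interval_measure) = (\<integral>\<^sup>+x. \<bar>indicator {0..<1} x * f x\<bar> powr p \<partial>unit_interval_measure)"
    by (rule nn_integral_cong_AE) (use AE_unit_interval_less_1 in eventually_elim, simp)
  also have "\<dots> = (\<integral>\<^sup>+x. ennreal (\<bar>indicator {0..<1} x * f x\<bar> powr p) * indicator {0..1} x \<partial>lebesgue)"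
    by (rule nn_integral_restrict_space) simp
  also have "\<dots> = (\<integral>\<^sup>+x. \<bar>indicator {0..<1} x * f x\<bar> powr p \<partial>lebesgue)"
    by (rule nn_integral_cong) (auto simp: indicator_def)
  finally show ?thesis .
qed

lemma lebesgue_measurable_extension:
  fixes f :: "real \<Rightarrow> real"
  assumes "f \<in> unit_measurable"
  shows "(\<lambda>x. indicator {0..<1} x * f x) \<in> borel_measurable lebesgue"
proof -
  have "(\<lambda>x. if x \<in> {0..1} then f x else 0) \<in> borel_measurable lebesgue"
    using assms by (simp add: borel_measurable_if del: atLeastAtMost_iff)
  then have "(\<lambda>x. indicator {0..<1} x * (if x \<in> {0..1} then f x else 0)) \<in> borel_measurable lebesgue"
    by (intro borel_measurable_times borel_measurable_indicator) auto
  also have "(\<lambda>x. indicator {0..<1} x * (if x \<in> {0..1} then f x else 0)) = (\<lambda>x. indicator {0..<1} x * f x)"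
    by (auto simp: indicator_def)
  finally show ?thesis .
qed

text \<open>Change of variables along the increasing affine map from the interval of length b onto
  the one of length a; a / b is its derivative.\<close>

lemma nn_integral_affine_piece:
  assumes [measurable]: "F \<in> borel_measurable lebesgue" and ab: "0 < a" "0 < b"
  shows "(\<integral>\<^sup>+x. indicator {t..<t + b} x * (ennreal (a / b) * F (s + a / b * (x - t))) \<partial>lebesgue)
    = (\<integral>\<^sup>+x. indicator {s..<s + a} x * F x \<partial>lebesgue)"
proof -
  define c where "c = a / b"
  have c: "0 < c" using ab by (simp add: c_def)
  have ind: "indicator {s..<s + a} (s - c * t + c * x) = (indicator {t..<t + b} x :: ennreal)" for x
  proof -
    have "a = c * b" using ab by (simp add: c_def)
    then have "s - c * t + c * x < s + a \<longleftrightarrow> c * x < c * (t + b)" by (simp add: algebra_simps)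
    moreover have "s \<le> s - c * t + c * x \<longleftrightarrow> c * t \<le> c * x" by simp
    ultimately show ?thesis using c by (simp add: indicator_def)
  qed
  have [measurable]: "(\<lambda>x. indicator {s..<s + a} x * F x) \<in> borel_measurable lebesgue"
    by (intro borel_measurable_times_ennreal borel_measurable_indicator) auto
  have aff: "(\<lambda>x. t0 + c * x) \<in> lebesgue \<rightarrow>\<^sub>M lebesgue" for t0
    using lebesgue_affine_measurable[where c = "\<lambda>x::real. c"] c by simp
  have [measurable]: "(\<lambda>x. indicator {t..<t + b} x * F (s - c * t + c * x)) \<in> borel_measurable lebesgue"
    by (intro borel_measurable_times_ennreal borel_measurable_indicator measurable_compose[OF aff]) auto
  have "(\<integral>\<^sup>+x. indicator {s..<s + a} x * F x \<partial>lebesgue)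
      = ennreal \<bar>c\<bar> * (\<integral>\<^sup>+x. indicator {s..<s + a} (s - c * t + c * x) * F (s - c * t + c * x) \<partial>lebesgue)"
    by (rule nn_integral_real_affine_lebesgue) (use c in auto)
  also have "\<dots> = (\<integral>\<^sup>+x. ennreal c * (indicator {t..<t + b} x * F (s - c * t + c * x)) \<partial>lebesgue)"
    unfolding ind using c by (subst nn_integral_cmult) auto
  finally show ?thesis by (simp add: c_def[symmetric] algebra_simps)
qed

section \<open>The isometry determined by two tilings\<close>

locale piecewise_affine =
  fixes p :: real and n :: nat and s a t b e :: "nat \<Rightarrow> real"
  assumes p: "1 \<le> p" and source: "interval_partition n s a" and target: "interval_partition n t b"
    and sign: "\<And>i. e i * e i = 1"
begin

text \<open>A weighted composition operator: the i-th target tile receives an affinely transported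
  copy of f on the i-th source tile, with sign \<open>e i\<close>. The factor
  \<open>(a i / b i) powr (1 / p)\<close> offsets the change of length in the p-norm.\<close>

definition opf :: "(real \<Rightarrow> real) \<Rightarrow> real \<Rightarrow> real"
  where "opf f x = (\<Sum>i<n. indicator {t i..<t i + b i} x *
    (e i * (a i / b i) powr (1 / p) * f (s i + a i / b i * (x - t i))))"

lemma lengths: "i < n \<Longrightarrow> 0 < a i" "i < n \<Longrightarrow> 0 < b i"
  using source target by (auto simp: interval_partition_def)

lemma opf_eq:
  "i < n \<Longrightarrow> x \<in> {t i..<t i + b i} \<Longrightarrow>
    opf f x = e i * (a i / b i) powr (1 / p) * f (s i + a i / b i * (x - t i))"
  unfolding opf_def by (rule interval_partition_sum_indicator[OF target])

lemma opf_outside: "x \<notin> {0..<1} \<Longrightarrow> opf f x = 0"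
  unfolding opf_def by (rule interval_partition_sum_outside[OF target])

lemma source_point:
  assumes i: "i < n" and x: "x \<in> {t i..<t i + b i}"
  shows "s i + a i / b i * (x - t i) \<in> {s i..<s i + a i}"
proof -
  have "a i / b i * (x - t i) < a i / b i * b i"
    using x lengths[OF i] by (intro mult_strict_left_mono) auto
  then show ?thesis using x lengths[OF i] by simp
qed

lemma target_cases:
  assumes "x \<in> {0..<1}"
  obtains i where "i < n" "x \<in> {t i..<t i + b i}"
  using target assms unfolding interval_partition_def by blast

text \<open>All evaluation points lie in source tiles. Hence f can be replaced by its extension by
  zero, which is measurable on the whole line.\<close>

lemma opf_cong:
  assumes "\<And>x. x \<in> {0..<1} \<Longrightarrow> f x = g x"
  shows "opf f x = opf g x"
proof (cases "x \<in> {0..<1}")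
  case True
  then obtain i where i: "i < n" "x \<in> {t i..<t i + b i}" by (rule target_cases)
  have "s i + a i / b i * (x - t i) \<in> {0..<1}"
    using source_point[OF i] source i(1) unfolding interval_partition_def by blast
  then show ?thesis using i assms by (simp add: opf_eq)
qed (simp add: opf_outside)

lemma piece_measurable:
  assumes "i < n"
  shows "(\<lambda>x. s i + a i / b i * (x - t i)) \<in> lebesgue \<rightarrow>\<^sub>M lebesgue"
proof -
  have "(\<lambda>x. (s i - a i / b i * t i) + a i / b i * x) \<in> lebesgue \<rightarrow>\<^sub>M lebesgue"
    using lebesgue_affine_measurable[where c = "\<lambda>x::real. a i / b i"] lengths[OF assms] by simp
  also have "(\<lambda>x. (s i - a i / b i * t i) + a i / b i * x) = (\<lambda>x. s i + a i / b i * (x - t i))"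
    by (simp add: fun_eq_iff right_diff_distrib)
  finally show ?thesis .
qed

lemma opf_measurable [measurable]:
  assumes "f \<in> unit_measurable"
  shows "opf f \<in> unit_measurable"
proof -
  let ?f = "\<lambda>x. indicator {0..<1} x * f x"
  have f: "?f \<in> borel_measurable lebesgue" using assms by (rule lebesgue_measurable_extension)
  note aff = piece_measurable
  have "opf ?f \<in> borel_measurable lebesgue"
    unfolding opf_def
    by (intro borel_measurable_sum borel_measurable_times borel_measurable_const
        borel_measurable_indicator measurable_compose[OF aff f]) auto
  moreover have "opf ?f = opf f" by (intro ext opf_cong) simp
  ultimately show ?thesis by (simp add: measurable_restrict_space1)
qed

lemma abs_opf_powr:
  "ennreal (\<bar>opf f x\<bar> powr p) = (\<Sum>i<n. indicator {t i..<t i + b i} x *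
    (ennreal (a i / b i) * ennreal (\<bar>f (s i + a i / b i * (x - t i))\<bar> powr p)))"
proof (cases "x \<in> {0..<1}")
  case True
  then obtain i where i: "i < n" "x \<in> {t i..<t i + b i}" by (rule target_cases)
  have "\<bar>e i\<bar> = 1" using sign[of i] by (metis abs_mult_self_eq abs_one abs_mult power2_eq_square power2_eq_1_iff abs_ge_zero abs_eq_iff')
  then have "\<bar>opf f x\<bar> powr p = a i / b i * \<bar>f (s i + a i / b i * (x - t i))\<bar> powr p"
    using i lengths[OF i(1)] p by (simp add: opf_eq abs_mult powr_mult powr_powr)
  then have "ennreal (\<bar>opf f x\<bar> powr p) = ennreal (a i / b i) * ennreal (\<bar>f (s i + a i / b i * (x - t i))\<bar> powr p)"
    using lengths[OF i(1)] by (simp only: ennreal_mult divide_nonneg_pos less_imp_le powr_ge_zero)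
  then show ?thesis by (simp only: interval_partition_sum_indicator[OF target i])
next
  case False
  show ?thesis
    unfolding opf_outside[OF False] interval_partition_sum_outside[OF target False] using p by simp
qed

text \<open>On each target tile the substitution gives the integral over the matching source tile,
  and the source tiles again make up [0,1).\<close>

lemma nn_integral_opf:
  assumes f: "f \<in> unit_measurable"
  shows "(\<integral>\<^sup>+x. \<bar>opf f x\<bar> powr p \<partial>unit_interval_measure) = (\<integral>\<^sup>+x. \<bar>f x\<bar> powr p \<partial>unit_interval_measure)"
proof -
  let ?f = "\<lambda>x. indicator {0..<1} x * f x"
  have fm [measurable]: "?f \<in> borel_measurable lebesgue" using f by (rule lebesgue_measurable_extension)
  have Fm: "(\<lambda>x. ennreal (\<bar>?f x\<bar> powr p)) \<in> borel_measurable lebesgue" by measurable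
  note aff = piece_measurable
  have "(\<integral>\<^sup>+x. \<bar>opf f x\<bar> powr p \<partial>unit_interval_measure) = (\<integral>\<^sup>+x. \<bar>indicator {0..<1} x * opf f x\<bar> powr p \<partial>lebesgue)"
    using p by (intro nn_integral_unit_interval) simp
  also have "\<dots> = (\<integral>\<^sup>+x. \<bar>opf ?f x\<bar> powr p \<partial>lebesgue)"
  proof (rule nn_integral_cong)
    fix x
    have "opf ?f x = opf f x" by (rule opf_cong) simp
    then show "ennreal (\<bar>indicator {0..<1} x * opf f x\<bar> powr p) = ennreal (\<bar>opf ?f x\<bar> powr p)"
      by (cases "x \<in> {0..<1}") (auto simp: opf_outside)
  qed
  also have "\<dots> = (\<Sum>i<n. \<integral>\<^sup>+x. indicator {t i..<t i + b i} x *
      (ennreal (a i / b i) * ennreal (\<bar>?f (s i + a i / b i * (x - t i))\<bar> powr p)) \<partial>lebesgue)"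
    unfolding abs_opf_powr
    by (rule nn_integral_sum) (intro borel_measurable_times_ennreal borel_measurable_indicator borel_measurable_const
        measurable_compose[OF aff Fm]; simp)
  also have "\<dots> = (\<Sum>i<n. \<integral>\<^sup>+x. indicator {s i..<s i + a i} x * ennreal (\<bar>?f x\<bar> powr p) \<partial>lebesgue)"
    by (intro sum.cong refl nn_integral_affine_piece[OF Fm] lengths) auto
  also have "\<dots> = (\<integral>\<^sup>+x. (\<Sum>i<n. indicator {s i..<s i + a i} x * ennreal (\<bar>?f x\<bar> powr p)) \<partial>lebesgue)"
    by (rule nn_integral_sum[symmetric]) (intro borel_measurable_times_ennreal borel_measurable_indicator Fm; simp)
  also have "\<dots> = (\<integral>\<^sup>+x. ennreal (\<bar>?f x\<bar> powr p) \<partial>lebesgue)"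
  proof (rule nn_integral_cong)
    fix x
    show "(\<Sum>i<n. indicator {s i..<s i + a i} x * ennreal (\<bar>?f x\<bar> powr p)) = ennreal (\<bar>?f x\<bar> powr p)"
    proof (cases "x \<in> {0..<1}")
      case True
      then obtain i where "i < n" "x \<in> {s i..<s i + a i}"
        using source unfolding interval_partition_def by blast
      then show ?thesis by (rule interval_partition_sum_indicator[OF source])
    qed (use p in simp)
  qed
  also have "\<dots> = (\<integral>\<^sup>+x. \<bar>f x\<bar> powr p \<partial>unit_interval_measure)"
    using p by (intro nn_integral_unit_interval[symmetric]) simp
  finally show ?thesis .
qed

lemma opf_diff: "opf f x - opf g x = opf (\<lambda>x. f x - g x) x"
  by (simp add: opf_def sum_subtractf[symmetric] algebra_simps)

lemma opf_add: "opf f x + opf g x = opf (\<lambda>x. f x + g x) x"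
  by (simp add: opf_def sum.distrib[symmetric] algebra_simps)

lemma opf_scale: "opf (\<lambda>x. c * f x) x = c * opf f x"
  by (simp add: opf_def sum_distrib_left algebra_simps)

text \<open>By linearity and norm preservation the difference of the images has p-th power integral
  zero. This makes the operator well defined on classes.\<close>

lemma opf_cong_AE:
  assumes [measurable]: "f \<in> unit_measurable" "g \<in> unit_measurable"
    and "AE x in unit_interval_measure. f x = g x"
  shows "AE x in unit_interval_measure. opf f x = opf g x"
proof -
  have "(\<integral>\<^sup>+x. \<bar>opf f x - opf g x\<bar> powr p \<partial>unit_interval_measure) = (\<integral>\<^sup>+x. \<bar>f x - g x\<bar> powr p \<partial>unit_interval_measure)"
    unfolding opf_diff by (rule nn_integral_opf) simp
  also have "\<dots> = (\<integral>\<^sup>+x. 0 \<partial>unit_interval_measure)"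
    using assms(3) by (intro nn_integral_cong_AE) (auto elim: AE_mp)
  finally have "AE x in unit_interval_measure. ennreal (\<bar>opf f x - opf g x\<bar> powr p) = 0"
    by (subst nn_integral_0_iff_AE[symmetric]) (simp_all add: opf_measurable)
  then show ?thesis by eventually_elim (simp add: ennreal_eq_0_iff)
qed

definition op :: "L0 \<Rightarrow> L0"
  where "op f = abs_L0 (opf (rep_L0 f))"

lemma op_abs: "f \<in> unit_measurable \<Longrightarrow> op (abs_L0 f) = abs_L0 (opf f)"
  unfolding op_def by (simp add: abs_L0_eq_iff opf_measurable opf_cong_AE rep_abs_L0_AE)

lemma op_plus: "op (f + g) = op f + op g"
proof -
  have "op (abs_L0 f + abs_L0 g) = op (abs_L0 f) + op (abs_L0 g)"
    if [measurable]: "f \<in> unit_measurable" "g \<in> unit_measurable" for f g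
    by (simp add: abs_L0_plus op_abs opf_measurable opf_add)
  from this[of "rep_L0 f" "rep_L0 g"] show ?thesis by simp
qed

lemma op_scaleR: "op (c *\<^sub>R f) = c *\<^sub>R op f"
proof -
  have "op (c *\<^sub>R abs_L0 f) = c *\<^sub>R op (abs_L0 f)"
    if [measurable]: "f \<in> unit_measurable" for f
    by (simp add: abs_L0_scaleR op_abs opf_measurable opf_scale[abs_def])
  from this[of "rep_L0 f"] show ?thesis by simp
qed

lemma op_p_integrable: "p_integrable p (op f) \<longleftrightarrow> p_integrable p f"
  using p_integrable_abs_L0_nn[of "opf (rep_L0 f)"] p_integrable_abs_L0_nn[of "rep_L0 f"]
  by (simp add: op_def opf_measurable nn_integral_opf)

lemma op_norm: "Lp_norm p (op f) = Lp_norm p f"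
  using Lp_norm_abs_L0_nn[of "opf (rep_L0 f)"] Lp_norm_abs_L0_nn[of "rep_L0 f"]
  by (simp add: op_def opf_measurable nn_integral_opf)

text \<open>Exchanging source and target inverts the affine maps; the signs square to 1 and the two
  weights are reciprocal. Surjectivity of the isometry follows from this.\<close>

lemma op_inverse: "piecewise_affine.op p n t b s a e (op f) = f"
proof -
  interpret inv: piecewise_affine p n t b s a e
    using p source target sign by unfold_locales
  have eq: "inv.opf (opf g) x = g x" if "x \<in> {0..<1}" for g x
  proof -
    obtain i where i: "i < n" "x \<in> {s i..<s i + a i}" using inv.target_cases[OF \<open>x \<in> {0..<1}\<close>] .
    let ?y = "t i + b i / a i * (x - s i)"
    have y: "?y \<in> {t i..<t i + b i}" by (rule inv.source_point[OF i])
    have "s i + a i / b i * (?y - t i) = x" using lengths[OF i(1)] by (simp add: field_simps)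
    then have "inv.opf (opf g) x = e i * (b i / a i) powr (1 / p) * (e i * (a i / b i) powr (1 / p) * g x)"
      using inv.opf_eq[OF i] opf_eq[OF i(1) y] by simp
    also have "\<dots> = (e i * e i) * ((b i / a i) powr (1 / p) * (a i / b i) powr (1 / p)) * g x" by simp
    also have "(b i / a i) powr (1 / p) * (a i / b i) powr (1 / p) = (b i / a i * (a i / b i)) powr (1 / p)"
      by (rule powr_mult[symmetric])
    also have "b i / a i * (a i / b i) = 1" using lengths[OF i(1)] by simp
    finally show ?thesis using sign by simp
  qed
  have "inv.op (abs_L0 g) = abs_L0 (inv.opf g)" if "g \<in> unit_measurable" for g
    using that by (rule inv.op_abs)
  then have "inv.op (op f) = abs_L0 (inv.opf (opf (rep_L0 f)))"
    by (simp add: op_def opf_measurable)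
  also have "\<dots> = abs_L0 (rep_L0 f)"
    by (subst abs_L0_eq_iff) (use AE_unit_interval_less_1 eq in \<open>auto simp: opf_measurable inv.opf_measurable elim!: AE_mp\<close>)
  finally show ?thesis by simp
qed

lemma op_isometry: "restrict op (Lp p) \<in> Lp_isometries p"
proof -
  interpret inv: piecewise_affine p n t b s a e
    using p source target sign by unfold_locales
  have "bij_betw op (Lp p) (Lp p)"
    by (rule bij_betw_byWitness[where f' = inv.op])
      (auto simp: op_inverse inv.op_inverse Lp_def op_p_integrable inv.op_p_integrable)
  then have "restrict op (Lp p) \<in> Bij (Lp p)"
    by (simp add: Bij_def)
  then show ?thesis
    by (simp add: Lp_isometries_def Lp_add[OF p] Lp_scaleR op_plus op_scaleR op_norm)
qed

end


section \<open>Moving step functions into a compact set\<close>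

lemma exists_sorting_permutation:
  fixes v :: "nat \<Rightarrow> 'a::linorder"
  shows "\<exists>\<sigma>. bij_betw \<sigma> {..<L} {..<L} \<and> (\<forall>i j. i \<le> j \<longrightarrow> j < L \<longrightarrow> v (\<sigma> i) \<le> v (\<sigma> j))"
proof -
  let ?l = "sort_key v [0..<L]"
  have len: "length ?l = L" by simp
  have "bij_betw ((!) ?l) {..<L} {..<L}"
    by (rule bij_betw_nth) auto
  moreover have "v (?l ! i) \<le> v (?l ! j)" if "i \<le> j" "j < L" for i j
    using sorted_nth_mono[OF sorted_sort_key[of v "[0..<L]"] that(1)] that len by simp
  ultimately show ?thesis by blast
qed

text \<open>The stretch factor \<open>r * \<bar>u\<bar> powr p / S\<close> is proportional to the
  p-th power of the value it acts on, so u cancels from the rescaled modulus.\<close>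

lemma edge_value:
  fixes u S r p :: real
  assumes "0 < p" "0 < S" "0 < r" "u \<noteq> 0"
  shows "(1 / (r * \<bar>u\<bar> powr p / S)) powr (1 / p) * \<bar>u\<bar> = (S / r) powr (1 / p)"
proof -
  have "(1 / (r * \<bar>u\<bar> powr p / S)) powr (1 / p) * \<bar>u\<bar>
      = (1 / (r * \<bar>u\<bar> powr p / S)) powr (1 / p) * (\<bar>u\<bar> powr p) powr (1 / p)"
    using assms by (simp add: powr_powr)
  also have "\<dots> = (1 / (r * \<bar>u\<bar> powr p / S) * \<bar>u\<bar> powr p) powr (1 / p)"
    by (rule powr_mult[symmetric])
  also have "1 / (r * \<bar>u\<bar> powr p / S) * \<bar>u\<bar> powr p = S / r"
    using assms by (simp add: field_simps)
  finally show ?thesis .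
qed

text \<open>This bounds what a stretched cell contributes to the displacement of the constant 1.
  With w the weight, \<open>\<bar>e * w - 1\<bar>\<close> is at most 2 max(w,1), and w to the p is 1
  / b, so multiplying by the length b leaves 1 + b.\<close>

lemma edge_defect:
  fixes b e p :: real
  assumes p: "1 \<le> p" and b: "0 < b" and e: "e * e = 1"
  shows "b * \<bar>e * (1 / b) powr (1 / p) - 1\<bar> powr p \<le> 2 powr p * (1 + b)"
proof -
  define w where "w = (1 / b) powr (1 / p)"
  have w: "0 \<le> w" "w powr p = 1 / b" using p b by (simp_all add: w_def powr_powr)
  have "\<bar>e\<bar> = 1" using e by (metis abs_1 abs_minus_cancel power2_eq_square power2_eq_1_iff)
  then have "\<bar>e * w - 1\<bar> \<le> w + 1"
    using w abs_triangle_ineq4[of "e * w" 1] by (simp add: abs_mult)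
  also have "\<dots> \<le> 2 * max w 1" by simp
  finally have "\<bar>e * w - 1\<bar> powr p \<le> (2 * max w 1) powr p"
    using p by (intro powr_mono2) auto
  also have "\<dots> = 2 powr p * (max w 1) powr p" by (rule powr_mult)
  also have "(max w 1) powr p \<le> w powr p + 1" by (simp add: max_def)
  finally have "\<bar>e * w - 1\<bar> powr p \<le> 2 powr p * (1 / b + 1)" using w by simp
  then have "b * \<bar>e * w - 1\<bar> powr p \<le> b * (2 powr p * (1 / b + 1))"
    using b by (intro mult_left_mono) auto
  also have "\<dots> = 2 powr p * (1 + b)" using b by (simp add: field_simps)
  finally show ?thesis by (simp add: w_def)
qed

text \<open>
  \<open>\<beta> i\<close> is the factor by which the cell holding the value \<open>v (\<sigma> i)\<close> is stretched. The first and the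
  last \<open>r\<close> cells are stretched in proportion to \<open>\<bar>v\<bar>\<close> to the \<open>p\<close>, which makes the new values there
  constant, and the last inequality bounds the displacement of constants.
\<close>

lemma block_rearrangement:
  fixes v :: "nat \<Rightarrow> real"
  assumes p: "1 \<le> p" and r: "0 < r" "2 * r \<le> L" and v: "\<And>i. v i \<noteq> 0"
  shows "\<exists>\<sigma> \<beta> e. bij_betw \<sigma> {..<L} {..<L} \<and> (\<forall>i<L. 0 < \<beta> i) \<and> sum \<beta> {..<L} = real L \<and>
    (\<forall>i. e i * e i = 1) \<and>
    (\<forall>i j. i \<le> j \<longrightarrow> j < L \<longrightarrow> e i * (1 / \<beta> i) powr (1 / p) * v (\<sigma> i) \<le> e j * (1 / \<beta> j) powr (1 / p) * v (\<sigma> j)) \<and>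
    (\<forall>i<L. \<bar>e i * (1 / \<beta> i) powr (1 / p) * v (\<sigma> i)\<bar> \<le> ((\<Sum>i<L. \<bar>v i\<bar> powr p) / r) powr (1 / p)) \<and>
    (\<Sum>i<L. \<beta> i * \<bar>e i * (1 / \<beta> i) powr (1 / p) - 1\<bar> powr p) \<le> 2 powr p * (4 * r)"
proof -
  obtain \<sigma> where \<sigma>: "bij_betw \<sigma> {..<L} {..<L}"
    and sorted: "\<And>i j. i \<le> j \<Longrightarrow> j < L \<Longrightarrow> v (\<sigma> i) \<le> v (\<sigma> j)"
    using exists_sorting_permutation[of L v] by blast
  define u where "u i = v (\<sigma> i)" for i
  have u0: "u i \<noteq> 0" for i using v by (simp add: u_def)
  have mono: "u i \<le> u j" if "i \<le> j" "j < L" for i j using sorted[OF that] by (simp add: u_def)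
  define S1 where "S1 = (\<Sum>i\<in>{0..<r}. \<bar>u i\<bar> powr p)"
  define S2 where "S2 = (\<Sum>i\<in>{L - r..<L}. \<bar>u i\<bar> powr p)"
  define S where "S = (\<Sum>i<L. \<bar>v i\<bar> powr p)"
  have S: "S = (\<Sum>i<L. \<bar>u i\<bar> powr p)"
    unfolding S_def u_def using sum.reindex_bij_betw[OF \<sigma>, of "\<lambda>i. \<bar>v i\<bar> powr p"] by simp
  have S1: "0 < S1" unfolding S1_def using r u0 by (intro sum_pos) auto
  have S2: "0 < S2" unfolding S2_def using r u0 by (intro sum_pos) auto
  have S1S: "S1 \<le> S" unfolding S1_def S using r by (intro sum_mono2) auto
  have S2S: "S2 \<le> S" unfolding S2_def S using r by (intro sum_mono2) auto
  define \<beta> where "\<beta> i = (if i < r then real r * \<bar>u i\<bar> powr p / S1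
    else if L - r \<le> i then real r * \<bar>u i\<bar> powr p / S2 else 1)" for i
  \<comment> \<open>The signs make every left-edge value \<open>- c1\<close> and every right-edge
    value \<open>c2\<close>, whatever the signs of the sorted values were.\<close>
  define e where "e i = (if i < r then - sgn (u i) else if L - r \<le> i then sgn (u i) else 1)" for i
  define y where "y i = e i * (1 / \<beta> i) powr (1 / p) * u i" for i
  define c1 where "c1 = (S1 / r) powr (1 / p)"
  define c2 where "c2 = (S2 / r) powr (1 / p)"
  have c: "0 \<le> c1" "0 \<le> c2" "c1 \<le> (S / r) powr (1 / p)" "c2 \<le> (S / r) powr (1 / p)"
    unfolding c1_def c2_def using p S1 S2 S1S S2S r
    by (auto intro!: powr_mono2 divide_right_mono)
  have y1: "y i = - c1" if "i < r" for i
    using edge_value[of p S1 r "u i"] p S1 r u0[of i] that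
    by (simp add: y_def e_def \<beta>_def c1_def abs_sgn mult.commute mult.left_commute)
  have y2: "y i = c2" if "\<not> i < r" "L - r \<le> i" for i
    using edge_value[of p S2 r "u i"] p S2 r u0[of i] that
    by (simp add: y_def e_def \<beta>_def c2_def abs_sgn mult.commute mult.left_commute)
  have y3: "y i = u i" if "\<not> i < r" "\<not> L - r \<le> i" for i
    using that by (simp add: y_def e_def \<beta>_def)
  \<comment> \<open>A negative middle value is dominated in modulus by all r left-edge values, hence
    by their mean of order p, which is \<open>c1\<close>. The mirror argument for positive values
    uses the right edge.\<close>
  have mid1: "- c1 \<le> u i" if "\<not> i < r" "\<not> L - r \<le> i" for i
  proof (cases "u i < 0")
    case True
    have "real r * \<bar>u i\<bar> powr p = (\<Sum>k\<in>{0..<r}. \<bar>u i\<bar> powr p)" by simp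
    also have "\<dots> \<le> S1"
      unfolding S1_def
    proof (rule sum_mono)
      fix k assume "k \<in> {0..<r}"
      then have "u k \<le> u i" using that by (intro mono) auto
      then show "\<bar>u i\<bar> powr p \<le> \<bar>u k\<bar> powr p" using True p by (intro powr_mono2) auto
    qed
    finally have "\<bar>u i\<bar> powr p \<le> S1 / r" using r by (simp add: field_simps)
    then have "(\<bar>u i\<bar> powr p) powr (1 / p) \<le> c1" unfolding c1_def using p by (intro powr_mono2) auto
    then show ?thesis using p by (simp add: powr_powr)
  qed (use c in auto)
  have mid2: "u i \<le> c2" if "\<not> i < r" "\<not> L - r \<le> i" for i
  proof (cases "0 < u i")
    case True
    have "real r * \<bar>u i\<bar> powr p = (\<Sum>k\<in>{L - r..<L}. \<bar>u i\<bar> powr p)" using r by simp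
    also have "\<dots> \<le> S2"
      unfolding S2_def
    proof (rule sum_mono)
      fix k assume "k \<in> {L - r..<L}"
      then have "u i \<le> u k" using that by (intro mono) auto
      then show "\<bar>u i\<bar> powr p \<le> \<bar>u k\<bar> powr p" using True p by (intro powr_mono2) auto
    qed
    finally have "\<bar>u i\<bar> powr p \<le> S2 / r" using r by (simp add: field_simps)
    then have "(\<bar>u i\<bar> powr p) powr (1 / p) \<le> c2" unfolding c2_def using p by (intro powr_mono2) auto
    then show ?thesis using p by (simp add: powr_powr)
  qed (use c in auto)
  have \<beta>: "0 < \<beta> i" for i using S1 S2 u0 r by (simp add: \<beta>_def)
  have e: "e i * e i = 1" for i using u0[of i] by (auto simp: e_def sgn_if)
  have split: "sum f {..<L} = sum f {0..<r} + sum f {r..<L - r} + sum f {L - r..<L}" for f :: "nat \<Rightarrow> real"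
    using r by (simp add: lessThan_atLeast0 sum.atLeastLessThan_concat)
  have \<beta>1: "sum \<beta> {0..<r} = r"
  proof -
    have "sum \<beta> {0..<r} = (\<Sum>i\<in>{0..<r}. real r / S1 * \<bar>u i\<bar> powr p)"
      by (intro sum.cong) (auto simp: \<beta>_def)
    also have "\<dots> = real r / S1 * S1" by (simp only: S1_def sum_distrib_left)
    finally show ?thesis using S1 by simp
  qed
  have \<beta>2: "sum \<beta> {L - r..<L} = r"
  proof -
    have "sum \<beta> {L - r..<L} = (\<Sum>i\<in>{L - r..<L}. real r / S2 * \<bar>u i\<bar> powr p)"
      using r by (intro sum.cong) (auto simp: \<beta>_def)
    also have "\<dots> = real r / S2 * S2" by (simp only: S2_def sum_distrib_left)
    finally show ?thesis using S2 by simp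
  qed
  have "sum \<beta> {r..<L - r} = (\<Sum>i\<in>{r..<L - r}. 1)"
    by (intro sum.cong) (auto simp: \<beta>_def)
  then have \<beta>_sum: "sum \<beta> {..<L} = real L" unfolding split \<beta>1 \<beta>2 using r by simp
  have y_mono: "y i \<le> y j" if "i \<le> j" "j < L" for i j
  proof -
    have "u i \<le> u j" using that by (rule mono)
    moreover have "- c1 \<le> c2" using c by linarith
    ultimately show ?thesis
      using that y1[of i] y1[of j] y2[of i] y2[of j] y3[of i] y3[of j] mid1[of i] mid2[of i] mid1[of j] mid2[of j]
      by (cases "i < r"; cases "j < r"; cases "L - r \<le> i"; cases "L - r \<le> j") simp_all
  qed
  have y_bound: "\<bar>y i\<bar> \<le> (S / r) powr (1 / p)" for i
    using y1[of i] y2[of i] y3[of i] mid1[of i] mid2[of i] c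
    by (cases "i < r"; cases "L - r \<le> i") (simp_all add: abs_le_iff)
  let ?d = "\<lambda>i. \<beta> i * \<bar>e i * (1 / \<beta> i) powr (1 / p) - 1\<bar> powr p"
  have edge: "?d i \<le> 2 powr p * (1 + \<beta> i)" for i by (rule edge_defect[OF p \<beta> e])
  \<comment> \<open>Middle cells are not changed. On either edge \<beta> sums to r, so the terms 1 +
    \<beta> sum to 2 r there.\<close>
  have "sum ?d {..<L} = sum ?d {0..<r} + sum ?d {r..<L - r} + sum ?d {L - r..<L}" by (rule split)
  also have "sum ?d {r..<L - r} = 0"
    using p by (intro sum.neutral) (auto simp: \<beta>_def e_def)
  also have "sum ?d {0..<r} \<le> (\<Sum>i\<in>{0..<r}. 2 powr p * (1 + \<beta> i))" by (intro sum_mono edge)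
  also have "\<dots> = 2 powr p * (2 * r)"
    by (simp only: sum_distrib_left[symmetric] sum.distrib \<beta>1) simp
  also have "sum ?d {L - r..<L} \<le> (\<Sum>i\<in>{L - r..<L}. 2 powr p * (1 + \<beta> i))" by (intro sum_mono edge)
  also have "\<dots> = 2 powr p * (2 * r)"
    using r by (simp only: sum_distrib_left[symmetric] sum.distrib \<beta>2) simp
  finally have "sum ?d {..<L} \<le> 2 powr p * (4 * r)" by (simp add: algebra_simps)
  then show ?thesis
    by (intro exI[of _ \<sigma>] exI[of _ \<beta>] exI[of _ e] conjI allI impI \<sigma> \<beta> \<beta>_sum e
      y_mono[unfolded y_def u_def] y_bound[unfolded y_def u_def S_def]) assumption+
qed

section \<open>Uniform tilings, tilings by partial sums, and piecewise constant functions\<close>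

lemma mem_cell_iff:
  assumes "0 < n" "0 \<le> x"
  shows "x \<in> {real m / real n..<real m / real n + 1 / real n} \<longleftrightarrow> nat \<lfloor>real n * x\<rfloor> = m"
proof -
  have "x \<in> {real m / real n..<real m / real n + 1 / real n} \<longleftrightarrow> real m \<le> real n * x \<and> real n * x < real m + 1"
    using assms by (auto simp: field_simps)
  also have "\<dots> \<longleftrightarrow> \<lfloor>real n * x\<rfloor> = int m" by (simp add: floor_eq_iff)
  also have "\<dots> \<longleftrightarrow> nat \<lfloor>real n * x\<rfloor> = m" using assms by (auto simp: nat_eq_iff)
  finally show ?thesis .
qed

lemma interval_partition_uniform:
  assumes n: "0 < n" and \<sigma>: "bij_betw \<sigma> {..<n} {..<n}"
  shows "interval_partition n (\<lambda>k. real (\<sigma> k) / real n) (\<lambda>_. 1 / real n)"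
  unfolding interval_partition_def
proof (intro conjI allI impI ballI)
  fix i assume "i < n"
  then have "\<sigma> i < n" using \<sigma> by (auto simp: bij_betw_def)
  then have "real (\<sigma> i) + 1 \<le> real n" by linarith
  then have "(real (\<sigma> i) + 1) / real n \<le> 1" using n by simp
  then show "{real (\<sigma> i) / real n..<real (\<sigma> i) / real n + 1 / real n} \<subseteq> {0..<1}"
    using n by (auto simp: add_divide_distrib intro: order_trans[rotated])
next
  fix x :: real assume x: "x \<in> {0..<1}"
  then have "real n * x < real n" "0 \<le> real n * x" using n by simp_all
  then have m: "nat \<lfloor>real n * x\<rfloor> < n" by linarith
  have "x \<in> {real (\<sigma> i) / real n..<real (\<sigma> i) / real n + 1 / real n} \<longleftrightarrow> \<sigma> i = nat \<lfloor>real n * x\<rfloor>" for i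
    using mem_cell_iff[OF n] x by auto
  moreover have "\<exists>!i. i \<in> {..<n} \<and> \<sigma> i = nat \<lfloor>real n * x\<rfloor>"
    using bij_betw_iff_bijections[of \<sigma> "{..<n}" "{..<n}"] \<sigma> m by (metis lessThan_iff)
  ultimately show "\<exists>!i. i < n \<and> x \<in> {real (\<sigma> i) / real n..<real (\<sigma> i) / real n + 1 / real n}"
    by simp
qed (use n in simp)

lemma partial_sums_mono:
  fixes b :: "nat \<Rightarrow> real"
  assumes b: "\<And>i. i < n \<Longrightarrow> 0 < b i" and ij: "i \<le> j" "j \<le> n"
  shows "sum b {..<i} \<le> sum b {..<j}"
proof (rule sum_mono2)
  fix k assume "k \<in> {..<j} - {..<i}"
  then show "0 \<le> b k" using b[of k] ij by simp
qed (use ij in auto)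

lemma interval_partition_partial_sums:
  fixes b :: "nat \<Rightarrow> real"
  assumes b: "\<And>i. i < n \<Longrightarrow> 0 < b i" and 1: "sum b {..<n} = 1"
  shows "interval_partition n (\<lambda>k. sum b {..<k}) b"
  unfolding interval_partition_def
proof (intro conjI allI impI ballI)
  note mono = partial_sums_mono[of n b, OF b]
  fix i assume i: "i < n"
  show "0 < b i" using b i .
  have "0 \<le> sum b {..<i}" using mono[of 0 i] i by simp
  moreover have "sum b {..<i} + b i \<le> 1" using mono[of "Suc i" n] i 1 by simp
  ultimately show "{sum b {..<i}..<sum b {..<i} + b i} \<subseteq> {0..<1}" by auto
next
  note mono = partial_sums_mono[of n b, OF b]
  fix x :: real assume x: "x \<in> {0..<1}"
  have "x < sum b {..<n}" using x 1 by simp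
  \<comment> \<open>The tile containing x is the one that ends at the first partial sum exceeding
    x.\<close>
  define k where "k = (LEAST k. x < sum b {..<Suc k})"
  have n: "0 < n" using 1 by (cases n) auto
  then have "x < sum b {..<Suc (n - 1)}" using \<open>x < sum b {..<n}\<close> by simp
  then have k: "x < sum b {..<Suc k}" and kn: "k \<le> n - 1"
    unfolding k_def by (rule LeastI, rule Least_le)
  have "sum b {..<k} \<le> x"
  proof (cases k)
    case (Suc j)
    then have "\<not> x < sum b {..<Suc j}"
      using not_less_Least[of j "\<lambda>k. x < sum b {..<Suc k}"] by (simp add: k_def)
    then show ?thesis using Suc by simp
  qed (use x in simp)
  then have k_mem: "k < n \<and> x \<in> {sum b {..<k}..<sum b {..<k} + b k}" using k kn n by simp
  have "i = k" if i: "i < n \<and> x \<in> {sum b {..<i}..<sum b {..<i} + b i}" for i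
  proof (rule ccontr)
    assume "i \<noteq> k"
    then consider "Suc i \<le> k" | "Suc k \<le> i" by linarith
    then show False
    proof cases
      case 1
      then show False using mono[of "Suc i" k] i k_mem by simp
    next
      case 2
      then show False using mono[of "Suc k" i] i k_mem by simp
    qed
  qed
  with k_mem show "\<exists>!i. i < n \<and> x \<in> {sum b {..<i}..<sum b {..<i} + b i}" by blast
qed

lemma Lp_norm_piecewise_constant:
  assumes p: "1 \<le> p" and part: "interval_partition n t b" and f: "f \<in> unit_measurable"
    and z: "\<And>i x. i < n \<Longrightarrow> x \<in> {t i..<t i + b i} \<Longrightarrow> f x = z i"
  shows "Lp_norm p (abs_L0 f) = (\<Sum>i<n. b i * \<bar>z i\<bar> powr p) powr (1 / p)"
proof -
  have b: "0 \<le> b i" if "i < n" for i using part that by (auto simp: interval_partition_def less_imp_le)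
  have "(\<integral>\<^sup>+x. \<bar>f x\<bar> powr p \<partial>unit_interval_measure) = (\<integral>\<^sup>+x. \<bar>indicator {0..<1} x * f x\<bar> powr p \<partial>lebesgue)"
    by (rule nn_integral_unit_interval) (use p in simp)
  also have "\<dots> = (\<integral>\<^sup>+x. (\<Sum>i<n. indicator {t i..<t i + b i} x * ennreal (\<bar>z i\<bar> powr p)) \<partial>lebesgue)"
  proof (rule nn_integral_cong)
    fix x :: real
    show "ennreal (\<bar>indicator {0..<1} x * f x\<bar> powr p) = (\<Sum>i<n. indicator {t i..<t i + b i} x * ennreal (\<bar>z i\<bar> powr p))"
    proof (cases "x \<in> {0..<1}")
      case True
      then obtain i where i: "i < n" "x \<in> {t i..<t i + b i}"
        using part unfolding interval_partition_def by blast
      have "ennreal (\<bar>indicator {0..<1} x * f x\<bar> powr p) = ennreal (\<bar>z i\<bar> powr p)"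
        using True z[OF i] by simp
      then show ?thesis by (simp only: interval_partition_sum_indicator[OF part i])
    next
      case False
      then show ?thesis
        unfolding interval_partition_sum_outside[OF part False] using p by simp
    qed
  qed
  also have "\<dots> = (\<Sum>i<n. \<integral>\<^sup>+x. indicator {t i..<t i + b i} x * ennreal (\<bar>z i\<bar> powr p) \<partial>lebesgue)"
    by (rule nn_integral_sum) (intro borel_measurable_times_ennreal borel_measurable_indicator; simp)
  also have "\<dots> = (\<Sum>i<n. ennreal (b i * \<bar>z i\<bar> powr p))"
  proof (intro sum.cong refl)
    fix i assume "i \<in> {..<n}"
    have "(\<integral>\<^sup>+x. indicator {t i..<t i + b i} x * ennreal (\<bar>z i\<bar> powr p) \<partial>lebesgue)
        = emeasure lebesgue {t i..<t i + b i} * ennreal (\<bar>z i\<bar> powr p)"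
      by (subst nn_integral_multc) (auto intro: borel_measurable_indicator)
    then show "(\<integral>\<^sup>+x. indicator {t i..<t i + b i} x * ennreal (\<bar>z i\<bar> powr p) \<partial>lebesgue)
        = ennreal (b i * \<bar>z i\<bar> powr p)"
      using b \<open>i \<in> {..<n}\<close> by (simp add: ennreal_mult)
  qed
  also have "\<dots> = ennreal (\<Sum>i<n. b i * \<bar>z i\<bar> powr p)"
    using b by (intro sum_ennreal) simp
  finally have "(\<integral>\<^sup>+x. \<bar>f x\<bar> powr p \<partial>unit_interval_measure) = ennreal (\<Sum>i<n. b i * \<bar>z i\<bar> powr p)" .
  moreover have "0 \<le> (\<Sum>i<n. b i * \<bar>z i\<bar> powr p)" using b by (intro sum_nonneg) simp
  ultimately show ?thesis by (simp add: Lp_norm_abs_L0_nn[OF f])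
qed

section \<open>Monotone extension and assembly of the blocks\<close>

lemma continuous_at_right_jump:
  "continuous (at_right x) (\<lambda>x::real. if c \<le> x then 1 else 0 :: real)"
  unfolding continuous_within
proof (rule tendsto_eventually)
  show "\<forall>\<^sub>F y in at_right x. (if c \<le> y then 1 else 0) = (if c \<le> x then 1 else 0 :: real)"
  proof (cases "c \<le> x")
    case True
    have "\<forall>\<^sub>F y in at_right x. x < y" by (rule eventually_at_right_less)
    then show ?thesis by eventually_elim (use True in auto)
  next
    case False
    have "\<forall>\<^sub>F y in at_right x. y < c"
      using False by (simp add: eventually_at_right_field) (metis not_le)
    then show ?thesis by eventually_elim (use False in auto)
  qed
qed

text \<open>Add to \<open>y 0\<close> a nonnegative jump at the left end of each later tile. Jumps
  of the form \<open>c \<le> x\<close> are right continuous, and the sum is defined and bounded on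
  the whole line, as Helly's theorem requires.\<close>

lemma monotone_step_extension:
  fixes b y :: "nat \<Rightarrow> real"
  assumes b: "\<And>i. i < n \<Longrightarrow> 0 < b i" and n: "0 < n"
    and y: "\<And>i j. i \<le> j \<Longrightarrow> j < n \<Longrightarrow> y i \<le> y j" and M: "\<And>i. i < n \<Longrightarrow> \<bar>y i\<bar> \<le> M"
  shows "\<exists>g. mono g \<and> (\<forall>x. continuous (at_right x) g) \<and> (\<forall>x. \<bar>g x\<bar> \<le> M) \<and>
    (\<forall>k<n. \<forall>x\<in>{sum b {..<k}..<sum b {..<k} + b k}. g x = y k)"
proof -
  define J where "J c x = (if c \<le> x then 1 else 0 :: real)" for c x :: real
  define g where "g x = y 0 + (\<Sum>j<n - 1. (y (Suc j) - y j) * J (sum b {..<Suc j}) x)" for x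
  have d: "0 \<le> y (Suc j) - y j" if "j < n - 1" for j using y[of j "Suc j"] that by simp
  have "mono g"
    unfolding g_def
  proof (intro monoI add_left_mono sum_mono mult_left_mono)
    fix j assume "j \<in> {..<n - 1}"
    then show "0 \<le> y (Suc j) - y j" using d by simp
  qed (auto simp: J_def)
  moreover have "continuous (at_right x) g" for x
    unfolding g_def[abs_def] J_def[abs_def]
    by (intro continuous_add continuous_sum continuous_mult continuous_const continuous_at_right_jump)
  moreover have "\<bar>g x\<bar> \<le> M" for x
  proof -
    have "y 0 \<le> g x" unfolding g_def using d by (auto intro!: sum_nonneg simp: J_def)
    moreover have "(\<Sum>j<n - 1. (y (Suc j) - y j) * J (sum b {..<Suc j}) x) \<le> (\<Sum>j<n - 1. y (Suc j) - y j)"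
      using d by (intro sum_mono) (auto simp: J_def)
    then have "g x \<le> y (n - 1)" unfolding g_def sum_lessThan_telescope by simp
    ultimately show ?thesis using M[of 0] M[of "n - 1"] n by linarith
  qed
  moreover have "g x = y k" if k: "k < n" and x: "x \<in> {sum b {..<k}..<sum b {..<k} + b k}" for k x
  proof -
    note mono = partial_sums_mono[of n b, OF b]
    have "J (sum b {..<Suc j}) x = (if j < k then 1 else 0)" if "j < n - 1" for j
    proof (cases "j < k")
      case True
      then show ?thesis using mono[of "Suc j" k] k x by (simp add: J_def)
    next
      case False
      then have "sum b {..<Suc k} \<le> sum b {..<Suc j}" using that by (intro mono) auto
      then show ?thesis using x False by (simp add: J_def)
    qed
    then have "g x = y 0 + (\<Sum>j<n - 1. if j < k then y (Suc j) - y j else 0)"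
      unfolding g_def by (intro arg_cong2[of _ _ _ _ "(+)"] refl sum.cong) auto
    also have "(\<Sum>j<n - 1. if j < k then y (Suc j) - y j else 0) = (\<Sum>j<k. y (Suc j) - y j)"
      using k by (intro sum.mono_neutral_cong_right) auto
    finally show ?thesis by (simp add: sum_lessThan_telescope)
  qed
  ultimately show ?thesis by blast
qed

lemma sum_blocks:
  fixes f :: "nat \<Rightarrow> 'a::comm_monoid_add"
  shows "sum f {..<N * L} = (\<Sum>j<N. \<Sum>i<L. f (j * L + i))"
proof -
  have "sum f {j * L..<j * L + L} = (\<Sum>i<L. f (j * L + i))" for j
    by (simp add: sum.atLeastLessThan_shift_0[of f "j * L"] lessThan_atLeast0 o_def)
  then show ?thesis using sum.nat_group[of f L N] by simp
qed

text \<open>Each of the N blocks has R * r cells and is treated by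
  \<open>block_rearrangement\<close> with r edge cells at either end, a fraction 1 / R. Therefore
  neither \<open>M\<close> nor the displacement bound depends on r, the fineness of the step
  function. Nonzero values keep the stretch factors positive.\<close>

lemma step_to_monotone_class:
  fixes v :: "nat \<Rightarrow> real"
  assumes p: "1 \<le> p" and N: "0 < N" and R: "2 \<le> R" and r: "0 < r" and v: "\<And>i. v i \<noteq> 0"
    and norm: "Lp_norm p (abs_L0 (stepf (N * (R * r)) v)) = 1"
    and M: "M = real (N * R) powr (1 / p)"
  shows "\<exists>T \<in> Lp_isometries p.
    T (abs_L0 (stepf (N * (R * r)) v)) \<in> monotone_class ((2 * real N + 1) * M) (stepf N (\<lambda>j. 2 * M * real j)) \<and>
    (\<forall>c C. (\<forall>i. \<bar>c i\<bar> \<le> C) \<longrightarrow>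
      Lp_norm p (T (abs_L0 (stepf N c)) - abs_L0 (stepf N c)) \<le> 2 * C * (4 / R) powr (1 / p))"
proof -
  define L where "L = R * r"
  define n where "n = N * L"
  have L: "0 < L" "2 * r \<le> L" using R r by (simp_all add: L_def)
  have n: "0 < n" using N L by (simp add: n_def)
  define \<Phi> where "\<Phi> j \<sigma> \<beta> e \<longleftrightarrow> bij_betw \<sigma> {..<L} {..<L} \<and> (\<forall>i<L. 0 < \<beta> i) \<and> sum \<beta> {..<L} = real L \<and>
    (\<forall>i. e i * e i = 1) \<and>
    (\<forall>i k. i \<le> k \<longrightarrow> k < L \<longrightarrow>
      e i * (1 / \<beta> i) powr (1 / p) * v (j * L + \<sigma> i) \<le> e k * (1 / \<beta> k) powr (1 / p) * v (j * L + \<sigma> k)) \<and>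
    (\<forall>i<L. \<bar>e i * (1 / \<beta> i) powr (1 / p) * v (j * L + \<sigma> i)\<bar> \<le> ((\<Sum>i<L. \<bar>v (j * L + i)\<bar> powr p) / r) powr (1 / p)) \<and>
    (\<Sum>i<L. \<beta> i * \<bar>e i * (1 / \<beta> i) powr (1 / p) - 1\<bar> powr p) \<le> 2 powr p * (4 * r)" for j \<sigma> \<beta> e
  have "\<exists>\<sigma> \<beta> e. \<Phi> j \<sigma> \<beta> e" for j
    unfolding \<Phi>_def by (rule block_rearrangement[OF p r L(2)]) (rule v)
  then obtain \<sigma> \<beta> e where \<Phi>: "\<And>j. \<Phi> j (\<sigma> j) (\<beta> j) (e j)" by metis
  have \<sigma>: "bij_betw (\<sigma> j) {..<L} {..<L}" and \<beta>: "\<And>i. i < L \<Longrightarrow> 0 < \<beta> j i" "sum (\<beta> j) {..<L} = real L"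
    and e: "e j i * e j i = 1"
    and block_mono: "\<And>k. i \<le> k \<Longrightarrow> k < L \<Longrightarrow>
      e j i * (1 / \<beta> j i) powr (1 / p) * v (j * L + \<sigma> j i) \<le> e j k * (1 / \<beta> j k) powr (1 / p) * v (j * L + \<sigma> j k)"
    and block_bound: "i < L \<Longrightarrow> \<bar>e j i * (1 / \<beta> j i) powr (1 / p) * v (j * L + \<sigma> j i)\<bar>
      \<le> ((\<Sum>i<L. \<bar>v (j * L + i)\<bar> powr p) / r) powr (1 / p)"
    and defect: "(\<Sum>i<L. \<beta> j i * \<bar>e j i * (1 / \<beta> j i) powr (1 / p) - 1\<bar> powr p) \<le> 2 powr p * (4 * r)" for i j
    using \<Phi>[of j] unfolding \<Phi>_def by simp_all
  \<comment> \<open>The data of the blocks are glued together: cell k is number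
    \<open>k mod L\<close> of block \<open>k div L\<close>, and \<open>S\<close> permutes cells
    within their blocks.\<close>
  define S where "S k = (k div L) * L + \<sigma> (k div L) (k mod L)" for k
  define B where "B k = \<beta> (k div L) (k mod L)" for k
  define E where "E k = e (k div L) (k mod L)" for k
  have modL: "k mod L < L" for k using L by simp
  have \<sigma>L: "\<sigma> j i < L" if "i < L" for i j using \<sigma>[of j] that by (auto simp: bij_betw_def)
  have S_div: "S k div L = k div L" and S_mod: "S k mod L = \<sigma> (k div L) (k mod L)" for k
    using \<sigma>L[OF modL] L by (simp_all add: S_def)
  have div_less: "k div L < N" if "k < n" for k
    using that by (simp add: n_def less_mult_imp_div_less)
  have S_less: "S k < n" if "k < n" for k
  proof -
    have "S k < (k div L + 1) * L" using \<sigma>L[OF modL] by (simp add: S_def)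
    also have "\<dots> \<le> n" unfolding n_def using div_less[OF that] by (intro mult_right_mono) auto
    finally show ?thesis .
  qed
  have "inj_on S {..<n}"
  proof (rule inj_onI)
    fix k l assume "S k = S l"
    then have eq: "k div L = l div L" and "\<sigma> (k div L) (k mod L) = \<sigma> (l div L) (l mod L)"
      using S_div S_mod by metis+
    then have "k mod L = l mod L"
      using bij_betw_imp_inj_on[OF \<sigma>] modL by (metis inj_onD lessThan_iff)
    with eq show "k = l" by (metis div_mult_mod_eq)
  qed
  moreover from this have "S ` {..<n} = {..<n}"
    using S_less by (intro endo_inj_surj) auto
  ultimately have S: "bij_betw S {..<n} {..<n}" by (simp add: bij_betw_def)
  define b where "b k = B k / n" for k
  define t where "t k = sum b {..<k}" for k
  have b: "0 < b k" for k using \<beta>(1) modL n by (simp add: b_def B_def)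
  \<comment> \<open>The stretch factors of a block sum to L, so stretching leaves the block
    boundaries at j / N.\<close>
  have t_block: "t (j * L) = j / N" for j
  proof -
    have "sum B {..<j * L} = (\<Sum>m<j. \<Sum>i<L. \<beta> m i)"
      unfolding sum_blocks by (intro sum.cong refl) (simp add: B_def)
    then have "sum B {..<j * L} = real j * real L" using \<beta>(2) by simp
    then show ?thesis using L by (simp add: t_def b_def n_def sum_divide_distrib[symmetric])
  qed
  have t_mono: "t k \<le> t l" if "k \<le> l" for k l
    unfolding t_def by (rule partial_sums_mono[of l]) (use that b in auto)
  have target: "interval_partition n t b"
    unfolding t_def using b t_block[of N] N by (intro interval_partition_partial_sums) (auto simp: t_def n_def)
  have source: "interval_partition n (\<lambda>k. real (S k) / real n) (\<lambda>_. 1 / real n)"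
    by (rule interval_partition_uniform[OF n S])
  interpret piecewise_affine p n "\<lambda>k. real (S k) / real n" "\<lambda>_. 1 / real n" t b E
    using p source target e by unfold_locales (auto simp: E_def)
  have cell_block: "nat \<lfloor>real N * x\<rfloor> = k div L" if "x \<in> {t k..<t k + b k}" for k x
  proof -
    have le: "k div L * L \<le> k" "Suc k \<le> (k div L + 1) * L"
      using div_mult_mod_eq[of k L] modL[of k] unfolding add_mult_distrib by linarith+
    have "real (k div L) / N \<le> x" using t_mono[OF le(1)] t_block[of "k div L"] that by simp
    moreover have "x < real (k div L + 1) / N"
      using t_mono[OF le(2)] t_block[of "k div L + 1"] that by (simp add: t_def)
    moreover from calculation(1) have "0 \<le> x" by (rule order_trans[rotated]) simp
    ultimately have "x \<in> {real (k div L) / real N..<real (k div L) / real N + 1 / real N}" "0 \<le> x"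
      by (simp_all add: add_divide_distrib)
    then show ?thesis using mem_cell_iff[OF N] by blast
  qed
  have opf_step: "opf (stepf n w) x = E k * (1 / B k) powr (1 / p) * w (S k)"
    if k: "k < n" "x \<in> {t k..<t k + b k}" for w k x
  proof -
    define q where "q = real (S k) / real n + 1 / real n / b k * (x - t k)"
    have cell: "q \<in> {real (S k) / real n..<real (S k) / real n + 1 / real n}"
      unfolding q_def by (rule source_point[OF k])
    moreover have "0 \<le> real (S k) / real n" by simp
    ultimately have "0 \<le> q" unfolding atLeastLessThan_iff by linarith
    then have "nat \<lfloor>real n * q\<rfloor> = S k" using mem_cell_iff[OF n] cell by blast
    then have "stepf n w q = w (S k)" by (simp only: stepf_def)
    moreover have "1 / real n / b k = 1 / B k" using n by (simp add: b_def)
    ultimately show ?thesis using opf_eq[OF k, of "stepf n w"] by (simp only: q_def)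
  qed
  define T where "T = restrict op (Lp p)"
  have T: "T (abs_L0 (stepf m w)) = abs_L0 (opf (stepf m w))" for m w
    using step_in_Lp[OF p] by (simp add: T_def op_abs)
  define y where "y k = E k * (1 / B k) powr (1 / p) * v (S k)" for k
  have norm_sum: "(\<Sum>k<n. \<bar>v k\<bar> powr p) = n"
  proof -
    have "Lp_norm p (abs_L0 (stepf n v)) = (\<Sum>i<n. 1 / real n * \<bar>v i\<bar> powr p) powr (1 / p)"
    proof (rule Lp_norm_piecewise_constant[OF p interval_partition_uniform[OF n bij_betw_id]])
      fix i x assume x: "x \<in> {real (id i) / real n..<real (id i) / real n + 1 / real n}"
      moreover have "0 \<le> real (id i) / real n" by simp
      ultimately have "0 \<le> x" unfolding atLeastLessThan_iff by linarith
      then show "stepf n v x = v i" using mem_cell_iff[OF n] x by (simp add: stepf_def)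
    qed simp
    then have "(\<Sum>i<n. 1 / real n * \<bar>v i\<bar> powr p) powr (1 / p) = 1"
      using norm by (simp add: n_def L_def)
    then have "((\<Sum>i<n. 1 / real n * \<bar>v i\<bar> powr p) powr (1 / p)) powr p = 1" by simp
    then have "(\<Sum>i<n. 1 / real n * \<bar>v i\<bar> powr p) = 1"
      using p by (simp add: powr_powr sum_nonneg)
    then show ?thesis using n by (simp add: sum_divide_distrib[symmetric])
  qed
  \<comment> \<open>The p-th powers in one block sum to at most the total n, which norm 1
    prescribes, and n / r equals N * R.\<close>
  have y_bound: "\<bar>y k\<bar> \<le> M" if k: "k < n" for k
  proof -
    let ?j = "k div L"
    have "(\<Sum>i<L. \<bar>v (?j * L + i)\<bar> powr p) \<le> (\<Sum>j<N. \<Sum>i<L. \<bar>v (j * L + i)\<bar> powr p)"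
      by (rule member_le_sum[of ?j "{..<N}" "\<lambda>j. \<Sum>i<L. \<bar>v (j * L + i)\<bar> powr p"])
        (use div_less[OF k] in \<open>auto intro: sum_nonneg\<close>)
    also have "\<dots> = n" using norm_sum by (simp add: n_def sum_blocks)
    finally have le: "(\<Sum>i<L. \<bar>v (?j * L + i)\<bar> powr p) / r \<le> n / r"
      by (rule divide_right_mono) simp
    have "\<bar>y k\<bar> \<le> ((\<Sum>i<L. \<bar>v (?j * L + i)\<bar> powr p) / r) powr (1 / p)"
      unfolding y_def E_def B_def S_def by (rule block_bound[OF modL])
    also have "\<dots> \<le> (n / r) powr (1 / p)"
    proof (rule powr_mono2[OF _ _ le])
      show "0 \<le> (\<Sum>i<L. \<bar>v (?j * L + i)\<bar> powr p) / r"
        by (intro divide_nonneg_nonneg sum_nonneg) auto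
    qed (use p in simp)
    also have "real n / r = N * R" using r by (simp add: n_def L_def)
    finally show ?thesis by (simp add: M)
  qed
  have M0: "0 \<le> M" by (simp add: M)
  \<comment> \<open>The shift by \<open>2 * M\<close> per block outweighs any drop between two blocks.\<close>
  define y' where "y' k = y k + 2 * M * real (k div L)" for k
  have y'_mono: "y' i \<le> y' k" if ik: "i \<le> k" "k < n" for i k
  proof (cases "i div L = k div L")
    case True
    then have "i mod L \<le> k mod L"
      using ik by (metis div_mult_mod_eq nat_add_left_cancel_le)
    then have "y i \<le> y k"
      unfolding y_def E_def B_def S_def True by (rule block_mono[OF _ modL])
    then show ?thesis by (simp add: y'_def True)
  next
    case False
    then have "i div L + 1 \<le> k div L" using div_le_mono[OF ik(1), of L] by simp
    then have "2 * M * real (i div L + 1) \<le> 2 * M * real (k div L)"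
      using M0 by (intro mult_left_mono) linarith+
    then show ?thesis
      using y_bound[of i] y_bound[of k] ik by (simp add: y'_def algebra_simps abs_le_iff)
  qed
  have y'_bound: "\<bar>y' k\<bar> \<le> (2 * real N + 1) * M" if k: "k < n" for k
  proof -
    have "2 * M * real (k div L) \<le> 2 * M * real N"
      using M0 div_less[OF k] by (intro mult_left_mono) auto
    moreover have "0 \<le> 2 * M * real (k div L)" using M0 by simp
    ultimately have "\<bar>y' k\<bar> \<le> M + 2 * M * real N"
      using y_bound[OF k] M0 unfolding y'_def by linarith
    then show ?thesis by (simp add: algebra_simps)
  qed
  obtain g where g: "mono g" "\<forall>x. continuous (at_right x) g" "\<forall>x. \<bar>g x\<bar> \<le> (2 * real N + 1) * M"
      and gy: "\<And>k x. k < n \<Longrightarrow> x \<in> {t k..<t k + b k} \<Longrightarrow> g x = y' k"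
    using monotone_step_extension[of n b y' "(2 * real N + 1) * M"] b n y'_mono y'_bound
    unfolding t_def by metis
  have [measurable]: "g \<in> unit_measurable" using g(1) by (rule mono_unit_measurable)
  \<comment> \<open>On cell k the staircase has the value that was added to \<open>y k\<close> in
    \<open>y' k\<close>, since the cell lies in block \<open>k div L\<close>.\<close>
  have "T (abs_L0 (stepf n v)) = abs_L0 (\<lambda>x. g x - stepf N (\<lambda>j. 2 * M * real j) x)"
    unfolding T
  proof (subst abs_L0_eq_iff)
    show "AE x in unit_interval_measure. opf (stepf n v) x = g x - stepf N (\<lambda>j. 2 * M * real j) x"
      using AE_unit_interval_less_1
    proof eventually_elim
      case (elim x)
      then obtain k where k: "k < n" "x \<in> {t k..<t k + b k}" by (rule target_cases)
      show ?case
        unfolding opf_step[OF k] gy[OF k] stepf_def cell_block[OF k(2)] by (simp add: y'_def y_def)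
    qed
  qed (auto simp: opf_measurable)
  then have "T (abs_L0 (stepf n v)) \<in> monotone_class ((2 * real N + 1) * M) (stepf N (\<lambda>j. 2 * M * real j))"
    unfolding monotone_class_def using g by blast
  moreover have "Lp_norm p (T (abs_L0 (stepf N c)) - abs_L0 (stepf N c)) \<le> 2 * C * (4 / R) powr (1 / p)"
    if c: "\<And>i. \<bar>c i\<bar> \<le> C" for c C
  proof -
    have C: "0 \<le> C" using c[of 0] by linarith
    define \<delta> where "\<delta> k = E k * (1 / B k) powr (1 / p) - 1" for k
    define f where "f x = opf (stepf N c) x - stepf N c x" for x
    have [measurable]: "f \<in> unit_measurable" unfolding f_def by (simp add: opf_measurable)
    \<comment> \<open>A function constant on blocks is unaffected by permutations inside them, so
      the operator merely multiplies it by the weights, and the displacement is governed by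
      \<open>defect\<close>. The N bounds 2 powr p * (4 * r), divided by n = N * R * r, leave 2 powr
      p * (4 / R).\<close>
    have refine: "stepf N c = stepf n (\<lambda>i. c (i div L))" unfolding n_def by (rule stepf_refine[OF L(1)])
    have norm_f: "Lp_norm p (abs_L0 f) = (\<Sum>k<n. b k * \<bar>\<delta> k * c (k div L)\<bar> powr p) powr (1 / p)"
    proof (rule Lp_norm_piecewise_constant[OF p target])
      fix k x assume k: "k < n" "x \<in> {t k..<t k + b k}"
      have "stepf N c x = c (k div L)" by (simp add: stepf_def cell_block[OF k(2)])
      moreover have "opf (stepf N c) x = E k * (1 / B k) powr (1 / p) * c (k div L)"
        unfolding refine opf_step[OF k] S_div ..
      ultimately show "f x = \<delta> k * c (k div L)" by (simp add: f_def \<delta>_def algebra_simps)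
    qed simp
    have "(\<Sum>k<n. b k * \<bar>\<delta> k * c (k div L)\<bar> powr p) \<le> (\<Sum>k<n. C powr p / n * (B k * \<bar>\<delta> k\<bar> powr p))"
    proof (rule sum_mono)
      fix k
      have "\<bar>c (k div L)\<bar> powr p \<le> C powr p" using c p by (intro powr_mono2) auto
      then have "b k * \<bar>\<delta> k\<bar> powr p * \<bar>c (k div L)\<bar> powr p \<le> b k * \<bar>\<delta> k\<bar> powr p * C powr p"
        using b[of k] by (intro mult_left_mono) auto
      then show "b k * \<bar>\<delta> k * c (k div L)\<bar> powr p \<le> C powr p / n * (B k * \<bar>\<delta> k\<bar> powr p)"
        by (simp add: abs_mult powr_mult b_def algebra_simps)
    qed
    also have "\<dots> = C powr p / n * (\<Sum>j<N. \<Sum>i<L. \<beta> j i * \<bar>e j i * (1 / \<beta> j i) powr (1 / p) - 1\<bar> powr p)"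
      unfolding sum_distrib_left[symmetric] n_def sum_blocks by (simp add: B_def E_def \<delta>_def)
    also have "\<dots> \<le> C powr p / n * (\<Sum>j<N. 2 powr p * (4 * r))"
      by (intro mult_left_mono sum_mono defect) auto
    also have "\<dots> = (2 * C) powr p * (4 / R)"
      using N R r by (simp add: n_def L_def powr_mult)
    finally have le: "(\<Sum>k<n. b k * \<bar>\<delta> k * c (k div L)\<bar> powr p) \<le> (2 * C) powr p * (4 / R)" .
    have "0 \<le> (\<Sum>k<n. b k * \<bar>\<delta> k * c (k div L)\<bar> powr p)"
      using b by (intro sum_nonneg) (simp add: less_imp_le)
    then have "Lp_norm p (abs_L0 f) \<le> ((2 * C) powr p * (4 / R)) powr (1 / p)"
      unfolding norm_f using p le by (intro powr_mono2) auto
    also have "\<dots> = ((2 * C) powr p) powr (1 / p) * (4 / R) powr (1 / p)" by (rule powr_mult)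
    also have "((2 * C) powr p) powr (1 / p) = 2 * C" using p C by (simp add: powr_powr)
    finally show ?thesis unfolding T by (simp add: abs_L0_minus opf_measurable f_def[abs_def])
  qed
  moreover have "T \<in> Lp_isometries p" unfolding T_def by (rule op_isometry)
  ultimately show ?thesis unfolding n_def L_def by blast
qed


section \<open>Metrizability of the greatest equivariant compactification\<close>

text \<open>Zero coefficients are replaced by the small d, because the rearrangement needs nonzero
  values, and the result is normalised.\<close>

lemma sphere_step_approximation:
  assumes p: "1 \<le> p" and f: "f \<in> Lp p" "Lp_norm p f = 1" and e: "0 < e"
  shows "\<exists>m v. (\<forall>i. v i \<noteq> 0) \<and> Lp_norm p (abs_L0 (stepf (2 ^ m) v)) = 1 \<and>
    Lp_norm p (f - abs_L0 (stepf (2 ^ m) v)) < e"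
proof -
  interpret Metric_space "Lp p" "\<lambda>f g. Lp_norm p (f - g)" by (rule Metric_space_Lp[OF p])
  \<comment> \<open>Approximation and removal of zeros cost d each, and normalisation costs a
    further 2 d, so 4 d must not exceed e. The bound 1/4 keeps the norm a above 1/2.\<close>
  define d where "d = min (e / 4) (1 / 4)"
  have d: "0 < d" "4 * d \<le> e" "4 * d \<le> 1" using e by (auto simp: d_def)
  obtain m c where c: "Lp_norm p (abs_L0 (stepf (2 ^ m) c) - f) < d"
    using step_approximation[OF p f(1) d(1)] by blast
  define w where "w i = (if c i = 0 then d else c i)" for i
  let ?g = "abs_L0 (stepf (2 ^ m) w)"
  have g: "?g \<in> Lp p" using p by (rule step_in_Lp)
  have "Lp_norm p (?g - abs_L0 (stepf (2 ^ m) c)) \<le> d"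
    unfolding abs_L0_minus[OF stepf_measurable stepf_measurable]
  proof (rule bounded_in_Lp(2)[OF _ _ p])
    show "(\<lambda>x. stepf (2 ^ m) w x - stepf (2 ^ m) c x) \<in> unit_measurable" by measurable
    show "\<bar>stepf (2 ^ m) w x - stepf (2 ^ m) c x\<bar> \<le> d" for x
      using d by (simp add: stepf_def w_def)
  qed
  then have gf: "Lp_norm p (?g - f) < 2 * d"
    using triangle[OF g step_in_Lp[OF p, of "2 ^ m" c] f(1)] c by linarith
  define a where "a = Lp_norm p ?g"
  have 0: "0 \<in> Lp p" by (simp add: Lp_def p_integrable_zero)
  have a: "\<bar>1 - a\<bar> < 2 * d"
    using triangle[OF g f(1) 0] triangle[OF f(1) g 0] gf commute[of ?g f] f(2) by (simp add: a_def)
  then have a0: "0 < a" using d by linarith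
  define v where "v i = (1 / a) * w i" for i
  have v_eq: "stepf (2 ^ m) v = (\<lambda>x. (1 / a) * stepf (2 ^ m) w x)"
    by (simp add: fun_eq_iff stepf_def v_def)
  have v: "abs_L0 (stepf (2 ^ m) v) = (1 / a) *\<^sub>R ?g"
    by (simp add: abs_L0_scaleR v_eq)
  have "v i \<noteq> 0" for i using a0 d by (simp add: v_def w_def)
  moreover have "Lp_norm p (abs_L0 (stepf (2 ^ m) v)) = 1"
    using a0 p unfolding v by (subst Lp_norm_scaleR) (simp_all add: a_def)
  moreover have "Lp_norm p (f - abs_L0 (stepf (2 ^ m) v)) < e"
  proof -
    have "?g - (1 / a) *\<^sub>R ?g = (1 - 1 / a) *\<^sub>R ?g" by (simp add: scaleR_diff_left)
    then have "Lp_norm p (?g - abs_L0 (stepf (2 ^ m) v)) = \<bar>1 - 1 / a\<bar> * a"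
      using Lp_norm_scaleR[OF p, of "1 - 1 / a" ?g] by (simp add: v a_def)
    also have "\<dots> = \<bar>(1 - 1 / a) * a\<bar>" using a0 by (simp add: abs_mult)
    also have "(1 - 1 / a) * a = a - 1" using a0 by (simp add: field_simps)
    finally have "Lp_norm p (?g - abs_L0 (stepf (2 ^ m) v)) < 2 * d" using a by linarith
    moreover have "Lp_norm p (f - ?g) < 2 * d" using gf commute[of f ?g] by simp
    ultimately show ?thesis
      using triangle[OF f(1) g step_in_Lp[OF p, of "2 ^ m" v]] d by linarith
  qed
  ultimately show ?thesis by blast
qed

lemma Lp_isometries_inverse:
  assumes p: "1 \<le> p" and T: "T \<in> Lp_isometries p"
  shows "(\<lambda>f\<in>Lp p. inv_into (Lp p) T f) \<in> Lp_isometries p"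
proof -
  interpret group "Lp_isometry_group p" by (rule group_Lp_isometry_group[OF p])
  show ?thesis using inv_closed[of T] T by (simp add: inv_Lp_isometry_group[OF p T])
qed

text \<open>An isometry moves d exactly as far as its inverse does. The construction carries points
  of the sphere into \<open>K\<close>, whereas the orbit leads out of \<open>K\<close>, so inverses
  are required.\<close>

lemma almost_fixing_inverse:
  assumes p: "1 \<le> p" and T: "T \<in> almost_fixing p n"
  shows "(\<lambda>f\<in>Lp p. inv_into (Lp p) T f) \<in> almost_fixing p n"
proof -
  let ?T' = "\<lambda>f\<in>Lp p. inv_into (Lp p) T f"
  have TI: "T \<in> Lp_isometries p" using T by (simp add: almost_fixing_def)
  have "Lp_norm p (?T' d - d) = Lp_norm p (T d - d)" if d: "d \<in> Lp p" for d
  proof -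
    note inv = Lp_isometries_inv_into[OF TI d]
    have "Lp_norm p (?T' d - d) = Lp_norm p (T (?T' d) - T d)"
      using Lp_isometries_norm_diff[OF p TI _ d, of "?T' d"] inv d by simp
    then show ?thesis using inv d Lp_norm_minus_commute[OF p] by simp
  qed
  then show ?thesis
    using T Lp_isometries_inverse[OF p TI] step_in_Lp[OF p] by (simp add: almost_fixing_def)
qed

text \<open>Near any f there is a nonvanishing step function x of norm 1, and some T in
  \<open>almost_fixing p n\<close> takes it into \<open>K\<close>; applying the inverse of T
  exhibits x in the orbit of \<open>K\<close>. The set \<open>K\<close> depends on n but not on the
  grid of x.\<close>

lemma exists_compact_dense_orbit:
  assumes p: "1 \<le> p"
  shows "\<exists>K. compactin (Lp_sphere p) K \<and>
    topspace (Lp_sphere p) \<subseteq> Lp_sphere p closure_of (\<Union>T\<in>almost_fixing p n. T ` K)"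
proof -
  interpret Metric_space "Lp p" "\<lambda>f g. Lp_norm p (f - g)" by (rule Metric_space_Lp[OF p])
  \<comment> \<open>R = 2 ^ k is taken large enough that step functions bounded by n are moved by
    less than 1 / (n + 1), the tolerance of \<open>almost_fixing\<close>.\<close>
  have "(\<lambda>k. (4 / 2 ^ k) powr (1 / p)) \<longlonglongrightarrow> 0"
  proof (rule tendsto_zero_powrI[where b = "1 / p"])
    have "(\<lambda>k. 4 * (1 / 2 :: real) ^ k) \<longlonglongrightarrow> 4 * 0"
      by (intro tendsto_mult tendsto_const LIMSEQ_realpow_zero) auto
    then show "(\<lambda>k. 4 / 2 ^ k :: real) \<longlonglongrightarrow> 0" by (simp add: power_divide)
  qed (use p in auto)
  from tendsto_mult[OF tendsto_const[of "2 * real n"] this]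
  have "(\<lambda>k. 2 * real n * (4 / 2 ^ k) powr (1 / p)) \<longlonglongrightarrow> 0" by simp
  then have "\<forall>\<^sub>F k in sequentially. 2 * real n * (4 / 2 ^ k) powr (1 / p) < 1 / (real n + 1)"
    by (rule order_tendstoD(2)) simp
  moreover have "\<forall>\<^sub>F k in sequentially. 1 \<le> k" by (rule eventually_ge_at_top)
  ultimately have "\<forall>\<^sub>F k in sequentially. 2 * real n * (4 / 2 ^ k) powr (1 / p) < 1 / (real n + 1) \<and> 1 \<le> k"
    by (rule eventually_conj)
  then obtain k where k: "2 * real n * (4 / 2 ^ k) powr (1 / p) < 1 / (real n + 1)" "1 \<le> k"
    by (auto simp: eventually_sequentially)
  define N :: nat where "N = 2 ^ n"
  define R :: nat where "R = 2 ^ k"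
  have N: "0 < N" by (simp add: N_def)
  have R: "2 \<le> R" using power_increasing[OF k(2), of "2::nat"] by (simp add: R_def)
  define M where "M = real (N * R) powr (1 / p)"
  let ?s = "stepf N (\<lambda>j. 2 * M * real j)"
  define K where "K = monotone_class ((2 * real N + 1) * M) ?s \<inter> topspace (Lp_sphere p)"
  \<comment> \<open>At x = 1 the staircase index reaches N itself, not N - 1.\<close>
  have "\<bar>?s x\<bar> \<le> 2 * M * N" if "x \<in> {0..1}" for x
  proof -
    have "real N * x \<le> real N" using that by (simp add: mult_left_le)
    then have "real (nat \<lfloor>real N * x\<rfloor>) \<le> N" by linarith
    then have "2 * M * real (nat \<lfloor>real N * x\<rfloor>) \<le> 2 * M * N"
      by (intro mult_left_mono) (auto simp: M_def)
    then show ?thesis by (simp add: stepf_def M_def abs_mult)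
  qed
  then have "compactin (Lp_sphere p) K"
    unfolding K_def by (intro compactin_Lp_sphere_monotone_class p) auto
  moreover have "f \<in> Lp_sphere p closure_of (\<Union>T\<in>almost_fixing p n. T ` K)"
    if fS: "f \<in> topspace (Lp_sphere p)" for f
    unfolding in_closure_of
  proof (intro conjI allI impI fS)
    fix U assume U: "f \<in> U \<and> openin (Lp_sphere p) U"
    then obtain W where W: "openin mtopology W" "U = W \<inter> {f \<in> Lp p. Lp_norm p f = 1}"
      unfolding Lp_sphere_def Lp_topology_def openin_subtopology by blast
    then obtain e where e: "0 < e" "mball f e \<subseteq> W"
      using U unfolding openin_mtopology by blast
    have f: "f \<in> Lp p" "Lp_norm p f = 1" using fS by (auto simp: topspace_Lp_sphere[OF p])
    obtain m v where v: "\<And>i. v i \<noteq> 0" and norm: "Lp_norm p (abs_L0 (stepf (2 ^ m) v)) = 1"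
        and dist: "Lp_norm p (f - abs_L0 (stepf (2 ^ m) v)) < e"
      using sphere_step_approximation[OF p f e(1)] by blast
    let ?x = "abs_L0 (stepf (2 ^ m) v)"
    have x: "?x \<in> Lp p" using p by (rule step_in_Lp)
    \<comment> \<open>Refining the dyadic grid by the factor N * R gives N * (R * 2 ^ m) cells, the
      form required with r = 2 ^ m.\<close>
    define w where "w i = v (i div (N * R))" for i
    have "stepf (2 ^ m) v = stepf (2 ^ m * (N * R)) w"
      unfolding w_def using N R by (intro stepf_refine) simp
    then have xw: "?x = abs_L0 (stepf (N * (R * 2 ^ m)) w)" by (simp add: ac_simps)
    have "\<exists>T \<in> Lp_isometries p. T ?x \<in> monotone_class ((2 * real N + 1) * M) ?s \<and>
        (\<forall>c C. (\<forall>i. \<bar>c i\<bar> \<le> C) \<longrightarrow>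
          Lp_norm p (T (abs_L0 (stepf N c)) - abs_L0 (stepf N c)) \<le> 2 * C * (4 / R) powr (1 / p))"
      unfolding xw
      by (rule step_to_monotone_class[OF p N R _ _ _ M_def]) (use v norm in \<open>simp_all add: w_def flip: xw\<close>)
    then obtain T where T: "T \<in> Lp_isometries p" and Tx: "T ?x \<in> monotone_class ((2 * real N + 1) * M) ?s"
        and Tc: "\<And>c C. (\<forall>i. \<bar>c i\<bar> \<le> C) \<Longrightarrow>
          Lp_norm p (T (abs_L0 (stepf N c)) - abs_L0 (stepf N c)) \<le> 2 * C * (4 / R) powr (1 / p)"
      by blast
    have "T \<in> almost_fixing p n"
      unfolding almost_fixing_def
    proof (intro CollectI conjI T allI impI)
      fix c :: "nat \<Rightarrow> real" assume "\<forall>i. \<bar>c i\<bar> \<le> real n"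
      from Tc[OF this] k(1)
      show "Lp_norm p (T (abs_L0 (stepf (2 ^ n) c)) - abs_L0 (stepf (2 ^ n) c)) < 1 / (real n + 1)"
        unfolding N_def R_def by simp
    qed
    then have T': "(\<lambda>f\<in>Lp p. inv_into (Lp p) T f) \<in> almost_fixing p n"
      by (rule almost_fixing_inverse[OF p])
    have TL: "T ?x \<in> Lp p" using T x by (rule Lp_isometries_closed)
    have "Lp_norm p (T ?x) = 1" using T x norm by (simp add: Lp_isometries_def)
    then have "T ?x \<in> K" using Tx TL by (simp add: K_def topspace_Lp_sphere[OF p])
    moreover have "(\<lambda>f\<in>Lp p. inv_into (Lp p) T f) (T ?x) = ?x"
      using TL Lp_isometries_inv_into(3)[OF T x] by simp
    ultimately have "?x \<in> (\<lambda>f\<in>Lp p. inv_into (Lp p) T f) ` K" by (metis imageI)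
    then have "?x \<in> (\<Union>T\<in>almost_fixing p n. T ` K)" using T' by blast
    moreover have "?x \<in> mball f e" using f(1) x dist by simp
    then have "?x \<in> U" using e(2) x norm unfolding W(2) by blast
    ultimately show "\<exists>y. y \<in> (\<Union>T\<in>almost_fixing p n. T ` K) \<and> y \<in> U" by blast
  qed
  ultimately show ?thesis by blast
qed

theorem mainTheorem8:
  fixes p :: real and B :: "'k topology" and actB :: "(L0 \<Rightarrow> L0) \<Rightarrow> 'k \<Rightarrow> 'k" and \<beta> :: "L0 \<Rightarrow> 'k"
  assumes "1 \<le> p"
    and "greatest_equivariant_compactification (Lp_isometry_group p) (Lp_strong_operator_topology p)
      (Lp_sphere p) (\<lambda>T f. T f) B actB \<beta>"
  shows "metrizable_space B"
proof -
  obtain K where "\<And>n. compactin (Lp_sphere p) (K n)"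
      "\<And>n. topspace (Lp_sphere p) \<subseteq> Lp_sphere p closure_of (\<Union>T\<in>almost_fixing p n. T ` K n)"
    using exists_compact_dense_orbit[OF assms(1)] by metis
  moreover have "almost_fixing p n \<subseteq> carrier (Lp_isometry_group p)" for n
    by (auto simp: almost_fixing_def)
  moreover have "equivariant_compactification (Lp_isometry_group p) (Lp_strong_operator_topology p)
      (Lp_sphere p) (\<lambda>T f. T f) B actB \<beta>"
    using assms(2) by (simp add: greatest_equivariant_compactification_def)
  ultimately show ?thesis
    using almost_fixing_small[OF assms(1)]
    by (intro metrizable_equivariant_compactification[OF G_space_Lp_sphere[OF assms(1)]
        metrizable_Lp_sphere[OF assms(1)], where V = "almost_fixing p" and K = K])
qed

end
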